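(* Let $f:N\to P$ be a $C^1$ map between $C^1$ manifolds $N$ and $P$, let $X$ and $Y$ be $C^1$ submanifolds of $N$ such that $f|_X$ and $f|_Y$ have constant rank, and let $0$ denote a point of $Y\cap\overline{X}$. Then the following conditions are equivalent: (i) $X$ is $(a_f)$-regular over $Y$ at $0$; (ii) $X$ is $(a_f^s)$-regular over $Y$ at $0$.
   Context: Induced foliation: if $f$ has constant rank on a submanifold $S$ of $N$, then $\mathfrak{F}^f_S$ denotes the foliation of $S$ induced by $f$, whose leaves are the connected components of the fibres of $f|_S$; for $x\in S$, $T_x(\mathfrak{F}^f_S)=\ker d_x(f|_S)$ is the tangent space at $x$ of the leaf through $x$. $(a_f)$-regularity: $X$ is $(a_f)$-regular over $Y$ at $y\in Y\cap\overline{X}$ if for every sequence $\{x_i\}$ in $X$ converging to $y$ such that $T_{x_i}(\mathfrak{F}^f_X)$ converges (in the Grassmann bundle of $TN$) to some $\tau$, one has $T_y(\mathfrak{F}^f_Y)\subset\tau$. $(a_f^s)$-regularity: $X$ is $(a_f^s)$-regular over $Y$ at $y\in Y\cap\overline{X}$ if, for every $C^1$ local retraction $\pi$ defined near $y$ onto the leaf $L$ of $\mathfrak{F}^f_Y$ passing through $y$ (i.e. a $C^1$ map $\pi:W\to L$ defined on an open neighbourhood $W$ of $y$ in $N$ with $\pi(z)=z$ for all $z\in W\cap L$), there is a neighbourhood $U$ of $y$ in $N$ (with $U\subset W$) such that $\pi|_{X\cap U}$ is a submersion on every leaf of $\mathfrak{F}^f_X\cap U$, i.e. for every $x\in X\cap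 U$, $d_x\pi$ maps $T_x(\mathfrak{F}^f_X)$ onto $T_{\pi(x)}L$. *)

theory Defs
  imports "HOL-Analysis.Analysis"
begin

section \<open>C1 manifolds\<close>

text \<open>
  A manifold is a whole type \<open>'a\<close> (its topology is that of the type) with an atlas of charts into
  a linear subspace \<open>model\<close> of a Euclidean space \<open>'e\<close>.  The model is a subspace and not the type
  \<open>'e\<close> itself because Euclidean space types have positive dimension: with \<open>model = {0}\<close>
  manifolds of dimension 0 are included, and \<open>model = UNIV\<close> is the usual case.
\<close>

record ('a, 'e) chart =
  cdom :: "'a set"
  cmap :: "'a \<Rightarrow> 'e"

record ('a, 'e) manifold =
  model :: "'e set"
  atlas :: "('a, 'e) chart set"

definition cinv :: "('a, 'e) chart \<Rightarrow> 'e \<Rightarrow> 'a" where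
  "cinv c = inv_into (cdom c) (cmap c)"

definition is_chart :: "'e set \<Rightarrow> ('a::topological_space, 'e::euclidean_space) chart \<Rightarrow> bool" where
  "is_chart M c \<longleftrightarrow>
     open (cdom c) \<and> openin (top_of_set M) (cmap c ` cdom c) \<and>
     homeomorphism (cdom c) (cmap c ` cdom c) (cmap c) (cinv c)"

text \<open>
  \<open>S\<close> is a relatively open subset of the subspace \<open>M\<close>.  A derivative within \<open>S\<close> is determined on
  \<open>M\<close> only; accordingly, derivatives are below applied to vectors of the model space only.
\<close>

definition C1_on :: "'e::euclidean_space set \<Rightarrow> 'e set \<Rightarrow> ('e \<Rightarrow> 'g::euclidean_space) \<Rightarrow> bool" where
  "C1_on M S g \<longleftrightarrow>
     (\<exists>g'. (\<forall>x\<in>S. (g has_derivative g' x) (at x within S)) \<and>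
           (\<forall>v\<in>M. continuous_on S (\<lambda>x. g' x v)))"

definition C1_compatible ::
    "'e set \<Rightarrow> ('a::topological_space, 'e::euclidean_space) chart \<Rightarrow> ('a, 'e) chart \<Rightarrow> bool" where
  "C1_compatible M c d \<longleftrightarrow>
     C1_on M (cmap c ` (cdom c \<inter> cdom d)) (cmap d \<circ> cinv c) \<and>
     C1_on M (cmap d ` (cdom c \<inter> cdom d)) (cmap c \<circ> cinv d)"

definition C1_manifold :: "('a::t2_space, 'e::euclidean_space) manifold \<Rightarrow> bool" where
  "C1_manifold N \<longleftrightarrow>
     subspace (model N) \<and>
     (\<forall>c\<in>atlas N. is_chart (model N) c) \<and>
     (\<forall>c\<in>atlas N. \<forall>d\<in>atlas N. C1_compatible (model N) c d) \<and>
     (\<Union>c\<in>atlas N. cdom c) = UNIV"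

definition maximal_atlas :: "('a::t2_space, 'e::euclidean_space) manifold \<Rightarrow> ('a, 'e) chart set" where
  "maximal_atlas N =
     {c. is_chart (model N) c \<and> (\<forall>d\<in>atlas N. C1_compatible (model N) c d)}"

definition C1_map_on ::
    "('a::t2_space, 'e::euclidean_space) manifold \<Rightarrow> ('b::t2_space, 'g::euclidean_space) manifold \<Rightarrow>
     'a set \<Rightarrow> ('a \<Rightarrow> 'b) \<Rightarrow> bool" where
  "C1_map_on N P W f \<longleftrightarrow>
     open W \<and> continuous_on W f \<and>
     (\<forall>c\<in>atlas N. \<forall>d\<in>atlas P.
        C1_on (model N) (cmap c ` {x \<in> W \<inter> cdom c. f x \<in> cdom d}) (cmap d \<circ> f \<circ> cinv c))"


section \<open>Tangent spaces and differentials\<close>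

text \<open>
  Each point \<open>x\<close> gets a preferred chart \<open>chart_at N x\<close>, and the tangent space \<open>T\<^sub>xN\<close> is the
  model space, a vector being identified with its coordinates in the preferred chart at \<open>x\<close>.
\<close>

definition chart_at :: "('a, 'e) manifold \<Rightarrow> 'a \<Rightarrow> ('a, 'e) chart" where
  "chart_at N x = (SOME c. c \<in> atlas N \<and> x \<in> cdom c)"

definition mderiv ::
    "('a::t2_space, 'e::euclidean_space) manifold \<Rightarrow> ('b::t2_space, 'g::euclidean_space) manifold \<Rightarrow>
     ('a \<Rightarrow> 'b) \<Rightarrow> 'a \<Rightarrow> 'e \<Rightarrow> 'g" where
  "mderiv N P f x =
     (let c = chart_at N x; d = chart_at P (f x)
      in frechet_derivative (cmap d \<circ> f \<circ> cinv c) (at (cmap c x) within cmap c ` cdom c))"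

text \<open>The differential at \<open>x\<close> of the map \<open>cmap c\<close>.\<close>

definition chart_deriv ::
    "('a::t2_space, 'e::euclidean_space) manifold \<Rightarrow> ('a, 'e) chart \<Rightarrow> 'a \<Rightarrow> 'e \<Rightarrow> 'e" where
  "chart_deriv N c x =
     (let b = chart_at N x
      in frechet_derivative (cmap c \<circ> cinv b) (at (cmap b x) within cmap b ` cdom b))"


section \<open>Submanifolds\<close>

definition adapted_chart ::
    "('a::t2_space, 'e::euclidean_space) manifold \<Rightarrow> 'a set \<Rightarrow> ('a, 'e) chart \<Rightarrow> 'e set \<Rightarrow> bool" where
  "adapted_chart N S c V \<longleftrightarrow>
     c \<in> maximal_atlas N \<and> subspace V \<and> V \<subseteq> model N \<and>
     cmap c ` (cdom c \<inter> S) = cmap c ` cdom c \<inter> V"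

text \<open>
  Embedded submanifolds; the dimension is only required to be locally constant.
\<close>

definition C1_submanifold :: "('a::t2_space, 'e::euclidean_space) manifold \<Rightarrow> 'a set \<Rightarrow> bool" where
  "C1_submanifold N S \<longleftrightarrow> (\<forall>x\<in>S. \<exists>c V. x \<in> cdom c \<and> adapted_chart N S c V)"

definition tangent_space :: "('a::t2_space, 'e::euclidean_space) manifold \<Rightarrow> 'a set \<Rightarrow> 'a \<Rightarrow> 'e set" where
  "tangent_space N S x =
     {v \<in> model N. \<exists>c V. x \<in> cdom c \<and> adapted_chart N S c V \<and> chart_deriv N c x v \<in> V}"

definition constant_rank_on ::
    "('a::t2_space, 'e::euclidean_space) manifold \<Rightarrow> ('b::t2_space, 'g::euclidean_space) manifold \<Rightarrow>
     ('a \<Rightarrow> 'b) \<Rightarrow> 'a set \<Rightarrow> bool" where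
  "constant_rank_on N P f S \<longleftrightarrow>
     (\<exists>r. \<forall>x\<in>S. dim (mderiv N P f x ` tangent_space N S x) = r)"


section \<open>The foliation induced by a map of constant rank\<close>

definition leaf :: "('a::topological_space \<Rightarrow> 'b) \<Rightarrow> 'a set \<Rightarrow> 'a \<Rightarrow> 'a set" where
  "leaf f S x = connected_component_set {z \<in> S. f z = f x} x"

definition foliation_tangent ::
    "('a::t2_space, 'e::euclidean_space) manifold \<Rightarrow> ('b::t2_space, 'g::euclidean_space) manifold \<Rightarrow>
     ('a \<Rightarrow> 'b) \<Rightarrow> 'a set \<Rightarrow> 'a \<Rightarrow> 'e set" where
  "foliation_tangent N P f S x = {v \<in> tangent_space N S x. mderiv N P f x v = 0}"


section \<open>Convergence in the Grassmann bundle\<close>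

text \<open>
  The distance \<open>\<parallel>P\<^sub>V - P\<^sub>W\<parallel>\<close> of the orthogonal projections onto the subspaces \<open>V\<close> and \<open>W\<close>; it
  metrizes the topology of the Grassmannian, subspaces of different dimensions being at distance 1.
\<close>

definition grassmann_dist :: "'e::euclidean_space set \<Rightarrow> 'e set \<Rightarrow> real" where
  "grassmann_dist V W = onorm (\<lambda>v. closest_point V v - closest_point W v)"

text \<open>
  Convergence of the subspaces \<open>V i\<close> of \<open>T\<^bsub>x i\<^esub>N\<close> to the subspace \<open>\<tau>\<close> of \<open>T\<^sub>yN\<close>, in the
  trivialization of the bundle near \<open>y\<close> given by the preferred chart at \<open>y\<close>; in it,
  \<open>\<tau>\<close> is represented by itself.
\<close>

definition grassmann_bundle_tendsto ::
    "('a::t2_space, 'e::euclidean_space) manifold \<Rightarrow>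
     (nat \<Rightarrow> 'a) \<Rightarrow> (nat \<Rightarrow> 'e set) \<Rightarrow> 'a \<Rightarrow> 'e set \<Rightarrow> bool" where
  "grassmann_bundle_tendsto N x V y \<tau> \<longleftrightarrow>
     subspace \<tau> \<and> \<tau> \<subseteq> model N \<and> x \<longlonglongrightarrow> y \<and>
     (\<lambda>i. grassmann_dist (chart_deriv N (chart_at N y) (x i) ` V i) \<tau>) \<longlonglongrightarrow> 0"


section \<open>The regularity conditions\<close>

definition af_regular ::
    "('a::t2_space, 'e::euclidean_space) manifold \<Rightarrow> ('b::t2_space, 'g::euclidean_space) manifold \<Rightarrow>
     ('a \<Rightarrow> 'b) \<Rightarrow> 'a set \<Rightarrow> 'a set \<Rightarrow> 'a \<Rightarrow> bool" where
  "af_regular N P f X Y y \<longleftrightarrow>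
     (\<forall>x \<tau>. (\<forall>i. x i \<in> X) \<longrightarrow> x \<longlonglongrightarrow> y \<longrightarrow>
        grassmann_bundle_tendsto N x (\<lambda>i. foliation_tangent N P f X (x i)) y \<tau> \<longrightarrow>
        foliation_tangent N P f Y y \<subseteq> \<tau>)"

text \<open>
  Leaves are embedded submanifolds of \<open>N\<close>, so a C1 map into a leaf is a C1 map into \<open>N\<close> with
  values in the leaf.
\<close>

definition local_retraction ::
    "('a::t2_space, 'e::euclidean_space) manifold \<Rightarrow> 'a \<Rightarrow> 'a set \<Rightarrow> 'a set \<Rightarrow> ('a \<Rightarrow> 'a) \<Rightarrow> bool" where
  "local_retraction N y L W \<pi> \<longleftrightarrow>
     open W \<and> y \<in> W \<and> C1_map_on N N W \<pi> \<and> \<pi> ` W \<subseteq> L \<and> (\<forall>z\<in>W \<inter> L. \<pi> z = z)"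

definition afs_regular ::
    "('a::t2_space, 'e::euclidean_space) manifold \<Rightarrow> ('b::t2_space, 'g::euclidean_space) manifold \<Rightarrow>
     ('a \<Rightarrow> 'b) \<Rightarrow> 'a set \<Rightarrow> 'a set \<Rightarrow> 'a \<Rightarrow> bool" where
  "afs_regular N P f X Y y \<longleftrightarrow>
     (\<forall>W \<pi>. local_retraction N y (leaf f Y y) W \<pi> \<longrightarrow>
        (\<exists>U. open U \<and> y \<in> U \<and> U \<subseteq> W \<and>
           (\<forall>x\<in>X \<inter> U. mderiv N N \<pi> x ` foliation_tangent N P f X x
                         = foliation_tangent N P f Y (\<pi> x))))"

end

theory Submission
  imports Defs
begin

text \<open>
  Near \<open>y\<^sub>0\<close> the leaf \<open>L\<close> of \<open>Y\<close> through \<open>y\<^sub>0\<close> is a submanifold of \<open>N\<close> whose tangent spaces are those of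
  the foliation; this is the constant rank theorem (\<open>constant_rank_straightening\<close>,
  \<open>leaf_adapted_chart\<close>). In an adapted chart \<open>L\<close> becomes a linear subspace \<open>K\<close>, a retraction onto \<open>L\<close>
  becomes a map \<open>h\<close> into \<open>K\<close> that is the identity on \<open>K\<close>, and the submersivity at a point \<open>x\<close> of \<open>X\<close>
  says that the derivative of \<open>h\<close> maps the tangent space \<open>Q x\<close> of the leaf of \<open>X\<close> onto \<open>K\<close>.

  That the first condition implies the second (\<open>af_imp_afs_regular\<close>) is the semicontinuity of the rank.
  A limit \<open>\<tau>\<close> of tangent spaces \<open>Q x\<close>, which exists along a subsequence by compactness of the
  Grassmannian, contains \<open>K\<close>. The derivative of \<open>h\<close> at the limit point is the identity on \<open>K\<close>, so it maps
  \<open>\<tau>\<close> onto \<open>K\<close>, and surjectivity persists for nearby maps and subspaces.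

  The converse (\<open>afs_imp_af_regular\<close>) is less direct, because surjectivity is not a closed condition:
  nothing is gained from a retraction whose derivative at \<open>y\<^sub>0\<close> does not map \<open>\<tau>\<close> onto \<open>K\<close>. The failure
  has to occur at points of the given sequence themselves. If \<open>\<tau>\<close> does not contain \<open>K\<close>, there are linear
  maps \<open>\<alpha>\<close>, one for each point \<open>x\<close> of a subsequence and converging along it, such that
  \<open>v \<mapsto> proj K v + \<alpha> (v - proj K v)\<close> maps \<open>Q x\<close> into a hyperplane of \<open>K\<close>. A sum of small bumps around the
  points of a sparse subsequence yields a continuously differentiable \<open>\<psi>\<close> that vanishes on \<open>K\<close> and has
  the derivative \<open>v \<mapsto> \<alpha> (v - proj K v)\<close> at infinitely many of the points (\<open>C1_perturbation\<close>). The
  retraction \<open>proj K + \<psi>\<close> then violates submersivity arbitrarily close to \<open>y\<^sub>0\<close>.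
\<close>

section \<open>Orthogonal projections\<close>

abbreviation proj :: "'e::euclidean_space set \<Rightarrow> 'e \<Rightarrow> 'e" where
  "proj \<equiv> closest_point"

lemma proj_unique:
  fixes V :: "'e::euclidean_space set"
  assumes V: "subspace V" and p: "p \<in> V" and orth: "\<And>u. u \<in> V \<Longrightarrow> (v - p) \<bullet> u = 0"
  shows "proj V v = p"
proof -
  have "\<forall>z\<in>V. dist v p \<le> dist v z"
  proof
    fix z assume z: "z \<in> V"
    have "orthogonal (v - p) (p - z)"
      using orth[of "p - z"] V p z by (simp add: orthogonal_def subspace_diff)
    then have "norm (v - z)^2 = norm (v - p)^2 + norm (p - z)^2"
      using norm_add_Pythagorean[of "v - p" "p - z"] by (simp only: diff_add_cancel add_diff_eq)
    then have "norm (v - p)^2 \<le> norm (v - z)^2" by simp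
    then show "dist v p \<le> dist v z" unfolding dist_norm by (rule power2_le_imp_le) simp
  qed
  from closest_point_unique[OF subspace_imp_convex[OF V] closed_subspace[OF V] p this]
  show ?thesis by (rule sym)
qed

lemma
  fixes V :: "'e::euclidean_space set"
  assumes V: "subspace V"
  shows proj_in [simp]: "proj V v \<in> V"
    and proj_orthogonal: "u \<in> V \<Longrightarrow> (v - proj V v) \<bullet> u = 0"
proof -
  obtain y z where y: "y \<in> span V" and z: "\<And>w. w \<in> span V \<Longrightarrow> orthogonal z w" and v: "v = y + z"
    using orthogonal_subspace_decomp_exists[of V v] by metis
  have sp: "span V = V" using V by (simp add: span_eq_iff)
  have "proj V v = y"
    by (rule proj_unique[OF V]) (use y z v sp in \<open>auto simp: orthogonal_def\<close>)
  then show "proj V v \<in> V" "u \<in> V \<Longrightarrow> (v - proj V v) \<bullet> u = 0"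
    using y z v sp by (auto simp: orthogonal_def)
qed

lemma proj_id: "subspace V \<Longrightarrow> v \<in> V \<Longrightarrow> proj V v = (v::'e::euclidean_space)"
  by (rule closest_point_self)

lemma proj_inner:
  fixes V :: "'e::euclidean_space set"
  assumes "subspace V" "u \<in> V"
  shows "proj V v \<bullet> u = v \<bullet> u"
  using proj_orthogonal[OF assms, of v] by (simp add: inner_diff_left)

lemma linear_proj:
  fixes V :: "'e::euclidean_space set"
  assumes V: "subspace V"
  shows "linear (proj V)"
proof (rule linearI)
  show "proj V (x + y) = proj V x + proj V y" for x y
    by (rule proj_unique[OF V])
      (use V in \<open>auto simp: subspace_add inner_diff_left inner_add_left proj_inner\<close>)
  show "proj V (r *\<^sub>R x) = r *\<^sub>R proj V x" for r x
    by (rule proj_unique[OF V])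
      (use V in \<open>auto simp: subspace_scale inner_diff_left proj_inner\<close>)
qed

lemma bounded_linear_proj:
  fixes V :: "'e::euclidean_space set"
  shows "subspace V \<Longrightarrow> bounded_linear (proj V)"
  by (simp add: linear_proj linear_conv_bounded_linear[symmetric])

lemma continuous_on_proj [continuous_intros]:
  fixes V :: "'e::euclidean_space set"
  assumes "subspace V" "continuous_on S f"
  shows "continuous_on S (\<lambda>x. proj V (f x))"
  using bounded_linear.continuous_on[OF bounded_linear_proj] assms by blast

lemma norm_proj_le:
  fixes V :: "'e::euclidean_space set"
  assumes V: "subspace V"
  shows "norm (proj V v) \<le> norm v"
proof -
  have "orthogonal (proj V v) (v - proj V v)"
    using proj_orthogonal[OF V, of "proj V v" v] V by (simp add: orthogonal_def inner_commute)
  then have "norm v ^ 2 = norm (proj V v)^2 + norm (v - proj V v)^2"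
    using norm_add_Pythagorean[of "proj V v" "v - proj V v"] by simp
  then have "norm (proj V v) ^ 2 \<le> norm v ^ 2" by simp
  then show ?thesis by (rule power2_le_imp_le) simp
qed


lemma norm_diff_proj_le:
  fixes V :: "'e::euclidean_space set"
  assumes V: "subspace V"
  shows "norm (v - proj V v) \<le> norm v"
proof -
  have "orthogonal (v - proj V v) (proj V v)"
    using proj_orthogonal[OF V, of "proj V v" v] V by (simp add: orthogonal_def)
  then have "norm v ^ 2 = norm (v - proj V v)^2 + norm (proj V v)^2"
    using norm_add_Pythagorean[of "v - proj V v" "proj V v"] by simp
  then have "norm (v - proj V v) ^ 2 \<le> norm v ^ 2" by simp
  then show ?thesis by (rule power2_le_imp_le) simp
qed


section \<open>Calculus on relatively open subsets of a subspace\<close>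

lemma at_within_openin:
  assumes "openin (top_of_set M) S" "x \<in> S"
  shows "at x within S = at x within M"
proof -
  obtain T where "open T" "S = M \<inter> T" using assms(1) by (auto simp: openin_open)
  with \<open>x \<in> S\<close> show ?thesis by (intro at_within_nhd[of x T]) auto
qed

lemma has_derivative_unique_subspace:
  fixes h :: "'e::euclidean_space \<Rightarrow> 'g::real_normed_vector"
  assumes M: "subspace M" and x: "x \<in> M" and v: "v \<in> M"
    and D: "(h has_derivative D) (at x within M)" and E: "(h has_derivative E) (at x within M)"
  shows "D v = E v"
proof -
  let ?p = "\<lambda>t::real. x + t *\<^sub>R v"
  have p: "(?p has_derivative (\<lambda>t. t *\<^sub>R v)) (at 0)"
    by (auto intro!: derivative_eq_intros)
  have sub: "?p ` UNIV \<subseteq> M" using M x v by (auto simp: subspace_add subspace_scale)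
  have "((\<lambda>t. h (?p t)) has_derivative (\<lambda>t. G (t *\<^sub>R v))) (at 0)"
    if "(h has_derivative G) (at x within M)" for G
    using has_derivative_in_compose[OF p, of h G] has_derivative_subset[OF that sub] by simp
  from has_derivative_unique[OF this[OF D] this[OF E]] have "D (1 *\<^sub>R v) = E (1 *\<^sub>R v)" by metis
  then show ?thesis by simp
qed

text \<open>
  The part of a derivative that leaves the subspace \<open>Q\<close> is the derivative of the map
  \<open>h - proj Q \<circ> h\<close>, which vanishes near \<open>x\<close>.
\<close>

lemma has_derivative_in_subspace:
  fixes h :: "'e::euclidean_space \<Rightarrow> 'g::euclidean_space"
  assumes M: "subspace M" and Q: "subspace Q" and S: "openin (top_of_set M) S" "x \<in> S"
    and D: "(h has_derivative D) (at x within M)" and h: "\<And>z. z \<in> S \<Longrightarrow> h z \<in> Q" and v: "v \<in> M"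
  shows "D v \<in> Q"
proof -
  have xM: "x \<in> M" using S by (auto dest: openin_imp_subset)
  have "((\<lambda>z. h z - proj Q (h z)) has_derivative (\<lambda>v. D v - proj Q (D v))) (at x within M)"
    by (intro has_derivative_diff D bounded_linear.has_derivative[OF bounded_linear_proj[OF Q]])
  moreover have "((\<lambda>z. h z - proj Q (h z)) has_derivative (\<lambda>v. 0)) (at x within S)"
    by (rule has_derivative_transform[OF S(2), where f = "\<lambda>_. 0"]) (use h Q in \<open>auto simp: proj_id\<close>)
  then have "((\<lambda>z. h z - proj Q (h z)) has_derivative (\<lambda>v. 0)) (at x within M)"
    using at_within_openin[OF S] by simp
  ultimately have "D v - proj Q (D v) = 0"
    by (rule has_derivative_unique_subspace[OF M xM v])
  then show ?thesis using proj_in[OF Q, of "D v"] by simp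
qed

text \<open>
  A derivative within the subspace \<open>M\<close> is determined on \<open>M\<close> only, and \<open>der\<close> picks one of its linear
  extensions. For this reason \<open>der M h x\<close> is evaluated at vectors of \<open>M\<close> only.
\<close>

abbreviation der :: "'e::euclidean_space set \<Rightarrow> ('e \<Rightarrow> 'g::real_normed_vector) \<Rightarrow> 'e \<Rightarrow> 'e \<Rightarrow> 'g" where
  "der M h x \<equiv> frechet_derivative h (at x within M)"

lemma der_eq:
  fixes h :: "'e::euclidean_space \<Rightarrow> 'g::real_normed_vector"
  assumes "subspace M" "x \<in> M" "(h has_derivative D) (at x within M)" "v \<in> M"
  shows "der M h x v = D v"
  using has_derivative_unique_subspace[OF assms(1,2,4) _ assms(3)] assms(3)
    differentiableI frechet_derivative_works by blast

lemma has_derivative_cong_openin: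
  fixes h :: "'e::euclidean_space \<Rightarrow> 'g::real_normed_vector"
  assumes M: "subspace M" and S: "openin (top_of_set M) S" "x \<in> S"
    and D: "(h has_derivative D) (at x within M)" and eq: "\<And>z. z \<in> S \<Longrightarrow> h z = k z"
  shows "(k has_derivative D) (at x within M)"
proof -
  have "(h has_derivative D) (at x within S)" using D at_within_openin[OF S] by simp
  then have "(k has_derivative D) (at x within S)"
    by (rule has_derivative_transform[OF S(2), rotated]) (simp add: eq)
  then show ?thesis using at_within_openin[OF S] by simp
qed

text \<open>
  As derivatives are unique on \<open>M\<close>, a derivative can be chosen pointwise, independently of the
  domain; hence being continuously differentiable is a local property (\<open>C1_on_local\<close>).
\<close>

lemma C1_on_iff:
  fixes h :: "'e::euclidean_space \<Rightarrow> 'g::euclidean_space"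
  assumes M: "subspace M" and S: "openin (top_of_set M) S"
  shows "C1_on M S h \<longleftrightarrow>
    (\<forall>x\<in>S. (h has_derivative der M h x) (at x within M)) \<and> (\<forall>v\<in>M. continuous_on S (\<lambda>x. der M h x v))"
    (is "_ \<longleftrightarrow> ?R")
proof
  assume "C1_on M S h"
  then obtain D where D: "\<And>x. x \<in> S \<Longrightarrow> (h has_derivative D x) (at x within M)"
    and cont: "\<And>v. v \<in> M \<Longrightarrow> continuous_on S (\<lambda>x. D x v)"
    using S by (auto simp: C1_on_def at_within_openin)
  have eq: "der M h x v = D x v" if "x \<in> S" "v \<in> M" for x v
    using der_eq[OF M _ D[OF that(1)] that(2)] that S by (auto dest: openin_imp_subset)
  show ?R
    using D cont
    by (auto simp: eq frechet_derivative_works[symmetric] cong: continuous_on_cong intro: differentiableI)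
next
  assume ?R
  then show "C1_on M S h"
    using S unfolding C1_on_def by (intro exI[of _ "der M h"]) (auto simp: at_within_openin)
qed

lemma C1_onI:
  fixes h :: "'e::euclidean_space \<Rightarrow> 'g::euclidean_space"
  assumes "openin (top_of_set M) S"
    and "\<And>x. x \<in> S \<Longrightarrow> (h has_derivative D x) (at x within M)"
    and "\<And>v. v \<in> M \<Longrightarrow> continuous_on S (\<lambda>x. D x v)"
  shows "C1_on M S h"
  using assms unfolding C1_on_def by (intro exI[of _ D]) (auto simp: at_within_openin)

lemma C1_on_has_derivative:
  fixes h :: "'e::euclidean_space \<Rightarrow> 'g::euclidean_space"
  assumes "C1_on M S h" "subspace M" "openin (top_of_set M) S" "x \<in> S"
  shows "(h has_derivative der M h x) (at x within M)"
  using assms C1_on_iff by blast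

lemma C1_on_continuous_on:
  fixes h :: "'e::euclidean_space \<Rightarrow> 'g::euclidean_space"
  assumes "C1_on M S h"
  shows "continuous_on S h"
  using assms has_derivative_continuous_on unfolding C1_on_def by blast

lemma C1_on_cong:
  fixes h :: "'e::euclidean_space \<Rightarrow> 'g::euclidean_space"
  assumes "C1_on M S h" "\<And>x. x \<in> S \<Longrightarrow> h x = k x"
  shows "C1_on M S k"
proof -
  obtain D where D: "\<And>x. x \<in> S \<Longrightarrow> (h has_derivative D x) (at x within S)"
    and cont: "\<And>v. v \<in> M \<Longrightarrow> continuous_on S (\<lambda>x. D x v)"
    using assms(1) unfolding C1_on_def by metis
  have "(k has_derivative D x) (at x within S)" if "x \<in> S" for x
    by (rule has_derivative_transform[OF that _ D[OF that]]) (simp add: assms(2))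
  with cont show ?thesis unfolding C1_on_def by (intro exI[of _ D]) auto
qed

lemma C1_on_subset:
  fixes h :: "'e::euclidean_space \<Rightarrow> 'g::euclidean_space"
  assumes "C1_on M S h" "T \<subseteq> S"
  shows "C1_on M T h"
  using assms has_derivative_subset continuous_on_subset unfolding C1_on_def by (meson subsetD)

lemma C1_on_local:
  fixes h :: "'e::euclidean_space \<Rightarrow> 'g::euclidean_space"
  assumes M: "subspace M" and S: "openin (top_of_set M) S"
    and loc: "\<And>x. x \<in> S \<Longrightarrow> \<exists>T. openin (top_of_set M) T \<and> x \<in> T \<and> T \<subseteq> S \<and> C1_on M T h"
  shows "C1_on M S h"
  unfolding C1_on_iff[OF M S]
proof safe
  fix x assume "x \<in> S"
  then show "(h has_derivative der M h x) (at x within M)"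
    using loc C1_on_has_derivative[OF _ M] by blast
next
  fix v assume v: "v \<in> M"
  show "continuous_on S (\<lambda>x. der M h x v)"
    unfolding continuous_on_eq_continuous_within
  proof
    fix x assume x: "x \<in> S"
    then obtain T where T: "openin (top_of_set M) T" "x \<in> T" "T \<subseteq> S" "C1_on M T h"
      using loc by blast
    then have "continuous (at x within T) (\<lambda>x. der M h x v)"
      using v C1_on_iff[OF M T(1)] continuous_on_eq_continuous_within by blast
    then show "continuous (at x within S) (\<lambda>x. der M h x v)"
      using at_within_openin[OF S x] at_within_openin[OF T(1,2)] by simp
  qed
qed

text \<open>
  Pointwise convergence of linear maps on \<open>M\<close> is uniform on bounded sets, since \<open>M\<close> has finite
  dimension; the proof expands the argument in an orthonormal basis.
\<close>

lemma tendsto_linear_apply: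
  fixes A :: "'i \<Rightarrow> 'e::euclidean_space \<Rightarrow> 'g::real_normed_vector"
  assumes M: "subspace M" and lin: "eventually (\<lambda>i. linear (A i)) F" and lin0: "linear A0"
    and A: "\<And>v. v \<in> M \<Longrightarrow> ((\<lambda>i. A i v) \<longlongrightarrow> A0 v) F"
    and u: "(u \<longlongrightarrow> u0) F" and uM: "eventually (\<lambda>i. u i \<in> M) F" and u0: "u0 \<in> M"
  shows "((\<lambda>i. A i (u i)) \<longlongrightarrow> A0 u0) F"
proof -
  have expand: "B w = (\<Sum>b\<in>Basis. (w \<bullet> b) *\<^sub>R B (proj M b))" if B: "linear B" and w: "w \<in> M"
    for B :: "'e \<Rightarrow> 'g" and w
  proof -
    have "B w = B (proj M (\<Sum>b\<in>Basis. (w \<bullet> b) *\<^sub>R b))" using M w by (simp add: euclidean_representation proj_id)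
    also have "\<dots> = (\<Sum>b\<in>Basis. (w \<bullet> b) *\<^sub>R B (proj M b))"
      by (simp add: linear_sum[OF linear_proj[OF M]] linear_sum[OF B]
          linear_scale[OF linear_proj[OF M]] linear_scale[OF B])
    finally show ?thesis .
  qed
  have "((\<lambda>i. \<Sum>b\<in>Basis. (u i \<bullet> b) *\<^sub>R A i (proj M b)) \<longlongrightarrow> (\<Sum>b\<in>Basis. (u0 \<bullet> b) *\<^sub>R A0 (proj M b))) F"
    by (intro tendsto_sum tendsto_scaleR tendsto_inner u tendsto_const A) (use M in auto)
  then have "((\<lambda>i. \<Sum>b\<in>Basis. (u i \<bullet> b) *\<^sub>R A i (proj M b)) \<longlongrightarrow> A0 u0) F"
    using expand[OF lin0 u0] by simp
  moreover have "eventually (\<lambda>i. (\<Sum>b\<in>Basis. (u i \<bullet> b) *\<^sub>R A i (proj M b)) = A i (u i)) F"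
    using lin uM by eventually_elim (rule expand[symmetric])
  ultimately show ?thesis by (rule Lim_transform_eventually)
qed

lemma C1_on_compose:
  fixes g :: "'e::euclidean_space \<Rightarrow> 'f::euclidean_space" and h :: "'f \<Rightarrow> 'g::euclidean_space"
  assumes M: "subspace M" and S: "openin (top_of_set M) S" and g: "C1_on M S g"
    and M': "subspace M'" and T: "openin (top_of_set M') T" and h: "C1_on M' T h"
    and sub: "g ` S \<subseteq> T"
  shows "C1_on M S (h \<circ> g)"
    and "\<And>x v. x \<in> S \<Longrightarrow> v \<in> M \<Longrightarrow> der M (h \<circ> g) x v = der M' h (g x) (der M g x v)"
    and "\<And>x v. x \<in> S \<Longrightarrow> v \<in> M \<Longrightarrow> der M g x v \<in> M'"
proof -
  have TM: "T \<subseteq> M'" and SM: "S \<subseteq> M" using S T by (auto dest: openin_imp_subset)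
  note dg = C1_on_has_derivative[OF g M S] and dh = C1_on_has_derivative[OF h M' T]
  show inM': "der M g x v \<in> M'" if "x \<in> S" "v \<in> M" for x v
    by (rule has_derivative_in_subspace[OF M M' S that(1) dg _ that(2)]) (use that sub TM in auto)
  have D: "(h \<circ> g has_derivative (\<lambda>v. der M' h (g x) (der M g x v))) (at x within M)" if x: "x \<in> S" for x
  proof -
    have "(h has_derivative der M' h (g x)) (at (g x) within g ` S)"
      using dh[of "g x"] x sub TM by (auto intro: has_derivative_subset)
    moreover have "(g has_derivative der M g x) (at x within S)"
      using dg[OF x] at_within_openin[OF S x] by simp
    ultimately show ?thesis
      using diff_chain_within at_within_openin[OF S x] unfolding comp_def by metis
  qed
  show "der M (h \<circ> g) x v = der M' h (g x) (der M g x v)" if "x \<in> S" "v \<in> M" for x v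
    using der_eq[OF M _ D that(2)] that SM by auto
  show "C1_on M S (h \<circ> g)"
  proof (rule C1_onI[OF S D])
    fix v assume v: "v \<in> M"
    show "continuous_on S (\<lambda>x. der M' h (g x) (der M g x v))"
      unfolding continuous_on
    proof
      fix x assume x: "x \<in> S"
      let ?F = "at x within S"
      have inS: "eventually (\<lambda>z. z \<in> S) ?F" by (simp add: eventually_at_topological) (metis open_UNIV UNIV_I)
      have gx: "g x \<in> T" using x sub by auto
      have cg: "(g \<longlongrightarrow> g x) ?F" using C1_on_continuous_on[OF g] x by (auto simp: continuous_on)
      show "((\<lambda>x. der M' h (g x) (der M g x v)) \<longlongrightarrow> der M' h (g x) (der M g x v)) ?F"
      proof (rule tendsto_linear_apply[OF M'])
        show "eventually (\<lambda>z. linear (der M' h (g z))) ?F"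
          using inS by eventually_elim (use dh sub in \<open>blast intro: has_derivative_linear\<close>)
        show "linear (der M' h (g x))" using dh[OF gx] by (rule has_derivative_linear)
        show "((\<lambda>z. der M' h (g z) u) \<longlongrightarrow> der M' h (g x) u) ?F" if u: "u \<in> M'" for u
        proof -
          have "continuous_on T (\<lambda>y. der M' h y u)" using h u C1_on_iff[OF M' T] by blast
          then have "continuous_on S (\<lambda>z. der M' h (g z) u)"
            using continuous_on_compose2[OF _ C1_on_continuous_on[OF g] sub] by blast
          then show ?thesis using x by (auto simp: continuous_on)
        qed
        have "continuous_on S (\<lambda>x. der M g x v)" using g v C1_on_iff[OF M S] by blast
        then show "((\<lambda>z. der M g z v) \<longlongrightarrow> der M g x v) ?F" using x by (auto simp: continuous_on)
        show "eventually (\<lambda>z. der M g z v \<in> M') ?F"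
          using inS by eventually_elim (rule inM'[OF _ v])
        show "der M g x v \<in> M'" by (rule inM'[OF x v])
      qed
    qed
  qed
qed

section \<open>Charts\<close>

lemma C1_manifold_subspace: "C1_manifold N \<Longrightarrow> subspace (model N)"
  by (simp add: C1_manifold_def)

lemma atlas_in_maximal_atlas: "C1_manifold N \<Longrightarrow> c \<in> atlas N \<Longrightarrow> c \<in> maximal_atlas N"
  by (auto simp: C1_manifold_def maximal_atlas_def)

lemma maximal_atlas_is_chart: "c \<in> maximal_atlas N \<Longrightarrow> is_chart (model N) c"
  by (auto simp: maximal_atlas_def)

lemma chart_at:
  assumes "C1_manifold N"
  shows "chart_at N x \<in> atlas N" "x \<in> cdom (chart_at N x)"
proof -
  have "\<exists>c. c \<in> atlas N \<and> x \<in> cdom c" using assms unfolding C1_manifold_def by blast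
  then have "chart_at N x \<in> atlas N \<and> x \<in> cdom (chart_at N x)"
    unfolding chart_at_def by (rule someI_ex)
  then show "chart_at N x \<in> atlas N" "x \<in> cdom (chart_at N x)" by auto
qed

lemma chart_at_maximal: "C1_manifold N \<Longrightarrow> chart_at N x \<in> maximal_atlas N"
  by (simp add: chart_at atlas_in_maximal_atlas)

context
  fixes M :: "'e::euclidean_space set" and c :: "('a::t2_space, 'e) chart"
  assumes c: "is_chart M c"
begin

lemma chart_open: "open (cdom c)"
  using c by (simp add: is_chart_def)

lemma chart_image_subset: "cmap c ` cdom c \<subseteq> M"
  using c unfolding is_chart_def by (auto dest: openin_imp_subset)

lemma chart_in_model: "x \<in> cdom c \<Longrightarrow> cmap c x \<in> M"
  using chart_image_subset by auto

lemma cinv_cmap [simp]: "x \<in> cdom c \<Longrightarrow> cinv c (cmap c x) = x"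
  using c by (simp add: is_chart_def homeomorphism_def)

lemma cmap_cinv [simp]: "z \<in> cmap c ` cdom c \<Longrightarrow> cmap c (cinv c z) = z"
  using c by auto

lemma continuous_on_cmap: "continuous_on (cdom c) (cmap c)"
  using c by (simp add: is_chart_def homeomorphism_def)

lemma continuous_on_cinv: "continuous_on (cmap c ` cdom c) (cinv c)"
  using c by (simp add: is_chart_def homeomorphism_def)

lemma cinv_in: "z \<in> cmap c ` cdom c \<Longrightarrow> cinv c z \<in> cdom c"
  using c by auto

lemma openin_cmap_image:
  assumes "open A" "A \<subseteq> cdom c"
  shows "openin (top_of_set M) (cmap c ` A)"
proof -
  have "openin (top_of_set (cmap c ` cdom c)) (cmap c ` A)"
    using homeomorphism_imp_open_map[of "cdom c" "cmap c ` cdom c" "cmap c" "cinv c" A] c assms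
    by (auto simp: is_chart_def openin_open)
  then show ?thesis
    using c openin_trans unfolding is_chart_def by blast
qed

lemma open_chart_preimage:
  assumes "open B"
  shows "open {x \<in> cdom c. cmap c x \<in> B}"
proof -
  have "open (cmap c -` B \<inter> cdom c)"
    using continuous_open_preimage[OF continuous_on_cmap chart_open assms] by (simp add: Int_commute)
  then show ?thesis by (simp add: vimage_def Collect_conj_eq Int_commute)
qed

lemma cmap_tendsto:
  assumes "(x \<longlongrightarrow> y) F" "y \<in> cdom c"
  shows "((\<lambda>i. cmap c (x i)) \<longlongrightarrow> cmap c y) F" "eventually (\<lambda>i. x i \<in> cdom c) F"
proof -
  have "isCont (cmap c) y"
    using continuous_on_cmap chart_open assms(2) by (simp add: continuous_on_eq_continuous_at)
  then show "((\<lambda>i. cmap c (x i)) \<longlongrightarrow> cmap c y) F" using assms(1) by (rule isCont_tendsto_compose)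
  show "eventually (\<lambda>i. x i \<in> cdom c) F"
    using topological_tendstoD[OF assms(1) chart_open assms(2)] .
qed

end

lemma chart_tendsto:
  fixes c :: "('a::t2_space, 'e::euclidean_space) chart"
  assumes c: "is_chart M c" and y: "y \<in> cdom c" and x: "\<And>i. x i \<in> cdom c"
    and lim: "((\<lambda>i. cmap c (x i)) \<longlongrightarrow> cmap c y) F"
  shows "(x \<longlongrightarrow> y) F"
proof -
  have "((\<lambda>i. cinv c (cmap c (x i))) \<longlongrightarrow> cinv c (cmap c y)) F"
    by (rule continuous_on_tendsto_compose[OF continuous_on_cinv[OF c] lim]) (use x y in auto)
  then show ?thesis using x y by (simp add: cinv_cmap[OF c])
qed

lemma open_C1_map_domain:
  assumes "C1_map_on N P W f" "open A" "open B"
  shows "open {x \<in> W \<inter> A. f x \<in> B}"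
proof -
  have "open (W \<inter> f -` B)"
    using assms by (intro continuous_open_preimage) (auto simp: C1_map_on_def)
  then have "open ((W \<inter> f -` B) \<inter> A)" using assms(2) by blast
  moreover have "(W \<inter> f -` B) \<inter> A = {x \<in> W \<inter> A. f x \<in> B}" by auto
  ultimately show ?thesis by simp
qed

text \<open>
  Charts of the maximal atlas are compatible with the charts of the atlas. Near each point the
  transition map factors through a chart of the atlas, and continuous differentiability is local.
\<close>

lemma maximal_atlas_compatible:
  fixes N :: "('a::t2_space, 'e::euclidean_space) manifold"
  assumes N: "C1_manifold N" and c: "c \<in> maximal_atlas N" and d: "d \<in> maximal_atlas N"
  shows "C1_on (model N) (cmap c ` (cdom c \<inter> cdom d)) (cmap d \<circ> cinv c)"
proof -
  let ?M = "model N"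
  note cc = maximal_atlas_is_chart[OF c] and dc = maximal_atlas_is_chart[OF d]
  note M = C1_manifold_subspace[OF N]
  show ?thesis
  proof (rule C1_on_local[OF M])
    show "openin (top_of_set ?M) (cmap c ` (cdom c \<inter> cdom d))"
      by (intro openin_cmap_image[OF cc] open_Int chart_open[OF cc] chart_open[OF dc]) auto
    fix z assume "z \<in> cmap c ` (cdom c \<inter> cdom d)"
    then obtain x where x: "x \<in> cdom c" "x \<in> cdom d" "z = cmap c x" by auto
    define b where "b = chart_at N x"
    have b: "b \<in> atlas N" "x \<in> cdom b" unfolding b_def by (rule chart_at[OF N])+
    have bc: "is_chart ?M b" using b N by (simp add: C1_manifold_def)
    let ?A = "cdom c \<inter> cdom d \<inter> cdom b"
    have oA: "open ?A" by (intro open_Int chart_open[OF cc] chart_open[OF dc] chart_open[OF bc])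
    have o1: "openin (top_of_set ?M) (cmap c ` ?A)" by (rule openin_cmap_image[OF cc oA]) auto
    have o2: "openin (top_of_set ?M) (cmap b ` ?A)" by (rule openin_cmap_image[OF bc oA]) auto
    have cb: "C1_on ?M (cmap c ` ?A) (cmap b \<circ> cinv c)"
      using c b(1) by (auto simp: maximal_atlas_def C1_compatible_def elim!: C1_on_subset)
    have bd: "C1_on ?M (cmap b ` ?A) (cmap d \<circ> cinv b)"
      using d b(1) by (auto simp: maximal_atlas_def C1_compatible_def elim!: C1_on_subset)
    have "C1_on ?M (cmap c ` ?A) ((cmap d \<circ> cinv b) \<circ> (cmap b \<circ> cinv c))"
      by (rule C1_on_compose(1)[OF M o1 cb M o2 bd]) (use cc in \<open>auto intro!: imageI\<close>)
    then have "C1_on ?M (cmap c ` ?A) (cmap d \<circ> cinv c)"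
      by (rule C1_on_cong) (use cc bc in auto)
    then show "\<exists>T. openin (top_of_set ?M) T \<and> z \<in> T \<and> T \<subseteq> cmap c ` (cdom c \<inter> cdom d) \<and>
        C1_on ?M T (cmap d \<circ> cinv c)"
      using o1 x b by (intro exI[of _ "cmap c ` ?A"]) auto
  qed
qed

section \<open>Differentials in coordinates\<close>

lemma chart_deriv_eq:
  fixes N :: "('a::t2_space, 'e::euclidean_space) manifold"
  assumes N: "C1_manifold N" and c: "c \<in> maximal_atlas N"
  shows "chart_deriv N c x = der (model N) (cmap c \<circ> cinv (chart_at N x)) (cmap (chart_at N x) x)"
proof -
  note bc = maximal_atlas_is_chart[OF chart_at_maximal[OF N, of x]]
  have "openin (top_of_set (model N)) (cmap (chart_at N x) ` cdom (chart_at N x))"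
    using bc by (simp add: is_chart_def)
  from at_within_openin[OF this] show ?thesis
    by (simp add: chart_deriv_def Let_def chart_at[OF N])
qed

lemma openin_chart_overlap:
  fixes N :: "('a::t2_space, 'e::euclidean_space) manifold"
  assumes c: "c \<in> maximal_atlas N" and d: "d \<in> maximal_atlas N"
  shows "openin (top_of_set (model N)) (cmap c ` (cdom c \<inter> cdom d))"
  using chart_open[OF maximal_atlas_is_chart[OF c]] chart_open[OF maximal_atlas_is_chart[OF d]]
  by (intro openin_cmap_image[OF maximal_atlas_is_chart[OF c]]) auto

lemma linear_chart_deriv:
  fixes N :: "('a::t2_space, 'e::euclidean_space) manifold"
  assumes N: "C1_manifold N" and c: "c \<in> maximal_atlas N" and x: "x \<in> cdom c"
  shows "linear (chart_deriv N c x)"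
proof -
  note b = chart_at_maximal[OF N, of x]
  show ?thesis
    unfolding chart_deriv_eq[OF N c]
    by (rule has_derivative_linear[OF C1_on_has_derivative[OF maximal_atlas_compatible[OF N b c]
            C1_manifold_subspace[OF N] openin_chart_overlap[OF b c]]])
      (use x chart_at[OF N] in auto)
qed

lemma chart_deriv_in_model:
  fixes N :: "('a::t2_space, 'e::euclidean_space) manifold"
  assumes N: "C1_manifold N" and c: "c \<in> maximal_atlas N" and x: "x \<in> cdom c" and v: "v \<in> model N"
  shows "chart_deriv N c x v \<in> model N"
proof -
  note b = chart_at_maximal[OF N, of x]
  note bc = maximal_atlas_is_chart[OF b] and cc = maximal_atlas_is_chart[OF c]
  note M = C1_manifold_subspace[OF N]
  note o = openin_chart_overlap[OF b c]
  have z: "cmap (chart_at N x) x \<in> cmap (chart_at N x) ` (cdom (chart_at N x) \<inter> cdom c)"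
    using x chart_at[OF N] by auto
  show ?thesis
    unfolding chart_deriv_eq[OF N c]
    by (rule has_derivative_in_subspace[OF M M o z
          C1_on_has_derivative[OF maximal_atlas_compatible[OF N b c] M o z] _ v])
      (use chart_in_model[OF cc] bc in auto)
qed

text \<open>
  The chain rule: \<open>chart_deriv N c x\<close> is the derivative of the transition map from the preferred chart
  at \<open>x\<close> to \<open>c\<close>.
\<close>

lemma chart_deriv_transition:
  fixes N :: "('a::t2_space, 'e::euclidean_space) manifold"
  assumes N: "C1_manifold N" and c: "c \<in> maximal_atlas N" and d: "d \<in> maximal_atlas N"
    and x: "x \<in> cdom c" "x \<in> cdom d" and v: "v \<in> model N"
  shows "der (model N) (cmap d \<circ> cinv c) (cmap c x) (chart_deriv N c x v) = chart_deriv N d x v"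
proof -
  let ?M = "model N" and ?b = "chart_at N x"
  note b = chart_at_maximal[OF N, of x] and xb = chart_at(2)[OF N, of x]
  note bc = maximal_atlas_is_chart[OF b] and cc = maximal_atlas_is_chart[OF c]
    and dc = maximal_atlas_is_chart[OF d]
  note M = C1_manifold_subspace[OF N]
  let ?A = "cdom ?b \<inter> cdom c \<inter> cdom d"
  have oA: "open ?A" by (intro open_Int chart_open[OF cc] chart_open[OF dc] chart_open[OF bc])
  have o1: "openin (top_of_set ?M) (cmap ?b ` ?A)" by (rule openin_cmap_image[OF bc oA]) auto
  have z: "cmap ?b x \<in> cmap ?b ` ?A" using x xb by auto
  have bC: "C1_on ?M (cmap ?b ` ?A) (cmap c \<circ> cinv ?b)"
    by (rule C1_on_subset[OF maximal_atlas_compatible[OF N b c]]) auto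
  have sub: "(cmap c \<circ> cinv ?b) ` (cmap ?b ` ?A) \<subseteq> cmap c ` (cdom c \<inter> cdom d)"
    using bc by (auto intro!: imageI)
  note comp = C1_on_compose[OF M o1 bC M openin_chart_overlap[OF c d] maximal_atlas_compatible[OF N c d] sub]
  have bD: "C1_on ?M (cmap ?b ` ?A) (cmap d \<circ> cinv ?b)"
    by (rule C1_on_subset[OF maximal_atlas_compatible[OF N b d]]) auto
  have "chart_deriv N d x v = der ?M ((cmap d \<circ> cinv c) \<circ> (cmap c \<circ> cinv ?b)) (cmap ?b x) v"
    unfolding chart_deriv_eq[OF N d]
  proof (rule der_eq[OF M _ _ v])
    show "cmap ?b x \<in> ?M" by (rule chart_in_model[OF bc xb])
    have "C1_on ?M (cmap ?b ` ?A) ((cmap d \<circ> cinv c) \<circ> (cmap c \<circ> cinv ?b))" by (rule comp(1))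
    from C1_on_has_derivative[OF this M o1 z] have
      "((cmap d \<circ> cinv c) \<circ> (cmap c \<circ> cinv ?b) has_derivative
        der ?M ((cmap d \<circ> cinv c) \<circ> (cmap c \<circ> cinv ?b)) (cmap ?b x)) (at (cmap ?b x) within cmap ?b ` ?A)"
      using at_within_openin[OF o1 z] by simp
    then have "(cmap d \<circ> cinv ?b has_derivative
        der ?M ((cmap d \<circ> cinv c) \<circ> (cmap c \<circ> cinv ?b)) (cmap ?b x)) (at (cmap ?b x) within cmap ?b ` ?A)"
      by (rule has_derivative_transform[OF z, rotated]) (use bc cc in auto)
    then show "(cmap d \<circ> cinv ?b has_derivative
        der ?M ((cmap d \<circ> cinv c) \<circ> (cmap c \<circ> cinv ?b)) (cmap ?b x)) (at (cmap ?b x) within ?M)"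
      using at_within_openin[OF o1 z] by simp
  qed
  also have "\<dots> = der ?M (cmap d \<circ> cinv c) (cmap c x) (chart_deriv N c x v)"
    using comp(2)[OF z v] bc xb by (simp add: chart_deriv_eq[OF N c])
  finally show ?thesis by simp
qed

lemma chart_deriv_self:
  fixes N :: "('a::t2_space, 'e::euclidean_space) manifold"
  assumes N: "C1_manifold N" and v: "v \<in> model N"
  shows "chart_deriv N (chart_at N x) x v = v"
proof -
  let ?M = "model N" and ?b = "chart_at N x"
  note b = chart_at_maximal[OF N, of x] and xb = chart_at(2)[OF N, of x]
  note bc = maximal_atlas_is_chart[OF b]
  note M = C1_manifold_subspace[OF N]
  have o: "openin (top_of_set ?M) (cmap ?b ` cdom ?b)" using bc by (simp add: is_chart_def)
  have "(cmap ?b \<circ> cinv ?b has_derivative (\<lambda>v. v)) (at (cmap ?b x) within ?M)"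
    by (rule has_derivative_cong_openin[OF M o, where h = "\<lambda>z. z"]) (use bc xb in auto)
  then show ?thesis
    unfolding chart_deriv_eq[OF N b] by (rule der_eq[OF M chart_in_model[OF bc xb] _ v])
qed

lemma chart_deriv_inverse:
  fixes N :: "('a::t2_space, 'e::euclidean_space) manifold"
  assumes N: "C1_manifold N" and c: "c \<in> maximal_atlas N" and x: "x \<in> cdom c" and v: "v \<in> model N"
  shows "der (model N) (cmap (chart_at N x) \<circ> cinv c) (cmap c x) (chart_deriv N c x v) = v"
  using chart_deriv_transition[OF N c chart_at_maximal[OF N] x chart_at(2)[OF N] v]
    chart_deriv_self[OF N v] by simp

lemma chart_deriv_image:
  fixes N :: "('a::t2_space, 'e::euclidean_space) manifold"
  assumes N: "C1_manifold N" and c: "c \<in> maximal_atlas N" and x: "x \<in> cdom c"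
  shows "inj_on (chart_deriv N c x) (model N)" "chart_deriv N c x ` model N = model N"
proof -
  show inj: "inj_on (chart_deriv N c x) (model N)"
    using chart_deriv_inverse[OF N c x] by (metis inj_onI)
  have "dim (chart_deriv N c x ` model N) = dim (model N)"
    using inj linear_chart_deriv[OF N c x] C1_manifold_subspace[OF N]
    by (intro dim_image_eq) (auto simp: span_eq_iff[THEN iffD2])
  then show "chart_deriv N c x ` model N = model N"
    using chart_deriv_in_model[OF N c x] C1_manifold_subspace[OF N]
    by (intro subspace_dim_equal linear_subspace_image linear_chart_deriv[OF N c x]) auto
qed

lemma mderiv_has_derivative:
  fixes N :: "('a::t2_space, 'e::euclidean_space) manifold"
    and P :: "('b::t2_space, 'g::euclidean_space) manifold"
  assumes N: "C1_manifold N" and P: "C1_manifold P" and f: "C1_map_on N P W f" and x: "x \<in> W"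
  shows "(cmap (chart_at P (f x)) \<circ> f \<circ> cinv (chart_at N x) has_derivative mderiv N P f x)
    (at (cmap (chart_at N x) x) within model N)"
proof -
  let ?M = "model N" and ?b = "chart_at N x" and ?d = "chart_at P (f x)"
  note b = chart_at[OF N, of x] and d = chart_at[OF P, of "f x"]
  note bc = maximal_atlas_is_chart[OF chart_at_maximal[OF N, of x]]
    and dc = maximal_atlas_is_chart[OF chart_at_maximal[OF P, of "f x"]]
  note M = C1_manifold_subspace[OF N]
  have o: "openin (top_of_set ?M) (cmap ?b ` cdom ?b)" using bc by (simp add: is_chart_def)
  have o': "openin (top_of_set ?M) (cmap ?b ` {x \<in> W \<inter> cdom ?b. f x \<in> cdom ?d})"
    by (intro openin_cmap_image[OF bc] open_C1_map_domain[OF f] chart_open[OF bc] chart_open[OF dc]) auto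
  have "C1_on ?M (cmap ?b ` {x \<in> W \<inter> cdom ?b. f x \<in> cdom ?d}) (cmap ?d \<circ> f \<circ> cinv ?b)"
    using f b d unfolding C1_map_on_def by blast
  from C1_on_has_derivative[OF this M o'] x b d at_within_openin[OF o]
  show ?thesis by (simp add: mderiv_def Let_def)
qed

text \<open>
  Differentiability of a map and its differential are defined through the charts of the atlas. They
  are needed in charts adapted to submanifolds, which in general belong to the maximal
  atlas only.
\<close>

theorem C1_map_in_charts:
  fixes N :: "('a::t2_space, 'e::euclidean_space) manifold"
    and P :: "('b::t2_space, 'g::euclidean_space) manifold"
  assumes N: "C1_manifold N" and P: "C1_manifold P" and f: "C1_map_on N P W f"
    and c: "c \<in> maximal_atlas N" and d: "d \<in> maximal_atlas P"
  shows C1_on_in_charts: "C1_on (model N) (cmap c ` {x \<in> W \<inter> cdom c. f x \<in> cdom d}) (cmap d \<circ> f \<circ> cinv c)"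
    and mderiv_in_charts: "\<And>x v. x \<in> W \<Longrightarrow> x \<in> cdom c \<Longrightarrow> f x \<in> cdom d \<Longrightarrow> v \<in> model N \<Longrightarrow>
      chart_deriv P d (f x) (mderiv N P f x v)
        = der (model N) (cmap d \<circ> f \<circ> cinv c) (cmap c x) (chart_deriv N c x v)"
proof -
  let ?M = "model N"
  note cc = maximal_atlas_is_chart[OF c] and dc = maximal_atlas_is_chart[OF d]
  note M = C1_manifold_subspace[OF N] and M' = C1_manifold_subspace[OF P]
  define S where "S = cmap c ` {x \<in> W \<inter> cdom c. f x \<in> cdom d}"
  have oS: "openin (top_of_set ?M) S" unfolding S_def
    by (intro openin_cmap_image[OF cc] open_C1_map_domain[OF f] chart_open[OF cc] chart_open[OF dc]) auto
  have main: "\<exists>T. openin (top_of_set ?M) T \<and> cmap c x \<in> T \<and> T \<subseteq> S \<and> C1_on ?M T (cmap d \<circ> f \<circ> cinv c)"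
    "v \<in> ?M \<Longrightarrow> chart_deriv P d (f x) (mderiv N P f x v)
        = der (model N) (cmap d \<circ> f \<circ> cinv c) (cmap c x) (chart_deriv N c x v)"
    if x: "x \<in> W" "x \<in> cdom c" "f x \<in> cdom d" for x v
  proof -
    define b b' where "b = chart_at N x" and "b' = chart_at P (f x)"
    have b: "b \<in> atlas N" "x \<in> cdom b" and b': "b' \<in> atlas P" "f x \<in> cdom b'"
      unfolding b_def b'_def by (rule chart_at[OF N] chart_at[OF P])+
    have bm: "b \<in> maximal_atlas N" and b'm: "b' \<in> maximal_atlas P"
      using b b' N P atlas_in_maximal_atlas by auto
    note bc = maximal_atlas_is_chart[OF bm] and b'c = maximal_atlas_is_chart[OF b'm]
    let ?A = "{x \<in> W \<inter> (cdom c \<inter> cdom b). f x \<in> cdom d \<inter> cdom b'}"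
    have oA: "open ?A"
      by (intro open_C1_map_domain[OF f] open_Int chart_open[OF cc] chart_open[OF dc] chart_open[OF bc] chart_open[OF b'c])
    have oc: "openin (top_of_set ?M) (cmap c ` ?A)" by (rule openin_cmap_image[OF cc oA]) auto
    have ob: "openin (top_of_set ?M) (cmap b ` ?A)" by (rule openin_cmap_image[OF bc oA]) auto
    have zc: "cmap c x \<in> cmap c ` ?A" and zb: "cmap b x \<in> cmap b ` ?A" using x b b' by auto
    have fb: "C1_on ?M (cmap b ` ?A) (cmap b' \<circ> f \<circ> cinv b)"
    proof (rule C1_on_subset)
      show "C1_on ?M (cmap b ` {x \<in> W \<inter> cdom b. f x \<in> cdom b'}) (cmap b' \<circ> f \<circ> cinv b)"
        using f b b' unfolding C1_map_on_def by blast
    qed auto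
    have sub: "(cmap b' \<circ> f \<circ> cinv b) ` (cmap b ` ?A) \<subseteq> cmap b' ` (cdom b' \<inter> cdom d)"
      using bc by (auto intro!: imageI)
    note comp1 = C1_on_compose[OF M ob fb M' openin_chart_overlap[OF b'm d] maximal_atlas_compatible[OF P b'm d] sub]
    have k: "C1_on ?M (cmap b ` ?A) (cmap d \<circ> f \<circ> cinv b)"
      by (rule C1_on_cong[OF comp1(1)]) (use bc b'c in auto)
    have cb: "C1_on ?M (cmap c ` ?A) (cmap b \<circ> cinv c)"
      by (rule C1_on_subset[OF maximal_atlas_compatible[OF N c bm]]) auto
    have sub': "(cmap b \<circ> cinv c) ` (cmap c ` ?A) \<subseteq> cmap b ` ?A" using cc by (auto intro!: imageI)
    note comp2 = C1_on_compose[OF M oc cb M ob k sub']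
    have "C1_on ?M (cmap c ` ?A) (cmap d \<circ> f \<circ> cinv c)"
      by (rule C1_on_cong[OF comp2(1)]) (use cc bc in auto)
    then show "\<exists>T. openin (top_of_set ?M) T \<and> cmap c x \<in> T \<and> T \<subseteq> S \<and> C1_on ?M T (cmap d \<circ> f \<circ> cinv c)"
      using oc zc by (intro exI[of _ "cmap c ` ?A"]) (auto simp: S_def)
    assume v: "v \<in> ?M"
    define w where "w = chart_deriv N c x v"
    have w: "w \<in> ?M" unfolding w_def by (rule chart_deriv_in_model[OF N c x(2) v])
    have "der ?M (cmap d \<circ> f \<circ> cinv c) (cmap c x) w
        = der ?M ((cmap d \<circ> f \<circ> cinv b) \<circ> (cmap b \<circ> cinv c)) (cmap c x) w"
    proof (rule der_eq[OF M chart_in_model[OF cc x(2)] _ w])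
      show "(cmap d \<circ> f \<circ> cinv c has_derivative
          der ?M ((cmap d \<circ> f \<circ> cinv b) \<circ> (cmap b \<circ> cinv c)) (cmap c x)) (at (cmap c x) within ?M)"
        by (rule has_derivative_cong_openin[OF M oc zc C1_on_has_derivative[OF comp2(1) M oc zc]]) (use cc bc in auto)
    qed
    also have "\<dots> = der ?M (cmap d \<circ> f \<circ> cinv b) (cmap b x) (chart_deriv N b x v)"
      unfolding comp2(2)[OF zc w]
      using chart_deriv_transition[OF N c bm x(2) b(2) v] cc x by (simp add: w_def)
    also have "chart_deriv N b x v = v" unfolding b_def by (rule chart_deriv_self[OF N v])
    also have "der ?M (cmap d \<circ> f \<circ> cinv b) (cmap b x) v
        = der ?M ((cmap d \<circ> cinv b') \<circ> (cmap b' \<circ> f \<circ> cinv b)) (cmap b x) v"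
    proof (rule der_eq[OF M chart_in_model[OF bc b(2)] _ v])
      show "(cmap d \<circ> f \<circ> cinv b has_derivative
          der ?M ((cmap d \<circ> cinv b') \<circ> (cmap b' \<circ> f \<circ> cinv b)) (cmap b x)) (at (cmap b x) within ?M)"
        by (rule has_derivative_cong_openin[OF M ob zb C1_on_has_derivative[OF comp1(1) M ob zb]]) (use bc b'c in auto)
    qed
    also have "\<dots> = der (model P) (cmap d \<circ> cinv b') (cmap b' (f x)) (der ?M (cmap b' \<circ> f \<circ> cinv b) (cmap b x) v)"
      unfolding comp1(2)[OF zb v] using bc b by simp
    also have "der ?M (cmap b' \<circ> f \<circ> cinv b) (cmap b x) v = mderiv N P f x v"
      unfolding b_def b'_def
      by (rule der_eq[OF M _ mderiv_has_derivative[OF N P f x(1)] v])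
        (use chart_in_model[OF bc b(2)] in \<open>simp add: b_def\<close>)
    also have "der (model P) (cmap d \<circ> cinv b') (cmap b' (f x)) = chart_deriv P d (f x)"
      unfolding b'_def by (simp add: chart_deriv_eq[OF P d])
    finally show "chart_deriv P d (f x) (mderiv N P f x v)
        = der (model N) (cmap d \<circ> f \<circ> cinv c) (cmap c x) (chart_deriv N c x v)" unfolding w_def by (rule sym)
  qed
  show "C1_on (model N) (cmap c ` {x \<in> W \<inter> cdom c. f x \<in> cdom d}) (cmap d \<circ> f \<circ> cinv c)"
    unfolding S_def[symmetric] by (rule C1_on_local[OF M oS]) (use main(1) in \<open>auto simp: S_def\<close>)
  show "chart_deriv P d (f x) (mderiv N P f x v)
        = der (model N) (cmap d \<circ> f \<circ> cinv c) (cmap c x) (chart_deriv N c x v)"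
    if "x \<in> W" "x \<in> cdom c" "f x \<in> cdom d" "v \<in> model N" for x v
    by (rule main(2)[OF that])
qed

lemma mderiv_in_model:
  fixes N :: "('a::t2_space, 'e::euclidean_space) manifold"
    and P :: "('b::t2_space, 'g::euclidean_space) manifold"
  assumes N: "C1_manifold N" and P: "C1_manifold P" and f: "C1_map_on N P W f" and x: "x \<in> W"
    and v: "v \<in> model N"
  shows "mderiv N P f x v \<in> model P"
proof -
  let ?M = "model N" and ?b = "chart_at N x" and ?d = "chart_at P (f x)"
  note b = chart_at[OF N, of x] and d = chart_at[OF P, of "f x"]
  note bc = maximal_atlas_is_chart[OF chart_at_maximal[OF N, of x]]
    and dc = maximal_atlas_is_chart[OF chart_at_maximal[OF P, of "f x"]]
  have o: "openin (top_of_set ?M) (cmap ?b ` {x \<in> W \<inter> cdom ?b. f x \<in> cdom ?d})"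
    by (intro openin_cmap_image[OF bc] open_C1_map_domain[OF f] chart_open[OF bc] chart_open[OF dc]) auto
  show ?thesis
    by (rule has_derivative_in_subspace[OF C1_manifold_subspace[OF N] C1_manifold_subspace[OF P] o _
        mderiv_has_derivative[OF N P f x] _ v]) (use x b d bc chart_in_model[OF dc] in auto)
qed

lemma linear_mderiv:
  fixes N :: "('a::t2_space, 'e::euclidean_space) manifold"
    and P :: "('b::t2_space, 'g::euclidean_space) manifold"
  assumes "C1_manifold N" "C1_manifold P" "C1_map_on N P W f" "x \<in> W"
  shows "linear (mderiv N P f x)"
  using mderiv_has_derivative[OF assms] by (rule has_derivative_linear)

section \<open>Tangent spaces of submanifolds\<close>

lemma adapted_chart_mem:
  assumes c: "adapted_chart N S c V" and x: "x \<in> cdom c"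
  shows "x \<in> S \<longleftrightarrow> cmap c x \<in> V"
proof -
  have cm: "c \<in> maximal_atlas N" and eq: "cmap c ` (cdom c \<inter> S) = cmap c ` cdom c \<inter> V"
    using c by (auto simp: adapted_chart_def)
  note cc = maximal_atlas_is_chart[OF cm]
  have "x \<in> S" if "cmap c x \<in> V"
  proof -
    have "cmap c x \<in> cmap c ` (cdom c \<inter> S)" unfolding eq using x that by simp
    then obtain x' where x': "x' \<in> cdom c" "x' \<in> S" "cmap c x = cmap c x'" by auto
    then have "x = x'" using x cinv_cmap[OF cc] by metis
    then show ?thesis using x' by simp
  qed
  moreover have "cmap c x \<in> V" if "x \<in> S"
  proof -
    have "cmap c x \<in> cmap c ` (cdom c \<inter> S)" using x that by simp
    then show ?thesis unfolding eq by simp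
  qed
  ultimately show ?thesis by blast
qed

text \<open>
  The tangent space is defined by some adapted chart, and any other one defines the same space: the
  transition map takes the submanifold into itself, so its derivative maps one of the two subspaces
  into the other.
\<close>

lemma tangent_space_in_chart:
  fixes N :: "('a::t2_space, 'e::euclidean_space) manifold"
  assumes N: "C1_manifold N" and c: "adapted_chart N S c V" and x: "x \<in> S" "x \<in> cdom c"
  shows "tangent_space N S x = {v \<in> model N. chart_deriv N c x v \<in> V}"
proof -
  let ?M = "model N"
  note M = C1_manifold_subspace[OF N]
  have cm: "c \<in> maximal_atlas N" and V: "subspace V"
    using c by (auto simp: adapted_chart_def)
  note cc = maximal_atlas_is_chart[OF cm]
  have "chart_deriv N c x v \<in> V"
    if v: "v \<in> ?M" and d: "x \<in> cdom d" "adapted_chart N S d V'" and dv: "chart_deriv N d x v \<in> V'" for v d V'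
  proof -
    have dm: "d \<in> maximal_atlas N" and V': "subspace V'" "V' \<subseteq> ?M"
      using d by (auto simp: adapted_chart_def)
    note dc = maximal_atlas_is_chart[OF dm]
    let ?B = "cmap d ` (cdom d \<inter> cdom c)"
    have o: "openin (top_of_set ?M) ?B" by (rule openin_chart_overlap[OF dm cm])
    then have o': "openin (top_of_set V') (?B \<inter> V')"
      using V'(2) by (auto simp: openin_open)
    have z: "cmap d x \<in> ?B \<inter> V'" using x d adapted_chart_mem[OF d(2)] by auto
    have D: "(cmap c \<circ> cinv d has_derivative der ?M (cmap c \<circ> cinv d) (cmap d x)) (at (cmap d x) within V')"
      by (rule has_derivative_subset[OF C1_on_has_derivative[OF maximal_atlas_compatible[OF N dm cm] M o] V'(2)])
        (use z in auto)
    have "der ?M (cmap c \<circ> cinv d) (cmap d x) (chart_deriv N d x v) \<in> V"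
    proof (rule has_derivative_in_subspace[OF V'(1) V o' z D _ dv])
      fix z assume z: "z \<in> ?B \<inter> V'"
      then obtain y where y: "y \<in> cdom d" "y \<in> cdom c" "z = cmap d y" by auto
      then have "y \<in> S" using z adapted_chart_mem[OF d(2)] by simp
      then show "(cmap c \<circ> cinv d) z \<in> V" using y dc adapted_chart_mem[OF c] by simp
    qed
    then show ?thesis using chart_deriv_transition[OF N dm cm d(1) x(2) v] by simp
  qed
  then show ?thesis using c x by (auto simp: tangent_space_def)
qed

lemma subspace_tangent_space:
  fixes N :: "('a::t2_space, 'e::euclidean_space) manifold"
  assumes N: "C1_manifold N" and S: "C1_submanifold N S" and x: "x \<in> S"
  shows "subspace (tangent_space N S x)"
proof -
  obtain c V where c: "x \<in> cdom c" "adapted_chart N S c V" using S x by (auto simp: C1_submanifold_def)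
  have cm: "c \<in> maximal_atlas N" and V: "subspace V" using c by (auto simp: adapted_chart_def)
  have "tangent_space N S x = model N \<inter> (chart_deriv N c x -` V)"
    using tangent_space_in_chart[OF N c(2) x c(1)] by auto
  then show ?thesis
    using linear_chart_deriv[OF N cm c(1)] V C1_manifold_subspace[OF N]
    by (simp add: subspace_inter linear_subspace_vimage)
qed

lemma chart_deriv_tangent_space:
  fixes N :: "('a::t2_space, 'e::euclidean_space) manifold"
  assumes N: "C1_manifold N" and c: "adapted_chart N S c V" and x: "x \<in> S" "x \<in> cdom c"
  shows "chart_deriv N c x ` tangent_space N S x = V"
proof -
  have cm: "c \<in> maximal_atlas N" and V: "V \<subseteq> model N" using c by (auto simp: adapted_chart_def)
  show ?thesis
    using chart_deriv_image(2)[OF N cm x(2)] V tangent_space_in_chart[OF N c x] by auto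
qed

lemma subspace_foliation_tangent:
  fixes N :: "('a::t2_space, 'e::euclidean_space) manifold"
    and P :: "('b::t2_space, 'g::euclidean_space) manifold"
  assumes N: "C1_manifold N" and P: "C1_manifold P" and f: "C1_map_on N P UNIV f"
    and S: "C1_submanifold N S" and x: "x \<in> S"
  shows "subspace (foliation_tangent N P f S x)" "foliation_tangent N P f S x \<subseteq> model N"
proof -
  have "foliation_tangent N P f S x = tangent_space N S x \<inter> {v. mderiv N P f x v = 0}"
    by (auto simp: foliation_tangent_def)
  then show "subspace (foliation_tangent N P f S x)"
    using subspace_tangent_space[OF N S x] linear_mderiv[OF N P f UNIV_I]
    by (simp add: subspace_inter linear_subspace_kernel)
  show "foliation_tangent N P f S x \<subseteq> model N"
    by (auto simp: foliation_tangent_def tangent_space_def)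
qed

section \<open>Maps of constant rank\<close>

text \<open>
  A right inverse \<open>h\<close> of \<open>g\<close> embeds \<open>g ` W\<close> in \<open>W\<close>, so its image is all of \<open>W\<close> by dimension, and
  \<open>h \<circ> g\<close> is the identity on \<open>W\<close>.
\<close>

lemma linear_onto_same_dim_kernel:
  fixes g :: "'g::euclidean_space \<Rightarrow> 'e::euclidean_space"
  assumes g: "linear g" and W: "subspace W" and dim: "dim (g ` W) = dim W"
    and w: "w \<in> W" "g w = 0"
  shows "w = 0"
proof -
  obtain h where h: "range h \<subseteq> W" "linear h" "\<And>v. v \<in> g ` W \<Longrightarrow> g (h v) = v"
    using linear_exists_right_inverse_on[OF g W] by (metis image_subset_iff rangeI subsetI)
  have gW: "subspace (g ` W)" by (rule linear_subspace_image[OF g W])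
  have "inj_on h (g ` W)" using h(3) by (metis inj_onI)
  then have "dim (h ` g ` W) = dim (g ` W)"
    using gW by (intro dim_image_eq[OF h(2)]) (simp add: span_eq_iff[THEN iffD2])
  then have "h ` g ` W = W"
    using h(1) dim by (intro subspace_dim_equal linear_subspace_image[OF h(2)] gW W) auto
  then obtain v where v: "v \<in> g ` W" "w = h v" using w(1) by blast
  then have "v = 0" using h(3) w(2) by metis
  then show ?thesis using v linear_0[OF h(2)] by simp
qed

text \<open>
  The constant rank theorem for the restriction of \<open>F\<close> to \<open>V\<close>, with a straightening \<open>\<Psi>\<close> that is
  defined on a neighbourhood of \<open>q\<close> in the whole space and moves points along \<open>V\<close> only, so that it can
  be composed with a chart adapted to \<open>V\<close>.

  Let \<open>K\<close> be the kernel of the derivative of \<open>F\<close> at \<open>q\<close> on \<open>V\<close>, let \<open>J\<close> be its orthogonal complement in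
  \<open>V\<close>, and let \<open>g\<close> be a linear map into \<open>J\<close> that inverts this derivative on \<open>J\<close>. On \<open>V\<close> the map \<open>\<Psi>\<close> is
  \<open>z \<mapsto> proj K z + g (F z - F q)\<close>, whose derivative at \<open>q\<close> is the identity, and the inverse function
  theorem applies. In the new coordinates of \<open>V\<close> the points of \<open>K\<close> form the fibre of \<open>g \<circ> F\<close> through \<open>q\<close>. As the
  rank of \<open>F\<close> is not larger than that of \<open>g \<circ> F\<close>, both derivatives have the same kernel, so that \<open>F\<close> itself
  is constant along \<open>K\<close>.
\<close>

theorem constant_rank_straightening:
  fixes M V :: "'e::euclidean_space set" and F :: "'e \<Rightarrow> 'g::euclidean_space"
  assumes M: "subspace M" and V: "subspace V" "V \<subseteq> M" and S: "openin (top_of_set M) S"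
    and F: "C1_on M S F" and q: "q \<in> S" "q \<in> V"
    and rank: "\<And>z. z \<in> S \<inter> V \<Longrightarrow> dim (der M F z ` V) = r"
  obtains G \<Psi> \<Xi> K e where "open G" "q \<in> G" "M \<inter> G \<subseteq> S" "subspace K" "K \<subseteq> V" "e > 0"
    and "homeomorphism G (ball (\<Psi> q) e) \<Psi> \<Xi>" "\<Psi> q \<in> K"
    and "C1_on M (M \<inter> G) \<Psi>" "C1_on M (M \<inter> ball (\<Psi> q) e) \<Xi>"
    and "\<And>z. z \<in> G \<Longrightarrow> \<Psi> z - z \<in> V"
    and "\<And>z. z \<in> G \<inter> V \<Longrightarrow> F z = F q \<longleftrightarrow> \<Psi> z \<in> K"
    and "\<And>z u. z \<in> G \<inter> V \<Longrightarrow> u \<in> M \<Longrightarrow> der M \<Psi> z u \<in> K \<longleftrightarrow> u \<in> V \<and> der M F z u = 0"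
proof -
  have SM: "S \<subseteq> M" using S by (auto dest: openin_imp_subset)
  note dF = C1_on_has_derivative[OF F M S]
  have linF: "linear (der M F z)" if "z \<in> S" for z using dF[OF that] by (rule has_derivative_linear)
  define K where "K = {v \<in> V. der M F q v = 0}"
  define J where "J = {v \<in> V. \<forall>u\<in>K. v \<bullet> u = 0}"
  have "K = V \<inter> {v. der M F q v = 0}" by (auto simp: K_def)
  then have K: "subspace K" "K \<subseteq> V"
    using subspace_inter[OF V(1) linear_subspace_kernel[OF linF[OF q(1)]]] by simp_all
  have J: "subspace J"
    using V(1) unfolding J_def subspace_def by (auto simp: inner_add_left)
  have KJ: "v = 0" if "v \<in> K" "v \<in> J" for v using that by (auto simp: J_def)
  have decomp: "v - proj K v \<in> J" if "v \<in> V" for v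
    using that V(1) K proj_orthogonal[OF K(1)] by (auto simp: J_def subset_iff intro!: subspace_diff)
  have "inj_on (der M F q) J"
  proof (rule inj_onI)
    fix v w assume vw: "v \<in> J" "w \<in> J" "der M F q v = der M F q w"
    then have "v - w \<in> K" using V(1) linear_diff[OF linF[OF q(1)]]
      by (auto simp: K_def J_def intro: subspace_diff)
    then have "v - w = 0" using KJ J vw subspace_diff by blast
    then show "v = w" by simp
  qed
  then obtain g where g: "range g \<subseteq> J" "linear g" "\<And>v. v \<in> J \<Longrightarrow> g (der M F q v) = v"
    using linear_exists_left_inverse_on[OF linF[OF q(1)] J] by auto
  have gV: "g y \<in> V" for y using g(1) by (auto simp: J_def)

  let ?P = "proj V"
  note blP = bounded_linear_proj[OF V(1)] and blK = bounded_linear_proj[OF K(1)]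
  have blg: "bounded_linear g" using g(2) by (simp add: linear_conv_bounded_linear)
  define \<Psi> where "\<Psi> x = x - ?P x + proj K x + g (F (?P x) - F q)" for x
  define A where "A x u = u - ?P u + proj K u + g (der M F (?P x) (?P u))" for x u
  obtain T where T: "open T" "S = M \<inter> T" using S by (auto simp: openin_open)
  define U1 where "U1 = {x. ?P x \<in> T} \<inter> T"
  have "open (?P -` T)" by (rule open_vimage[OF T(1) linear_continuous_on[OF blP]])
  then have oU1: "open U1" using T(1) by (auto simp: U1_def vimage_def)
  have PV: "?P x \<in> V" for x using V(1) by simp
  have PS: "?P x \<in> S" if "x \<in> U1" for x using that PV V(2) T(2) by (auto simp: U1_def)
  have Pid: "?P x = x" if "x \<in> V" for x using proj_id[OF V(1) that] .
  have qU1: "q \<in> U1" using q T(2) Pid by (auto simp: U1_def)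
  have Psi_diff: "\<Psi> x - x \<in> V" for x
    unfolding \<Psi>_def using PV[of x] gV proj_in[OF K(1), of x] K(2) V(1)
    by (auto simp: algebra_simps intro!: subspace_add subspace_diff)
  have A_diff: "A x u - u \<in> V" for x u
    unfolding A_def using PV[of u] gV proj_in[OF K(1), of u] K(2) V(1)
    by (auto simp: algebra_simps intro!: subspace_add subspace_diff)
  have dPsi: "(\<Psi> has_derivative A x) (at x)" if x: "x \<in> U1" for x
  proof -
    have "(F has_derivative der M F (?P x)) (at (?P x) within range ?P)"
      by (rule has_derivative_subset[OF dF[OF PS[OF x]]]) (use PV V(2) in auto)
    from has_derivative_in_compose[OF bounded_linear_imp_has_derivative[OF blP] this]
    have "((\<lambda>x. F (?P x)) has_derivative (\<lambda>u. der M F (?P x) (?P u))) (at x)" by simp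
    from bounded_linear.has_derivative[OF blg has_derivative_diff[OF this has_derivative_const[of "F q"]]]
    have "((\<lambda>x. g (F (?P x) - F q)) has_derivative (\<lambda>u. g (der M F (?P x) (?P u)))) (at x)" by simp
    then show ?thesis unfolding \<Psi>_def A_def
      by (intro has_derivative_add has_derivative_diff has_derivative_ident
          bounded_linear_imp_has_derivative[OF blP] bounded_linear_imp_has_derivative[OF blK])
  qed
  have blA: "bounded_linear (A x)" if "x \<in> U1" for x using dPsi[OF that] by (rule has_derivative_bounded_linear)
  define A' where "A' x = Blinfun (A x)" for x
  have A'[simp]: "blinfun_apply (A' x) = A x" if "x \<in> U1" for x
    unfolding A'_def using blA[OF that] by (simp add: bounded_linear_Blinfun_apply)
  have contA': "continuous_on U1 A'"
  proof (rule continuous_on_blinfun_componentwise)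
    fix b :: 'e
    have "continuous_on S (\<lambda>z. der M F z (?P b))"
      using F C1_on_iff[OF M S] PV V(2) by blast
    then have "continuous_on U1 (\<lambda>x. der M F (?P x) (?P b))"
      by (rule continuous_on_compose2) (use linear_continuous_on[OF blP] PS in auto)
    then have "continuous_on U1 (\<lambda>x. A x b)"
      unfolding A_def by (intro continuous_intros bounded_linear.continuous_on[OF blg])
    then show "continuous_on U1 (\<lambda>x. A' x b)" by (simp cong: continuous_on_cong)
  qed
  have Aq: "A q u = u" for u
  proof -
    have "proj K (?P u) = proj K u"
      by (rule proj_unique[OF K(1)])
        (use K V(1) in \<open>auto simp: inner_diff_left proj_inner subset_iff\<close>)
    then have j: "?P u - proj K u \<in> J" using decomp[OF PV[of u]] by simp
    have "der M F q (proj K u) = 0" using proj_in[OF K(1), of u] by (simp add: K_def)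
    then have "der M F q (?P u) = der M F q (?P u - proj K u)"
      by (simp add: linear_diff[OF linF[OF q(1)]])
    then have "g (der M F q (?P u)) = ?P u - proj K u" using g(3)[OF j] by simp
    then show ?thesis using Pid[OF q(2)] by (simp add: A_def)
  qed

  \<comment> \<open>
    Where \<open>A x\<close> is within distance \<open>1/2\<close> of the identity, the norm of its inverse is at most 2. This
    bound makes the derivative of the inverse function continuous.
  \<close>
  define U where "U = {x \<in> U1. dist (A' x) (A' q) < 1/2}"
  have "open (U1 \<inter> A' -` ball (A' q) (1/2))"
    by (rule continuous_open_preimage[OF contA' oU1 open_ball])
  moreover have "U1 \<inter> A' -` ball (A' q) (1/2) = U" by (auto simp: U_def dist_commute)
  ultimately have oU: "open U" by simp
  have UU1: "U \<subseteq> U1" and qU: "q \<in> U" using qU1 by (auto simp: U_def)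
  have lower: "norm u \<le> 2 * norm (A x u)" if x: "x \<in> U" for x u
  proof -
    have "norm (A x u - u) = norm ((A' x - A' q) u)"
      using x UU1 qU1 Aq by (simp add: blinfun.diff_left subset_iff)
    also have "\<dots> \<le> norm (A' x - A' q) * norm u" by (rule norm_blinfun)
    also have "\<dots> \<le> 1/2 * norm u"
      using x by (intro mult_right_mono) (auto simp: U_def dist_norm)
    finally have "norm (A x u - u) \<le> norm u / 2" by simp
    moreover have "norm u \<le> norm (A x u) + norm (A x u - u)"
      by (metis norm_triangle_sub norm_minus_commute)
    ultimately show ?thesis by simp
  qed
  have "id_blinfun o\<^sub>L A' q = id_blinfun"
    by (rule blinfun_eqI) (use qU1 Aq in simp)
  note inverse = inverse_function_theorem[OF oU _ continuous_on_subset[OF contA' UU1] qU this]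
  have dPsiU: "(\<Psi> has_derivative blinfun_apply (A' x)) (at x)" if "x \<in> U" for x
    using dPsi that UU1 by auto
  obtain U' V' \<Xi> B where IFT: "open U'" "U' \<subseteq> U" "q \<in> U'" "open V'" "\<Psi> q \<in> V'"
    "homeomorphism U' V' \<Psi> \<Xi>"
    and dXi: "\<And>y. y \<in> V' \<Longrightarrow> (\<Xi> has_derivative B y) (at y)"
    and B: "\<And>y. y \<in> V' \<Longrightarrow> B y = inv (blinfun_apply (A' (\<Xi> y)))"
    and bij: "\<And>y. y \<in> V' \<Longrightarrow> bij (blinfun_apply (A' (\<Xi> y)))"
    by (rule inverse[OF dPsiU], assumption, rule that)
  have XiU: "\<Xi> y \<in> U'" if "y \<in> V'" for y using IFT(6) that by (auto simp: homeomorphism_def)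
  have AB: "A (\<Xi> y) (B y v) = v" if "y \<in> V'" for y v
    using bij[OF that] B[OF that] XiU[OF that] IFT(2) UU1 A' by (metis bij_inv_eq_iff subsetD)
  obtain e where e: "e > 0" "ball (\<Psi> q) e \<subseteq> V'" using IFT(4,5) open_contains_ball by metis
  define G where "G = U' \<inter> \<Psi> -` ball (\<Psi> q) e"
  have OU1: "G \<subseteq> U1" and OU: "G \<subseteq> U" using IFT(2) UU1 by (auto simp: G_def)
  have contPsi: "continuous_on U' \<Psi>" and contXi: "continuous_on V' \<Xi>"
    using IFT(6) by (auto simp: homeomorphism_def)
  have oO: "open G" unfolding G_def by (rule continuous_open_preimage[OF contPsi IFT(1) open_ball])
  have qO: "q \<in> G" using IFT(3) e(1) by (simp add: G_def)
  have GU': "G \<subseteq> U'" by (simp add: G_def)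
  have "\<Psi> ` G = ball (\<Psi> q) e"
  proof
    show "ball (\<Psi> q) e \<subseteq> \<Psi> ` G"
    proof
      fix y assume y: "y \<in> ball (\<Psi> q) e"
      then have "\<Psi> (\<Xi> y) = y" "\<Xi> y \<in> U'"
        using e(2) XiU homeomorphism_apply2[OF IFT(6)] by auto
      then show "y \<in> \<Psi> ` G" using y unfolding G_def by (metis IntI imageI vimageI)
    qed
  qed (auto simp: G_def)
  then have hom: "homeomorphism G (ball (\<Psi> q) e) \<Psi> \<Xi>"
    by (rule homeomorphism_of_subsets[OF IFT(6) GU' e(2)])
  have MO: "M \<inter> G \<subseteq> S" using OU1 T(2) by (auto simp: U1_def)
  have Psi_q: "\<Psi> q \<in> K" using Pid[OF q(2)] K(1) linear_0[OF g(2)] by (simp add: \<Psi>_def)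

  have C1Psi: "C1_on M (M \<inter> G) \<Psi>"
  proof (rule C1_onI)
    show "openin (top_of_set M) (M \<inter> G)" using oO by blast
    show "(\<Psi> has_derivative A x) (at x within M)" if "x \<in> M \<inter> G" for x
      by (rule has_derivative_at_withinI[OF dPsi]) (use that OU1 in auto)
    show "continuous_on (M \<inter> G) (\<lambda>x. A x v)" for v
    proof -
      have "continuous_on U1 (\<lambda>x. A' x v)" by (intro continuous_intros contA')
      then have "continuous_on (M \<inter> G) (\<lambda>x. A' x v)" by (rule continuous_on_subset) (use OU1 in auto)
      then show ?thesis by (rule continuous_on_eq) (use OU1 in auto)
    qed
  qed
  have C1Xi: "C1_on M (M \<inter> ball (\<Psi> q) e) \<Xi>"
  proof (rule C1_onI)
    show "openin (top_of_set M) (M \<inter> ball (\<Psi> q) e)" by blast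
    show "(\<Xi> has_derivative B y) (at y within M)" if "y \<in> M \<inter> ball (\<Psi> q) e" for y
      by (rule has_derivative_at_withinI[OF dXi]) (use that e(2) in auto)
    have "continuous_on V' (\<lambda>y. B y v)" for v
      unfolding continuous_on
    proof
      fix y assume y: "y \<in> V'"
      let ?f = "\<lambda>t. 2 * (norm (A' (\<Xi> t) - A' (\<Xi> y)) * norm (B y v))"
      have "continuous_on V' (\<lambda>t. A' (\<Xi> t))"
        by (rule continuous_on_compose2[OF contA' contXi]) (use XiU IFT(2) UU1 in auto)
      then have "((\<lambda>t. A' (\<Xi> t)) \<longlongrightarrow> A' (\<Xi> y)) (at y within V')" using y by (simp add: continuous_on)
      from tendsto_norm[OF tendsto_diff[OF this tendsto_const[of "A' (\<Xi> y)"]]]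
      have "((\<lambda>t. norm (A' (\<Xi> t) - A' (\<Xi> y))) \<longlongrightarrow> 0) (at y within V')" by simp
      from tendsto_mult[OF tendsto_const[of 2] tendsto_mult[OF this tendsto_const[of "norm (B y v)"]]]
      have lim: "(?f \<longlongrightarrow> 0) (at y within V')" by simp
      have bound: "norm (B t v - B y v) \<le> ?f t" if t: "t \<in> V'" for t
      proof -
        have inU: "\<Xi> t \<in> U" "\<Xi> t \<in> U1" "\<Xi> y \<in> U1" using XiU[OF t] XiU[OF y] IFT(2) UU1 by auto
        have "A (\<Xi> t) (B t v - B y v) = A (\<Xi> y) (B y v) - A (\<Xi> t) (B y v)"
          using AB[OF t] AB[OF y] by (simp add: linear_diff[OF bounded_linear.linear[OF blA[OF inU(2)]]])
        also have "\<dots> = - (A' (\<Xi> t) - A' (\<Xi> y)) (B y v)"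
          using inU by (simp add: blinfun.diff_left)
        finally have "norm (A (\<Xi> t) (B t v - B y v)) \<le> norm (A' (\<Xi> t) - A' (\<Xi> y)) * norm (B y v)"
          using norm_blinfun[of "A' (\<Xi> t) - A' (\<Xi> y)" "B y v"] by simp
        then show ?thesis using lower[OF inU(1), of "B t v - B y v"] by simp
      qed
      have "((\<lambda>t. B t v - B y v) \<longlongrightarrow> 0) (at y within V')"
        by (rule Lim_null_comparison[OF _ lim])
          (use bound in \<open>auto simp: eventually_at_filter intro!: always_eventually\<close>)
      then show "((\<lambda>t. B t v) \<longlongrightarrow> B y v) (at y within V')" by (simp add: LIM_zero_iff)
    qed
    then show "continuous_on (M \<inter> ball (\<Psi> q) e) (\<lambda>y. B y v)" for v
      by (rule continuous_on_subset) (use e(2) in auto)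
  qed

  \<comment> \<open>
    On \<open>V\<close> the map \<open>g\<close> is injective on the image of the differential of \<open>F\<close>, because the rank has
    not increased.
  \<close>
  have rank_eq: "der M F z v = 0" if z: "z \<in> G \<inter> V" and v: "v \<in> V" and gv: "g (der M F z v) = 0" for z v
  proof (rule linear_onto_same_dim_kernel[OF g(2) _ _ _ gv])
    have zS: "z \<in> S" using z MO V(2) by auto
    show sub: "subspace (der M F z ` V)" by (rule linear_subspace_image[OF linF[OF zS] V(1)])
    show "der M F z v \<in> der M F z ` V" using v by simp
    have zU: "z \<in> U" using z OU by auto
    have Az: "A z u = proj K u + g (der M F z u)" if "u \<in> V" for u
      using Pid[OF that] Pid z by (simp add: A_def)
    have linA: "linear (A z)" using blA zU UU1 by (auto intro: bounded_linear.linear)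
    have inj: "inj_on (A z) V"
    proof (rule inj_onI)
      fix u w assume "A z u = A z w"
      then have "A z (u - w) = 0" by (simp add: linear_diff[OF linA])
      then show "u = w" using lower[OF zU, of "u - w"] by simp
    qed
    have "A z ` V \<subseteq> V"
      using A_diff V(1) by (metis diff_add_cancel image_subsetI subspace_add)
    moreover have "dim (A z ` V) = dim V"
      using inj by (intro dim_image_eq linA) (simp add: span_eq_iff[THEN iffD2, OF V(1)])
    ultimately have onto: "A z ` V = V"
      by (intro subspace_dim_equal linear_subspace_image[OF linA] V(1)) auto
    have "J \<subseteq> g ` der M F z ` V"
    proof
      fix j assume j: "j \<in> J"
      then have "j \<in> A z ` V" using onto by (auto simp: J_def)
      then obtain u where u: "u \<in> V" "j = A z u" by auto
      have "proj K u = j - g (der M F z u)" using u Az by simp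
      then have "proj K u \<in> J" using j g(1) subspace_diff[OF J] by auto
      then have "proj K u = 0" using KJ K(1) by simp
      then show "j \<in> g ` der M F z ` V" using u Az by auto
    qed
    then have img: "g ` der M F z ` V = J" using g(1) by auto
    have "der M F q ` V = der M F q ` J"
    proof
      show "der M F q ` J \<subseteq> der M F q ` V" by (auto simp: J_def)
      show "der M F q ` V \<subseteq> der M F q ` J"
      proof
        fix y assume "y \<in> der M F q ` V"
        then obtain v where v: "v \<in> V" "y = der M F q v" by auto
        have "der M F q (proj K v) = 0" using proj_in[OF K(1), of v] by (simp add: K_def)
        then have "y = der M F q (v - proj K v)" by (simp add: v linear_diff[OF linF[OF q(1)]])
        then show "y \<in> der M F q ` J" using decomp[OF v(1)] by blast
      qed
    qed
    moreover have "dim (der M F q ` J) = dim J"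
      using \<open>inj_on (der M F q) J\<close> by (intro dim_image_eq linF q) (simp add: span_eq_iff[THEN iffD2, OF J])
    ultimately have "dim J = r" using rank[of q] q by simp
    then show "dim (g ` der M F z ` V) = dim (der M F z ` V)"
      using img rank[of z] z zS by simp
  qed
  have kernel: "A z u \<in> K \<longleftrightarrow> u \<in> V \<and> der M F z u = 0" if z: "z \<in> G \<inter> V" for z u
  proof
    assume "u \<in> V \<and> der M F z u = 0"
    then show "A z u \<in> K" using Pid[of u] Pid[of z] z K(1) linear_0[OF g(2)] by (simp add: A_def)
  next
    assume AK: "A z u \<in> K"
    then have u: "u \<in> V" using A_diff[of z u] K(2) V(1) subspace_diff[OF V(1), of "A z u" "A z u - u"] by auto
    then have "g (der M F z u) = A z u - proj K u" using Pid[of u] Pid[of z] z by (simp add: A_def)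
    then have "g (der M F z u) \<in> K" using subspace_diff[OF K(1) AK proj_in[OF K(1), of u]] by simp
    then have "g (der M F z u) = 0" using KJ g(1) by blast
    then show "u \<in> V \<and> der M F z u = 0" using rank_eq[OF z u] u by simp
  qed
  have derPsi: "der M \<Psi> z u = A z u" if "z \<in> G \<inter> V" "u \<in> M" for z u
    using der_eq[OF M _ has_derivative_at_withinI[OF dPsi] that(2)] that V(2) OU1 by auto

  have fibre: "F z = F q \<longleftrightarrow> \<Psi> z \<in> K" if z: "z \<in> G \<inter> V" for z
  proof
    assume "F z = F q"
    then show "\<Psi> z \<in> K" using Pid[of z] z K(1) linear_0[OF g(2)] by (simp add: \<Psi>_def)
  next
    assume sK: "\<Psi> z \<in> K"
    have sb: "\<Psi> z \<in> ball (\<Psi> q) e" using z by (simp add: G_def)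
    define k where "k = \<Psi> z - \<Psi> q"
    have k: "k \<in> K" using subspace_diff[OF K(1) sK Psi_q] by (simp add: k_def)
    define s where "s t = \<Psi> q + t *\<^sub>R k" for t :: real
    have sKt: "s t \<in> K" for t using Psi_q k K(1) by (simp add: s_def subspace_add subspace_scale)
    have sball: "s t \<in> ball (\<Psi> q) e" if t: "t \<in> {0..1}" for t
    proof -
      have "norm (t *\<^sub>R k) \<le> norm k" using t by (simp add: mult_left_le_one_le)
      also have "norm k < e" using sb by (simp add: k_def dist_norm norm_minus_commute)
      finally show ?thesis by (simp add: s_def dist_norm)
    qed
    have XiO: "\<Xi> (s t) \<in> G \<inter> V" "\<Psi> (\<Xi> (s t)) = s t" if t: "t \<in> {0..1}" for t
    proof -
      show eq: "\<Psi> (\<Xi> (s t)) = s t" using hom sball[OF t] by (simp add: homeomorphism_def)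
      have "\<Xi> (s t) \<in> G" using hom sball[OF t] by (auto simp: homeomorphism_def)
      moreover have "\<Xi> (s t) \<in> V"
        using Psi_diff[of "\<Xi> (s t)"] eq sKt[of t] K(2) subspace_diff[OF V(1), of "s t" "s t - \<Xi> (s t)"] by auto
      ultimately show "\<Xi> (s t) \<in> G \<inter> V" by simp
    qed
    have "((\<lambda>t. F (\<Xi> (s t))) has_derivative (\<lambda>h. 0)) (at t within {0..1})" if t: "t \<in> {0..1}" for t
    proof -
      have yV: "s t \<in> V'" using sball[OF t] e(2) by auto
      have "(s has_derivative (\<lambda>h. h *\<^sub>R k)) (at t within {0..1})"
        unfolding s_def by (auto intro!: derivative_eq_intros)
      from has_derivative_compose[OF this dXi[OF yV]]
      have "((\<lambda>t. \<Xi> (s t)) has_derivative (\<lambda>h. B (s t) (h *\<^sub>R k))) (at t within {0..1})" .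
      moreover have "(F has_derivative der M F (\<Xi> (s t))) (at (\<Xi> (s t)) within (\<lambda>t. \<Xi> (s t)) ` {0..1})"
        by (rule has_derivative_subset[OF dF]) (use XiO t MO V(2) in auto)
      ultimately have "((\<lambda>t. F (\<Xi> (s t))) has_derivative (\<lambda>h. der M F (\<Xi> (s t)) (B (s t) (h *\<^sub>R k))))
          (at t within {0..1})"
        by (rule has_derivative_in_compose)
      moreover have "der M F (\<Xi> (s t)) (B (s t) (h *\<^sub>R k)) = 0" for h
      proof -
        have "A (\<Xi> (s t)) (B (s t) (h *\<^sub>R k)) \<in> K" using AB[OF yV] k K(1) by (simp add: subspace_scale)
        then show ?thesis using kernel XiO(1)[OF t] by blast
      qed
      ultimately show ?thesis by simp
    qed
    then obtain a where a: "\<And>t. t \<in> {0..1} \<Longrightarrow> F (\<Xi> (s t)) = a"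
      using has_derivative_zero_constant[of "{0..1::real}" "\<lambda>t. F (\<Xi> (s t))"] by auto
    have "\<Xi> (s 1) = z" "\<Xi> (s 0) = q"
      using hom z qO by (auto simp: s_def k_def homeomorphism_def)
    then show "F z = F q" using a[of 0] a[of 1] by simp
  qed
  show ?thesis
    by (rule that[OF oO qO MO K e(1) hom Psi_q C1Psi C1Xi Psi_diff fibre]) (use kernel derPsi in auto)
qed

section \<open>Leaves as submanifolds\<close>

lemma leaf_subset: "leaf f S y \<subseteq> {z \<in> S. f z = f y}"
  unfolding leaf_def by (rule connected_component_subset)

lemma mem_leaf_self: "y \<in> S \<Longrightarrow> y \<in> leaf f S y"
  unfolding leaf_def using connected_component_refl by fastforce

lemma connected_subset_leaf:
  assumes "connected C" "y \<in> C" "\<And>z. z \<in> C \<Longrightarrow> z \<in> S \<and> f z = f y"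
  shows "C \<subseteq> leaf f S y"
  unfolding leaf_def by (rule connected_component_maximal[OF assms(2,1)]) (use assms(3) in blast)

text \<open>
  Adapted charts of leaves arise by composing an adapted chart of the submanifold with a local
  diffeomorphism of the ambient Euclidean space that respects the model subspace.
\<close>

lemma compose_chart_in_maximal_atlas:
  fixes N :: "('a::t2_space, 'e::euclidean_space) manifold"
  assumes N: "C1_manifold N" and a: "a \<in> maximal_atlas N"
    and G: "open G" "model N \<inter> G \<subseteq> cmap a ` cdom a" and H: "open H"
    and hom: "homeomorphism G H \<Psi> \<Xi>"
    and model: "\<And>z. z \<in> G \<Longrightarrow> \<Psi> z \<in> model N \<longleftrightarrow> z \<in> model N"
    and C1: "C1_on (model N) (model N \<inter> G) \<Psi>" "C1_on (model N) (model N \<inter> H) \<Xi>"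
    and c: "cdom c = {x \<in> cdom a. cmap a x \<in> G}" "cmap c = \<Psi> \<circ> cmap a"
  shows "c \<in> maximal_atlas N" "cmap c ` cdom c = model N \<inter> H"
proof -
  let ?M = "model N"
  note M = C1_manifold_subspace[OF N]
  note ac = maximal_atlas_is_chart[OF a]
  have PX: "\<Psi> (\<Xi> s) = s" "\<Xi> s \<in> G" if "s \<in> H" for s
    using hom that by (auto simp: homeomorphism_def)
  have XP: "\<Xi> (\<Psi> z) = z" "\<Psi> z \<in> H" if "z \<in> G" for z
    using hom that by (auto simp: homeomorphism_def)
  have contPsi: "continuous_on G \<Psi>" and contXi: "continuous_on H \<Xi>"
    using hom by (auto simp: homeomorphism_def)
  have XM: "\<Xi> s \<in> ?M \<inter> G" if "s \<in> ?M \<inter> H" for s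
    using PX[of s] model[of "\<Xi> s"] that by auto
  have in_c: "cinv a (\<Xi> s) \<in> cdom c" "cmap c (cinv a (\<Xi> s)) = s" if s: "s \<in> ?M \<inter> H" for s
  proof -
    have z: "\<Xi> s \<in> cmap a ` cdom a" using XM[OF s] G(2) by auto
    show "cinv a (\<Xi> s) \<in> cdom c" using cinv_in[OF ac z] cmap_cinv[OF ac z] XM[OF s] by (simp add: c)
    show "cmap c (cinv a (\<Xi> s)) = s" using cmap_cinv[OF ac z] PX s by (simp add: c)
  qed
  have c_in: "cmap c x \<in> ?M \<inter> H" "cinv a (\<Xi> (cmap c x)) = x" if x: "x \<in> cdom c" for x
    using x XP model chart_in_model[OF ac] cinv_cmap[OF ac] by (auto simp: c)
  show image: "cmap c ` cdom c = ?M \<inter> H"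
  proof
    show "cmap c ` cdom c \<subseteq> ?M \<inter> H" using c_in(1) by blast
    show "?M \<inter> H \<subseteq> cmap c ` cdom c"
    proof
      fix s assume "s \<in> ?M \<inter> H"
      from in_c[OF this] show "s \<in> cmap c ` cdom c" by (metis imageI)
    qed
  qed
  have inj: "inj_on (cmap c) (cdom c)" using c_in(2) by (metis inj_onI)
  have cinv: "cinv c s = cinv a (\<Xi> s)" if "s \<in> ?M \<inter> H" for s
    unfolding cinv_def[of c] using inv_into_f_eq[OF inj in_c[OF that]] .
  have open_c: "open (cdom c)" using open_chart_preimage[OF ac G(1)] by (simp add: c)
  have cont_c: "continuous_on (cdom c) (cmap c)"
    unfolding c(2)
  proof (rule continuous_on_compose)
    show "continuous_on (cdom c) (cmap a)"
      by (rule continuous_on_subset[OF continuous_on_cmap[OF ac]]) (auto simp: c)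
    show "continuous_on (cmap a ` cdom c) \<Psi>"
      by (rule continuous_on_subset[OF contPsi]) (auto simp: c)
  qed
  have "continuous_on (?M \<inter> H) (\<lambda>s. cinv a (\<Xi> s))"
    by (rule continuous_on_compose2[OF continuous_on_cinv[OF ac] continuous_on_subset[OF contXi]])
      (use XM G(2) in auto)
  then have cont_cinv: "continuous_on (?M \<inter> H) (cinv c)"
    by (rule continuous_on_eq) (simp add: cinv)
  have "homeomorphism (cdom c) (?M \<inter> H) (cmap c) (cinv c)"
    by (rule homeomorphismI[OF cont_c cont_cinv]) (use c_in in_c cinv in auto)
  then have cc: "is_chart ?M c"
    using open_c H unfolding is_chart_def image by auto
  have "C1_compatible ?M c b" if b: "b \<in> atlas N" for b
  proof -
    have bm: "b \<in> maximal_atlas N" by (rule atlas_in_maximal_atlas[OF N b])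
    note bc = maximal_atlas_is_chart[OF bm]
    let ?A = "cdom c \<inter> cdom b"
    have oA: "open ?A" using open_c chart_open[OF bc] by blast
    have o1: "openin (top_of_set ?M) (cmap c ` ?A)" by (rule openin_cmap_image[OF cc oA]) auto
    have o2: "openin (top_of_set ?M) (cmap b ` ?A)" by (rule openin_cmap_image[OF bc oA]) auto
    have o3: "openin (top_of_set ?M) (cmap a ` ?A)" by (rule openin_cmap_image[OF ac oA]) (auto simp: c)
    have o4: "openin (top_of_set ?M) (?M \<inter> G)" using G(1) by blast
    have Xi: "C1_on ?M (cmap c ` ?A) \<Xi>" by (rule C1_on_subset[OF C1(2)]) (use c_in in auto)
    have ab: "C1_on ?M (cmap a ` ?A) (cmap b \<circ> cinv a)"
      by (rule C1_on_subset[OF maximal_atlas_compatible[OF N a bm]]) (auto simp: c)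
    have "C1_on ?M (cmap c ` ?A) ((cmap b \<circ> cinv a) \<circ> \<Xi>)"
      by (rule C1_on_compose(1)[OF M o1 Xi M o3 ab]) (use XP in \<open>auto simp: c\<close>)
    then have 1: "C1_on ?M (cmap c ` ?A) (cmap b \<circ> cinv c)"
      by (rule C1_on_cong) (use c_in cinv in auto)
    have ba: "C1_on ?M (cmap b ` ?A) (cmap a \<circ> cinv b)"
      by (rule C1_on_subset[OF maximal_atlas_compatible[OF N bm a]]) (auto simp: c)
    have "C1_on ?M (cmap b ` ?A) (\<Psi> \<circ> (cmap a \<circ> cinv b))"
      by (rule C1_on_compose(1)[OF M o2 ba M o4 C1(1)])
        (use cinv_cmap[OF bc] chart_in_model[OF ac] in \<open>auto simp: c\<close>)
    then have 2: "C1_on ?M (cmap b ` ?A) (cmap c \<circ> cinv b)"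
      by (rule C1_on_cong) (simp add: c)
    show ?thesis using 1 2 by (simp add: C1_compatible_def Int_commute)
  qed
  then show "c \<in> maximal_atlas N" using cc by (simp add: maximal_atlas_def)
qed

text \<open>
  In the straightened coordinates the fibre of \<open>f\<close> through \<open>y0\<close> is the intersection of \<open>K\<close> with a ball.
  It is therefore connected, so it belongs to a single leaf, and no other part of the leaf meets the
  domain of the chart.
\<close>

theorem leaf_adapted_chart:
  fixes N :: "('a::t2_space, 'e::euclidean_space) manifold"
    and P :: "('b::t2_space, 'g::euclidean_space) manifold"
  assumes N: "C1_manifold N" and P: "C1_manifold P" and f: "C1_map_on N P UNIV f"
    and Y: "C1_submanifold N Y" and rank: "constant_rank_on N P f Y" and y0: "y0 \<in> Y"
  obtains c K where "y0 \<in> cdom c" "adapted_chart N (leaf f Y y0) c K"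
    "\<And>y. y \<in> leaf f Y y0 \<Longrightarrow> y \<in> cdom c \<Longrightarrow>
       foliation_tangent N P f Y y = tangent_space N (leaf f Y y0) y"
proof -
  let ?M = "model N" and ?L = "leaf f Y y0"
  note M = C1_manifold_subspace[OF N]
  obtain a V where a: "y0 \<in> cdom a" "adapted_chart N Y a V" using Y y0 by (auto simp: C1_submanifold_def)
  have am: "a \<in> maximal_atlas N" and V: "subspace V" "V \<subseteq> ?M"
    using a by (auto simp: adapted_chart_def)
  note ac = maximal_atlas_is_chart[OF am]
  note inY = adapted_chart_mem[OF a(2)]
  define d where "d = chart_at P (f y0)"
  have dm: "d \<in> maximal_atlas P" and fd: "f y0 \<in> cdom d"
    unfolding d_def by (rule chart_at_maximal[OF P] chart_at(2)[OF P])+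
  note dc = maximal_atlas_is_chart[OF dm]
  define A where "A = {x \<in> UNIV \<inter> cdom a. f x \<in> cdom d}"
  have oA: "open A" unfolding A_def by (intro open_C1_map_domain[OF f] chart_open[OF ac] chart_open[OF dc])
  define S where "S = cmap a ` A"
  define F where "F = cmap d \<circ> f \<circ> cinv a"
  have S: "openin (top_of_set ?M) S" unfolding S_def
    by (rule openin_cmap_image[OF ac oA]) (auto simp: A_def)
  have F: "C1_on ?M S F" unfolding S_def A_def F_def by (rule C1_on_in_charts[OF N P f am dm])
  have yA: "y0 \<in> A" using a fd by (simp add: A_def)
  have derF: "der ?M F (cmap a x) (chart_deriv N a x v) = chart_deriv P d (f x) (mderiv N P f x v)"
    if "x \<in> A" "v \<in> ?M" for x v
    using mderiv_in_charts[OF N P f am dm] that by (simp add: A_def F_def)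
  define q where "q = cmap a y0"
  have q: "q \<in> S" "q \<in> V" using yA y0 inY a by (auto simp: q_def S_def)
  obtain r where r: "\<And>x. x \<in> Y \<Longrightarrow> dim (mderiv N P f x ` tangent_space N Y x) = r"
    using rank by (auto simp: constant_rank_on_def)
  have "dim (der ?M F z ` V) = r" if zS: "z \<in> S \<inter> V" for z
  proof -
    obtain x where x: "x \<in> A" "z = cmap a x" using zS by (auto simp: S_def)
    then have xa: "x \<in> cdom a" "f x \<in> cdom d" "x \<in> Y" using zS inY by (auto simp: A_def)
    let ?T = "mderiv N P f x ` tangent_space N Y x"
    have TM: "tangent_space N Y x \<subseteq> ?M" by (auto simp: tangent_space_def)
    have "der ?M F z ` V = chart_deriv P d (f x) ` ?T"
      unfolding chart_deriv_tangent_space[OF N a(2) xa(3,1), symmetric] image_image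
      using derF[OF x(1)] TM x(2) by (intro image_cong) auto
    moreover have "subspace ?T"
      by (rule linear_subspace_image[OF linear_mderiv[OF N P f UNIV_I] subspace_tangent_space[OF N Y xa(3)]])
    moreover have "?T \<subseteq> model P" using mderiv_in_model[OF N P f UNIV_I] TM by auto
    ultimately have "dim (der ?M F z ` V) = dim ?T"
      using inj_on_subset[OF chart_deriv_image(1)[OF P dm xa(2)]]
      by (simp add: dim_image_eq[OF linear_chart_deriv[OF P dm xa(2)]] span_eq_iff[THEN iffD2])
    then show ?thesis using r xa by simp
  qed
  from constant_rank_straightening[OF M V S F q this]
  obtain G \<Psi> \<Xi> K e where G: "open G" "q \<in> G" "?M \<inter> G \<subseteq> S" and K: "subspace K" "K \<subseteq> V" and e: "e > 0"
    and hom: "homeomorphism G (ball (\<Psi> q) e) \<Psi> \<Xi>" and PsiqK: "\<Psi> q \<in> K"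
    and C1: "C1_on ?M (?M \<inter> G) \<Psi>" "C1_on ?M (?M \<inter> ball (\<Psi> q) e) \<Xi>"
    and diff: "\<And>z. z \<in> G \<Longrightarrow> \<Psi> z - z \<in> V"
    and fibre: "\<And>z. z \<in> G \<inter> V \<Longrightarrow> F z = F q \<longleftrightarrow> \<Psi> z \<in> K"
    and kernel: "\<And>z u. z \<in> G \<inter> V \<Longrightarrow> u \<in> ?M \<Longrightarrow> der ?M \<Psi> z u \<in> K \<longleftrightarrow> u \<in> V \<and> der ?M F z u = 0"
    by metis
  let ?H = "ball (\<Psi> q) e"
  have same: "\<Psi> z \<in> Q \<longleftrightarrow> z \<in> Q" if "z \<in> G" "subspace Q" "V \<subseteq> Q" for z Q
    using diff[OF that(1)] that(2,3) subspace_diff[OF that(2), of "\<Psi> z" "\<Psi> z - z"]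
      subspace_add[OF that(2), of "\<Psi> z - z" z] by auto
  define c where "c = \<lparr>cdom = {x \<in> cdom a. cmap a x \<in> G}, cmap = \<Psi> \<circ> cmap a\<rparr>"
  have c: "cdom c = {x \<in> cdom a. cmap a x \<in> G}" "cmap c = \<Psi> \<circ> cmap a" by (simp_all add: c_def)
  have cA: "x \<in> A" if "x \<in> cdom c" for x
  proof -
    have "cmap a x \<in> S" using that G(3) chart_in_model[OF ac] by (auto simp: c)
    then obtain x' where "x' \<in> A" "cmap a x = cmap a x'" by (auto simp: S_def)
    then show ?thesis using that cinv_cmap[OF ac] by (metis (no_types, lifting) A_def IntD2 c(1) mem_Collect_eq)
  qed
  have MG: "?M \<inter> G \<subseteq> cmap a ` cdom a" using G(3) by (auto simp: S_def A_def)
  note new = compose_chart_in_maximal_atlas[OF N am G(1) MG open_ball hom same[OF _ M V(2)] C1 c]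
  have cm: "c \<in> maximal_atlas N" and image: "cmap c ` cdom c = ?M \<inter> ?H" using new by auto
  note cc = maximal_atlas_is_chart[OF cm]
  have y0c: "y0 \<in> cdom c" using a G(2) by (simp add: c q_def)
  have plaque: "x \<in> Y \<and> f x = f y0 \<longleftrightarrow> cmap c x \<in> K" if x: "x \<in> cdom c" for x
  proof -
    have xG: "cmap a x \<in> G" "x \<in> cdom a" using x by (auto simp: c)
    have xY: "x \<in> Y" if "cmap c x \<in> K"
      using that K(2) same[OF xG(1) V(1)] inY[OF xG(2)] by (auto simp: c)
    have "f x = f y0 \<longleftrightarrow> cmap c x \<in> K" if "x \<in> Y"
    proof -
      have "f x \<in> cdom d" using cA[OF x] by (simp add: A_def)
      then have "f x = f y0 \<longleftrightarrow> cmap d (f x) = cmap d (f y0)" using fd cinv_cmap[OF dc] by metis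
      then show ?thesis using fibre[of "cmap a x"] inY[OF xG(2)] that xG a(1) cinv_cmap[OF ac]
        by (simp add: F_def q_def c)
    qed
    with xY show ?thesis by blast
  qed
  define Q where "Q = {x \<in> cdom c. cmap c x \<in> K}"
  have "Q = cinv c ` (K \<inter> ?H)"
  proof
    show "Q \<subseteq> cinv c ` (K \<inter> ?H)"
    proof
      fix x assume x: "x \<in> Q"
      then have "cmap c x \<in> K \<inter> ?H" "cinv c (cmap c x) = x"
        using image cinv_cmap[OF cc] by (auto simp: Q_def)
      then show "x \<in> cinv c ` (K \<inter> ?H)" by (metis imageI)
    qed
    show "cinv c ` (K \<inter> ?H) \<subseteq> Q"
    proof
      fix x assume "x \<in> cinv c ` (K \<inter> ?H)"
      then obtain s where s: "s \<in> K" "s \<in> ?M \<inter> ?H" "x = cinv c s" using K(2) V(2) by auto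
      then show "x \<in> Q" using cinv_in[OF cc, of s] cmap_cinv[OF cc, of s] unfolding image by (simp add: Q_def)
    qed
  qed
  moreover have "connected (K \<inter> ?H)"
    by (intro convex_connected convex_Int subspace_imp_convex K convex_ball)
  moreover have "continuous_on (K \<inter> ?H) (cinv c)"
    by (rule continuous_on_subset[OF continuous_on_cinv[OF cc]]) (use image K V in auto)
  ultimately have "connected Q" by (simp add: connected_continuous_image)
  then have "Q \<subseteq> ?L"
    by (rule connected_subset_leaf)
      (use y0c PsiqK plaque in \<open>auto simp: Q_def c q_def\<close>)
  then have leaf: "x \<in> ?L \<longleftrightarrow> cmap c x \<in> K" if "x \<in> cdom c" for x
    using that plaque[OF that] leaf_subset[of f Y y0] by (auto simp: Q_def)
  have adapted: "adapted_chart N ?L c K"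
    using cm K V(2) leaf by (auto simp: adapted_chart_def)
  have "foliation_tangent N P f Y y = tangent_space N ?L y" if yL: "y \<in> ?L" and yc: "y \<in> cdom c" for y
  proof -
    have y: "y \<in> A" "y \<in> Y" "y \<in> cdom a" "f y \<in> cdom d" "cmap a y \<in> G"
      using cA[OF yc] yc yL leaf_subset[of f Y y0] by (auto simp: A_def c)
    have yG: "cmap a y \<in> G \<inter> V" using y inY by auto
    have oG: "openin (top_of_set ?M) (?M \<inter> G)" using G(1) by blast
    have yMG: "cmap a y \<in> ?M \<inter> G" using yG V by auto
    have equiv: "v \<in> foliation_tangent N P f Y y \<longleftrightarrow> chart_deriv N c y v \<in> K" if v: "v \<in> ?M" for v
    proof -
      let ?u = "chart_deriv N a y v"
      have u: "?u \<in> ?M" by (rule chart_deriv_in_model[OF N am y(3) v])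
      have "chart_deriv N c y v = der ?M (cmap c \<circ> cinv a) (cmap a y) ?u"
        by (rule chart_deriv_transition[OF N am cm y(3) yc v, symmetric])
      also have "\<dots> = der ?M \<Psi> (cmap a y) ?u"
      proof (rule der_eq[OF M _ _ u])
        show "cmap a y \<in> ?M" using yMG by simp
        show "(cmap c \<circ> cinv a has_derivative der ?M \<Psi> (cmap a y)) (at (cmap a y) within ?M)"
        proof (rule has_derivative_cong_openin[OF M oG yMG C1_on_has_derivative[OF C1(1) M oG yMG]])
          fix z assume "z \<in> ?M \<inter> G"
          then have "z \<in> cmap a ` cdom a" using MG by blast
          then show "\<Psi> z = (cmap c \<circ> cinv a) z" using cmap_cinv[OF ac] by (simp add: c)
        qed
      qed
      finally have "chart_deriv N c y v \<in> K \<longleftrightarrow> ?u \<in> V \<and> der ?M F (cmap a y) ?u = 0"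
        using kernel[OF yG u] by simp
      moreover have "der ?M F (cmap a y) ?u = 0 \<longleftrightarrow> mderiv N P f y v = 0"
      proof -
        have lin: "linear (chart_deriv P d (f y))" by (rule linear_chart_deriv[OF P dm y(4)])
        have "mderiv N P f y v \<in> model P" "0 \<in> model P"
          using mderiv_in_model[OF N P f UNIV_I v] C1_manifold_subspace[OF P] subspace_0 by auto
        then show ?thesis
          unfolding derF[OF y(1) v] using chart_deriv_image(1)[OF P dm y(4)] linear_0[OF lin]
          by (metis inj_onD)
      qed
      moreover have "?u \<in> V \<longleftrightarrow> v \<in> tangent_space N Y y"
        using tangent_space_in_chart[OF N a(2) y(2,3)] v by simp
      ultimately show ?thesis by (auto simp: foliation_tangent_def)
    qed
    have "foliation_tangent N P f Y y \<subseteq> ?M" by (rule subspace_foliation_tangent(2)[OF N P f Y y(2)])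
    with equiv show ?thesis unfolding tangent_space_in_chart[OF N adapted yL yc] by blast
  qed
  with y0c adapted show ?thesis by (rule that)
qed

section \<open>Convergence of subspaces\<close>

lemma grassmann_dist_proj_le:
  fixes V W :: "'e::euclidean_space set"
  assumes "subspace V" "subspace W"
  shows "norm (proj V v - proj W v) \<le> grassmann_dist V W * norm v"
  unfolding grassmann_dist_def
  by (rule onorm[of "\<lambda>v. proj V v - proj W v"]) (intro bounded_linear_sub bounded_linear_proj assms)

lemma grassmann_tendsto_proj:
  fixes V :: "'i \<Rightarrow> 'e::euclidean_space set"
  assumes V: "eventually (\<lambda>i. subspace (V i)) F" and W: "subspace W"
    and lim: "((\<lambda>i. grassmann_dist (V i) W) \<longlongrightarrow> 0) F"
  shows "((\<lambda>i. proj (V i) v) \<longlongrightarrow> proj W v) F"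
proof -
  have "((\<lambda>i. grassmann_dist (V i) W * norm v) \<longlongrightarrow> 0) F" using tendsto_mult_right[OF lim, of "norm v"] by simp
  then have "((\<lambda>i. proj (V i) v - proj W v) \<longlongrightarrow> 0) F"
    by (rule Lim_null_comparison[rotated]) (use V in \<open>eventually_elim, simp add: grassmann_dist_proj_le W\<close>)
  then show ?thesis by (simp add: LIM_zero_iff)
qed

lemma grassmann_limit_mem:
  fixes V :: "'i \<Rightarrow> 'e::euclidean_space set"
  assumes F: "F \<noteq> bot" and V: "eventually (\<lambda>i. subspace (V i)) F" and W: "subspace W"
    and lim: "((\<lambda>i. grassmann_dist (V i) W) \<longlongrightarrow> 0) F"
    and t: "eventually (\<lambda>i. t i \<in> V i) F" "(t \<longlongrightarrow> t0) F"
  shows "t0 \<in> W"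
proof -
  have "((\<lambda>i. norm (t0 - t i)) \<longlongrightarrow> 0) F"
    using tendsto_norm[OF tendsto_diff[OF tendsto_const[of t0] t(2)]] by simp
  then have "((\<lambda>i. proj (V i) t0 - t i) \<longlongrightarrow> 0) F"
  proof (rule Lim_null_comparison[rotated])
    show "\<forall>\<^sub>F i in F. norm (proj (V i) t0 - t i) \<le> norm (t0 - t i)"
      using V t(1)
    proof eventually_elim
      case (elim i)
      have "proj (V i) t0 - t i = proj (V i) (t0 - t i)"
        using elim by (simp add: linear_diff[OF linear_proj] proj_id)
      then show ?case using norm_proj_le[OF elim(1)] by simp
    qed
  qed
  then have "((\<lambda>i. (proj (V i) t0 - t i) + t i) \<longlongrightarrow> 0 + t0) F" by (rule tendsto_add[OF _ t(2)])
  then have "((\<lambda>i. proj (V i) t0) \<longlongrightarrow> t0) F" by simp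
  then have "t0 = proj W t0" using tendsto_unique[OF F _ grassmann_tendsto_proj[OF V W lim]] by blast
  then show ?thesis using proj_in[OF W, of t0] by simp
qed

text \<open>
  Orthogonal projections have norm at most 1, so a subsequence of them converges in the finite
  dimensional space of linear maps. The limit is idempotent and symmetric, hence it is the orthogonal
  projection onto its range.
\<close>

lemma grassmann_compact:
  fixes V :: "nat \<Rightarrow> 'e::euclidean_space set"
  assumes V: "\<And>i. subspace (V i)" and VM: "\<And>i. V i \<subseteq> M" and M: "subspace M"
  obtains r \<tau> where "strict_mono r" "subspace \<tau>" "\<tau> \<subseteq> M"
    "(\<lambda>i. grassmann_dist (V (r i)) \<tau>) \<longlonglongrightarrow> 0"
proof -
  define p where "p i = Blinfun (proj (V i))" for i
  have p[simp]: "blinfun_apply (p i) = proj (V i)" for i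
    unfolding p_def using bounded_linear_proj[OF V] by (simp add: bounded_linear_Blinfun_apply)
  have "norm (p i) \<le> 1" for i
    by (rule norm_blinfun_bound) (use norm_proj_le[OF V] in auto)
  then have "bounded (range p)" by (auto simp: bounded_iff)
  then obtain Q r where r: "strict_mono r" and Q: "(p \<circ> r) \<longlonglongrightarrow> Q"
    using bounded_imp_convergent_subsequence by blast
  have lim: "(\<lambda>i. proj (V (r i)) v) \<longlonglongrightarrow> Q v" for v
    using blinfun.tendsto[OF Q tendsto_const[of v]] by simp
  have idem: "Q (Q v) = Q v" for v
  proof -
    have "(\<lambda>i. (p \<circ> r) i (proj (V (r i)) v)) \<longlonglongrightarrow> Q (Q v)" by (rule blinfun.tendsto[OF Q lim])
    then have "(\<lambda>i. proj (V (r i)) v) \<longlonglongrightarrow> Q (Q v)" by (simp add: V proj_id)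
    then show ?thesis using lim LIMSEQ_unique by blast
  qed
  have sym: "Q v \<bullet> w = v \<bullet> Q w" for v w
  proof -
    have "(\<lambda>i. proj (V (r i)) v \<bullet> w) \<longlonglongrightarrow> Q v \<bullet> w" by (intro tendsto_intros lim)
    moreover have "proj (V (r i)) v \<bullet> w = v \<bullet> proj (V (r i)) w" for i
      using proj_inner[OF V[of "r i"] proj_in[OF V], of v w] proj_inner[OF V[of "r i"] proj_in[OF V], of w v]
      by (simp add: inner_commute)
    moreover have "(\<lambda>i. v \<bullet> proj (V (r i)) w) \<longlonglongrightarrow> v \<bullet> Q w" by (intro tendsto_intros lim)
    ultimately show ?thesis using LIMSEQ_unique by simp
  qed
  define \<tau> where "\<tau> = range Q"
  have sub: "subspace \<tau>"
    unfolding \<tau>_def by (intro linear_subspace_image bounded_linear.linear[OF blinfun.bounded_linear_right] subspace_UNIV)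
  have "Q v \<in> M" for v
    using closed_sequentially[OF closed_subspace[OF M] _ lim[of v]] proj_in[OF V] VM by blast
  then have "\<tau> \<subseteq> M" by (auto simp: \<tau>_def)
  have tau: "proj \<tau> v = Q v" for v
    by (rule proj_unique[OF sub]) (auto simp: \<tau>_def inner_diff_left sym[symmetric] idem)
  have "grassmann_dist (V (r i)) \<tau> = norm (p (r i) - Q)" for i
  proof -
    have "blinfun_apply (p (r i) - Q) = (\<lambda>v. proj (V (r i)) v - proj \<tau> v)"
      by (rule ext) (simp add: blinfun.diff_left tau)
    then show ?thesis by (simp add: grassmann_dist_def norm_blinfun.rep_eq)
  qed
  moreover have "(\<lambda>i. norm (p (r i) - Q)) \<longlonglongrightarrow> 0"
    using tendsto_norm[OF tendsto_diff[OF Q tendsto_const[of Q]]] by simp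
  ultimately have "(\<lambda>i. grassmann_dist (V (r i)) \<tau>) \<longlonglongrightarrow> 0" by simp
  with r sub \<open>\<tau> \<subseteq> M\<close> show ?thesis by (rule that)
qed


section \<open>Regularity implies transversality to retractions\<close>

text \<open>
  The coordinate expression of a map into \<open>L\<close> has values in \<open>K\<close>, and in the coordinates the
  tangent spaces of \<open>L\<close> are all equal to \<open>K\<close>.
\<close>

lemma mderiv_onto_tangent_space_iff:
  fixes N :: "('a::t2_space, 'e::euclidean_space) manifold"
  assumes N: "C1_manifold N" and c: "adapted_chart N L c K" and \<pi>: "C1_map_on N N W \<pi>"
    and x: "x \<in> W" "x \<in> cdom c" and y: "\<pi> x \<in> L" "\<pi> x \<in> cdom c" and T: "T \<subseteq> model N"
  shows "mderiv N N \<pi> x ` T = tangent_space N L (\<pi> x) \<longleftrightarrow>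
    der (model N) (cmap c \<circ> \<pi> \<circ> cinv c) (cmap c x) ` chart_deriv N c x ` T = K"
proof -
  let ?M = "model N" and ?D = "chart_deriv N c (\<pi> x)"
  have cm: "c \<in> maximal_atlas N" using c by (simp add: adapted_chart_def)
  have inj: "inj_on ?D ?M" by (rule chart_deriv_image(1)[OF N cm y(2)])
  have sub: "mderiv N N \<pi> x ` T \<subseteq> ?M" using mderiv_in_model[OF N N \<pi> x(1)] T by auto
  have sub': "tangent_space N L (\<pi> x) \<subseteq> ?M" by (auto simp: tangent_space_def)
  have "mderiv N N \<pi> x ` T = tangent_space N L (\<pi> x) \<longleftrightarrow>
      ?D ` mderiv N N \<pi> x ` T = ?D ` tangent_space N L (\<pi> x)"
    using inj_on_image_eq_iff[OF inj sub sub'] by simp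
  also have "?D ` tangent_space N L (\<pi> x) = K" by (rule chart_deriv_tangent_space[OF N c y])
  also have "?D ` mderiv N N \<pi> x ` T = der ?M (cmap c \<circ> \<pi> \<circ> cinv c) (cmap c x) ` chart_deriv N c x ` T"
    unfolding image_image using mderiv_in_charts[OF N N \<pi> cm cm x y(2)] T by (intro image_cong) auto
  finally show ?thesis .
qed

lemma subspace_chart_deriv_image:
  fixes N :: "('a::t2_space, 'e::euclidean_space) manifold"
  assumes N: "C1_manifold N" and c: "c \<in> maximal_atlas N" "x \<in> cdom c"
    and T: "subspace T" "T \<subseteq> model N"
  shows "subspace (chart_deriv N c x ` T)" "chart_deriv N c x ` T \<subseteq> model N"
  using linear_subspace_image[OF linear_chart_deriv[OF N c] T(1)] chart_deriv_in_model[OF N c] T(2) by auto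

lemma proper_subspace_normal:
  fixes A K :: "'e::euclidean_space set"
  assumes "subspace A" "subspace K" "A \<subset> K"
  obtains k where "k \<in> K" "norm k = 1" "\<And>a. a \<in> A \<Longrightarrow> k \<bullet> a = 0"
proof -
  obtain k0 where k0: "k0 \<in> K" "k0 \<notin> A" using assms(3) by auto
  define k where "k = k0 - proj A k0"
  have "k \<noteq> 0" using k0 proj_in[OF assms(1), of k0] by (auto simp: k_def)
  moreover have "proj A k0 \<in> K" using proj_in[OF assms(1)] assms(3) by blast
  then have "k \<in> K" using subspace_diff[OF assms(2) k0(1)] by (simp add: k_def)
  moreover have "k \<bullet> a = 0" if "a \<in> A" for a using proj_orthogonal[OF assms(1) that] by (simp add: k_def)
  ultimately show ?thesis
    by (intro that[of "(1 / norm k) *\<^sub>R k"]) (use assms(2) in \<open>auto simp: subspace_scale\<close>)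
qed

text \<open>
  In the coordinates of the chart \<open>c\<close> a retraction \<open>\<pi>\<close> becomes a map \<open>h\<close> into \<open>K\<close> whose derivative at
  the base point is the identity on \<open>K\<close>. If submersivity fails at points converging to \<open>y0\<close>, there are
  unit vectors of \<open>K\<close> normal to the images of the leaf tangent spaces. A limit \<open>k0\<close> of them is normal to
  the image of the limit \<open>\<tau>\<close> of these tangent spaces; but \<open>\<tau>\<close> contains the tangent space of the leaf of
  \<open>Y\<close>, so \<open>k0\<close> itself is in this image.
\<close>

theorem af_imp_afs_regular:
  fixes N :: "('a::t2_space, 'e::euclidean_space) manifold"
    and P :: "('b::t2_space, 'g::euclidean_space) manifold"
  assumes N: "C1_manifold N" and P: "C1_manifold P" and f: "C1_map_on N P UNIV f"
    and X: "C1_submanifold N X" and y0: "y0 \<in> Y"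
    and c: "y0 \<in> cdom c" "adapted_chart N (leaf f Y y0) c K"
    and tan: "\<And>y. y \<in> leaf f Y y0 \<Longrightarrow> y \<in> cdom c \<Longrightarrow>
      foliation_tangent N P f Y y = tangent_space N (leaf f Y y0) y"
    and af: "af_regular N P f X Y y0"
  shows "afs_regular N P f X Y y0"
  unfolding afs_regular_def
proof (intro allI impI, rule ccontr)
  fix W \<pi>
  let ?M = "model N" and ?L = "leaf f Y y0" and ?T = "foliation_tangent N P f X"
  define b where "b = chart_at N y0"
  assume "local_retraction N y0 ?L W \<pi>"
  then have W: "open W" "y0 \<in> W" and \<pi>: "C1_map_on N N W \<pi>" and \<pi>L: "\<And>x. x \<in> W \<Longrightarrow> \<pi> x \<in> ?L"
    and \<pi>_id: "\<And>x. x \<in> W \<Longrightarrow> x \<in> ?L \<Longrightarrow> \<pi> x = x"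
    by (auto simp: local_retraction_def)
  assume no_nbhd: "\<not> (\<exists>U. open U \<and> y0 \<in> U \<and> U \<subseteq> W \<and>
    (\<forall>x\<in>X \<inter> U. mderiv N N \<pi> x ` ?T x = foliation_tangent N P f Y (\<pi> x)))"
  have bm: "b \<in> maximal_atlas N" and yb: "y0 \<in> cdom b"
    unfolding b_def by (rule chart_at_maximal[OF N] chart_at(2)[OF N])+
  have cm: "c \<in> maximal_atlas N" and K: "subspace K" "K \<subseteq> ?M"
    using c by (auto simp: adapted_chart_def)
  note bc = maximal_atlas_is_chart[OF bm] and cc = maximal_atlas_is_chart[OF cm]
  note M = C1_manifold_subspace[OF N] and inL = adapted_chart_mem[OF c(2)]
  have yL: "y0 \<in> ?L" by (rule mem_leaf_self[OF y0])
  have TM: "subspace (?T x)" "?T x \<subseteq> ?M" if "x \<in> X" for x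
    using subspace_foliation_tangent[OF N P f X that] by auto

  define W0 where "W0 = {x \<in> W \<inter> (cdom c \<inter> cdom b). \<pi> x \<in> cdom c}"
  have oW0: "open W0" unfolding W0_def
    by (intro open_C1_map_domain[OF \<pi>] open_Int chart_open[OF cc] chart_open[OF bc])
  have yW0: "y0 \<in> W0" using W c yb \<pi>_id yL by (simp add: W0_def)
  define h where "h = cmap c \<circ> \<pi> \<circ> cinv c"
  define S where "S = cmap c ` W0"
  have oS: "openin (top_of_set ?M) S" unfolding S_def
    by (rule openin_cmap_image[OF cc oW0]) (auto simp: W0_def)
  have C1h: "C1_on ?M S h"
    unfolding h_def S_def by (rule C1_on_subset[OF C1_on_in_charts[OF N N \<pi> cm cm]]) (auto simp: W0_def)
  note dh = C1_on_has_derivative[OF C1h M oS]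
  have hK: "h z \<in> K" if zS: "z \<in> S" for z
  proof -
    obtain x where x: "x \<in> W0" "z = cmap c x" using zS by (auto simp: S_def)
    then have "\<pi> x \<in> cdom c \<inter> ?L" "x \<in> cdom c" using \<pi>L by (auto simp: W0_def)
    then show ?thesis using inL[of "\<pi> x"] x cinv_cmap[OF cc] by (simp add: h_def)
  qed
  define p where "p = cmap c y0"
  have pS: "p \<in> S" using yW0 by (simp add: S_def p_def)
  have pK: "p \<in> K" using inL[OF c(1)] yL by (simp add: p_def)
  have h_id: "der ?M h p k = k" if k: "k \<in> K" for k
  proof (rule has_derivative_unique_subspace[OF K(1) pK k])
    show "(h has_derivative der ?M h p) (at p within K)"
      by (rule has_derivative_subset[OF dh[OF pS] K(2)])
    have oK: "openin (top_of_set K) (S \<inter> K)" using oS K(2) by (auto simp: openin_open)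
    show "(h has_derivative (\<lambda>k. k)) (at p within K)"
    proof (rule has_derivative_cong_openin[OF K(1) oK _ has_derivative_ident])
      show "p \<in> S \<inter> K" using pS pK by simp
      fix z assume z: "z \<in> S \<inter> K"
      then obtain x where x: "x \<in> W0" "z = cmap c x" by (auto simp: S_def)
      then have xc: "x \<in> cdom c" "x \<in> W" by (auto simp: W0_def)
      then show "z = h z" using x z inL \<pi>_id cinv_cmap[OF cc] by (simp add: h_def)
    qed
  qed
  define Q where "Q x = chart_deriv N c x ` ?T x" for x
  have onto: "mderiv N N \<pi> x ` ?T x = foliation_tangent N P f Y (\<pi> x) \<longleftrightarrow> der ?M h (cmap c x) ` Q x = K"
    if x: "x \<in> W0" "x \<in> X" for x
  proof -
    have x': "x \<in> W" "x \<in> cdom c" "\<pi> x \<in> ?L" "\<pi> x \<in> cdom c" using x \<pi>L by (auto simp: W0_def)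
    show ?thesis
      using mderiv_onto_tangent_space_iff[OF N c(2) \<pi> x' TM(2)[OF x(2)]] tan[OF x'(3,4)]
      by (simp add: h_def Q_def)
  qed

  have "\<exists>x. x \<in> X \<inter> W0 \<and> cmap c x \<in> ball p (1 / Suc n) \<and> der ?M h (cmap c x) ` Q x \<noteq> K" for n
  proof (rule ccontr)
    assume none: "\<not> ?thesis"
    let ?U = "W0 \<inter> {x \<in> cdom c. cmap c x \<in> ball p (1 / Suc n)}"
    have "open ?U" by (intro open_Int oW0 open_chart_preimage[OF cc] open_ball)
    moreover have "y0 \<in> ?U" using yW0 c(1) by (simp add: p_def)
    moreover have "?U \<subseteq> W" by (auto simp: W0_def)
    moreover have "\<forall>x\<in>X \<inter> ?U. mderiv N N \<pi> x ` ?T x = foliation_tangent N P f Y (\<pi> x)"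
      using none onto by blast
    ultimately show False using no_nbhd by blast
  qed
  then obtain x where x: "\<And>n. x n \<in> X" "\<And>n. x n \<in> W0" and near: "\<And>n. cmap c (x n) \<in> ball p (1 / Suc n)"
    and bad: "\<And>n. der ?M h (cmap c (x n)) ` Q (x n) \<noteq> K"
    by (metis IntD1 IntD2)
  have xcb: "x n \<in> cdom c" "x n \<in> cdom b" for n using x(2)[of n] by (auto simp: W0_def)
  have "(\<lambda>n. cmap c (x n)) \<longlonglongrightarrow> p"
  proof (rule metric_tendsto_imp_tendsto[OF LIMSEQ_Suc[OF lim_inverse_n]])
    show "\<forall>\<^sub>F n in sequentially. dist (cmap c (x n)) p \<le> dist (inverse (real (Suc n))) 0"
      using near by (auto simp: dist_commute less_imp_le divide_inverse intro!: always_eventually)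
  qed
  then have x_lim: "x \<longlonglongrightarrow> y0" using chart_tendsto[OF cc c(1) xcb(1)] by (simp add: p_def)

  have "\<exists>k\<in>K. norm k = 1 \<and> (\<forall>u\<in>Q (x n). k \<bullet> der ?M h (cmap c (x n)) u = 0)" for n
  proof -
    have zS: "cmap c (x n) \<in> S" using x by (simp add: S_def)
    have Qn: "subspace (Q (x n))" "Q (x n) \<subseteq> ?M"
      unfolding Q_def by (rule subspace_chart_deriv_image[OF N cm xcb(1) TM(1)[OF x(1)] TM(2)[OF x(1)]])+
    have "der ?M h (cmap c (x n)) u \<in> K" if "u \<in> Q (x n)" for u
      by (rule has_derivative_in_subspace[OF M K(1) oS zS dh[OF zS] hK]) (use that Qn in auto)
    then have "der ?M h (cmap c (x n)) ` Q (x n) \<subset> K" using bad by blast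
    from proper_subspace_normal[OF linear_subspace_image[OF has_derivative_linear[OF dh[OF zS]] Qn(1)] K(1) this]
    show ?thesis by (metis imageI)
  qed
  then obtain k where kK: "\<And>n. k n \<in> K" and k1: "\<And>n. norm (k n) = 1"
    and k_perp: "\<And>n u. u \<in> Q (x n) \<Longrightarrow> k n \<bullet> der ?M h (cmap c (x n)) u = 0" by metis
  define V where "V n = chart_deriv N b (x n) ` ?T (x n)" for n
  have V: "subspace (V n)" "V n \<subseteq> ?M" for n
    unfolding V_def by (rule subspace_chart_deriv_image[OF N bm xcb(2) TM(1)[OF x(1)] TM(2)[OF x(1)]])+
  obtain r1 \<tau> where r1: "strict_mono r1" and \<tau>: "subspace \<tau>" "\<tau> \<subseteq> ?M"
    and lim1: "(\<lambda>i. grassmann_dist (V (r1 i)) \<tau>) \<longlonglongrightarrow> 0"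
    by (rule grassmann_compact[OF V M])
  have "bounded (range (k \<circ> r1))" using k1 by (auto simp: bounded_iff intro!: exI[of _ 1])
  then obtain k0 r2 where r2: "strict_mono r2" and lim2: "(k \<circ> r1 \<circ> r2) \<longlonglongrightarrow> k0"
    using bounded_imp_convergent_subsequence by blast
  define r where "r = r1 \<circ> r2"
  have r: "strict_mono r" unfolding r_def by (rule strict_mono_o[OF r1 r2])
  have limV: "(\<lambda>i. grassmann_dist (V (r i)) \<tau>) \<longlonglongrightarrow> 0"
    using LIMSEQ_subseq_LIMSEQ[OF lim1 r2] by (simp add: r_def o_def)
  have limk: "(\<lambda>i. k (r i)) \<longlonglongrightarrow> k0" using lim2 by (simp add: r_def o_def)
  have limx: "(\<lambda>i. x (r i)) \<longlonglongrightarrow> y0" using LIMSEQ_subseq_LIMSEQ[OF x_lim r] by (simp add: o_def)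
  have "k0 \<in> K" by (rule closed_sequentially[OF closed_subspace[OF K(1)] kK limk])
  moreover have "norm k0 = 1" using LIMSEQ_unique[OF tendsto_norm[OF limk]] by (simp add: k1)
  ultimately have k0: "k0 \<in> K" "norm k0 = 1" by auto
  have "grassmann_bundle_tendsto N (\<lambda>i. x (r i)) (\<lambda>i. ?T (x (r i))) y0 \<tau>"
    using \<tau> limx limV by (simp add: grassmann_bundle_tendsto_def V_def b_def)
  then have E: "foliation_tangent N P f Y y0 \<subseteq> \<tau>"
    using af limx x(1) unfolding af_regular_def by (meson)

  \<comment> \<open>A limit of the unit normals is orthogonal to itself.\<close>
  let ?\<theta> = "der ?M (cmap c \<circ> cinv b)"
  have "k0 \<in> chart_deriv N c y0 ` foliation_tangent N P f Y y0"
    using chart_deriv_tangent_space[OF N c(2) yL c(1)] tan[OF yL c(1)] k0(1) by simp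
  then obtain t where t: "t \<in> foliation_tangent N P f Y y0" "k0 = chart_deriv N c y0 t" by auto
  have t\<tau>: "t \<in> \<tau>" "t \<in> ?M" using t(1) E \<tau> by auto
  have k0_eq: "k0 = ?\<theta> (cmap b y0) t" unfolding t(2) b_def chart_deriv_eq[OF N cm] ..
  define t' where "t' i = proj (V (r i)) t" for i
  have t': "t' i \<in> V (r i)" for i unfolding t'_def by (rule proj_in[OF V(1)])
  have t'_lim: "t' \<longlonglongrightarrow> t"
    using grassmann_tendsto_proj[OF always_eventually \<tau>(1) limV, of t] V proj_id[OF \<tau>(1) t\<tau>(1)]
    by (simp add: t'_def[abs_def])
  define u where "u i = ?\<theta> (cmap b (x (r i))) (t' i)" for i
  have u: "u i \<in> Q (x (r i))" for i
  proof -
    obtain v where v: "v \<in> ?T (x (r i))" "t' i = chart_deriv N b (x (r i)) v" using t'[of i] by (auto simp: V_def)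
    have "u i = chart_deriv N c (x (r i)) v"
      unfolding u_def v(2) by (rule chart_deriv_transition[OF N bm cm xcb(2,1)]) (use v(1) TM(2) x(1) in blast)
    then show ?thesis using v(1) by (simp add: Q_def)
  qed
  let ?A = "cmap b ` (cdom b \<inter> cdom c)"
  have oA: "openin (top_of_set ?M) ?A" by (rule openin_chart_overlap[OF bm cm])
  note C1\<theta> = maximal_atlas_compatible[OF N bm cm]
  have "u \<longlonglongrightarrow> ?\<theta> (cmap b y0) t"
    unfolding u_def[abs_def]
  proof (rule tendsto_linear_apply[OF M _ _ _ t'_lim _ t\<tau>(2)])
    show "\<forall>\<^sub>F i in sequentially. linear (?\<theta> (cmap b (x (r i))))"
      using has_derivative_linear[OF C1_on_has_derivative[OF C1\<theta> M oA]] xcb by (auto intro!: always_eventually)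
    show "linear (?\<theta> (cmap b y0))"
      using has_derivative_linear[OF C1_on_has_derivative[OF C1\<theta> M oA]] yb c(1) by auto
    show "\<forall>\<^sub>F i in sequentially. t' i \<in> ?M" using t' V(2) by (auto intro!: always_eventually)
    show "(\<lambda>i. ?\<theta> (cmap b (x (r i))) v) \<longlonglongrightarrow> ?\<theta> (cmap b y0) v" if v: "v \<in> ?M" for v
    proof (rule continuous_on_tendsto_compose[of ?A "\<lambda>z. ?\<theta> z v"])
      show "continuous_on ?A (\<lambda>z. ?\<theta> z v)" using C1\<theta> v C1_on_iff[OF M oA] by blast
      show "(\<lambda>i. cmap b (x (r i))) \<longlonglongrightarrow> cmap b y0" by (rule cmap_tendsto(1)[OF bc limx yb])
    qed (use xcb yb c(1) in auto)
  qed
  then have u_lim: "u \<longlonglongrightarrow> k0" by (simp add: k0_eq)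
  have "(\<lambda>i. der ?M h (cmap c (x (r i))) (u i)) \<longlonglongrightarrow> der ?M h p k0"
  proof (rule tendsto_linear_apply[OF M _ _ _ u_lim])
    have zS: "cmap c (x n) \<in> S" for n using x by (simp add: S_def)
    show "\<forall>\<^sub>F i in sequentially. linear (der ?M h (cmap c (x (r i))))"
      using has_derivative_linear[OF dh[OF zS]] by (auto intro!: always_eventually)
    show "linear (der ?M h p)" by (rule has_derivative_linear[OF dh[OF pS]])
    show "\<forall>\<^sub>F i in sequentially. u i \<in> ?M"
      using u subspace_chart_deriv_image(2)[OF N cm xcb(1) TM(1)[OF x(1)] TM(2)[OF x(1)]]
      unfolding Q_def by (intro always_eventually allI) blast
    show "k0 \<in> ?M" using k0(1) K(2) by auto
    show "(\<lambda>i. der ?M h (cmap c (x (r i))) v) \<longlonglongrightarrow> der ?M h p v" if v: "v \<in> ?M" for v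
    proof (rule continuous_on_tendsto_compose[of S "\<lambda>z. der ?M h z v"])
      show "continuous_on S (\<lambda>z. der ?M h z v)" using C1h v C1_on_iff[OF M oS] by blast
      show "(\<lambda>i. cmap c (x (r i))) \<longlonglongrightarrow> p" unfolding p_def by (rule cmap_tendsto(1)[OF cc limx c(1)])
    qed (use pS zS in auto)
  qed
  then have "(\<lambda>i. k (r i) \<bullet> der ?M h (cmap c (x (r i))) (u i)) \<longlonglongrightarrow> k0 \<bullet> k0"
    using tendsto_inner[OF limk] h_id[OF k0(1)] by simp
  moreover have "k (r i) \<bullet> der ?M h (cmap c (x (r i))) (u i) = 0" for i by (rule k_perp[OF u])
  ultimately have "(\<lambda>i. 0) \<longlonglongrightarrow> k0 \<bullet> k0" by simp
  then have "k0 \<bullet> k0 = 0" using LIMSEQ_unique tendsto_const by blast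
  then show False using k0(2) by simp
qed

section \<open>A perturbation with prescribed derivatives\<close>

lemma has_derivative_square_max0:
  "((\<lambda>t::real. (max 0 t)^2) has_derivative (\<lambda>h. 2 * max 0 x * h)) (at x)"
proof (rule has_derivativeI_sandwich[of 1 _ _ _ _ "\<lambda>y. norm (y - x)"])
  show "bounded_linear (\<lambda>h. 2 * max 0 x * h)" by (rule bounded_linear_mult_right)
  show "((\<lambda>y. norm (y - x)) \<longlongrightarrow> 0) (at x)"
    using tendsto_norm[OF tendsto_diff[OF tendsto_ident_at[of x UNIV] tendsto_const[of x]]] by simp
  fix y :: real assume "y \<noteq> x"
  have "\<bar>(max 0 y)^2 - (max 0 x)^2 - 2 * max 0 x * (y - x)\<bar> \<le> (y - x)^2"
  proof (cases "0 \<le> x"; cases "0 \<le> y")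
    assume "0 \<le> x" "0 \<le> y"
    then have "(max 0 y)^2 - (max 0 x)^2 - 2 * max 0 x * (y - x) = (y - x)^2"
      by (simp add: power2_eq_square algebra_simps)
    then show ?thesis by simp
  next
    assume "0 \<le> x" "\<not> 0 \<le> y"
    then have "x * y \<le> 0" by (simp add: mult_nonneg_nonpos)
    then have nonneg: "0 \<le> x * x - 2 * (x * y)" using zero_le_square[of x] by linarith
    have "(max 0 y)^2 - (max 0 x)^2 - 2 * max 0 x * (y - x) = x * x - 2 * (x * y)"
      using \<open>0 \<le> x\<close> \<open>\<not> 0 \<le> y\<close> by (simp add: power2_eq_square algebra_simps)
    moreover have "(y - x)^2 = x * x - 2 * (x * y) + y * y" by (simp add: power2_eq_square algebra_simps)
    ultimately show ?thesis using nonneg by (simp only: abs_of_nonneg) simp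
  next
    assume "\<not> 0 \<le> x" "0 \<le> y"
    then have "x * y \<le> 0" by (simp add: mult_nonpos_nonneg)
    moreover have "(y - x) * (y - x) = y * y - 2 * (x * y) + x * x" by (simp add: algebra_simps)
    ultimately have "y * y \<le> (y - x) * (y - x)" using zero_le_square[of x] by linarith
    then show ?thesis using \<open>\<not> 0 \<le> x\<close> \<open>0 \<le> y\<close> by (simp add: power2_eq_square)
  qed (simp add: power2_eq_square)
  moreover have "0 < \<bar>y - x\<bar>" using \<open>y \<noteq> x\<close> by simp
  ultimately show "norm ((max 0 y)^2 - (max 0 x)^2 - 2 * max 0 x * (y - x)) / norm (y - x) \<le> norm (y - x)"
    by (simp add: divide_le_eq power2_eq_square abs_mult[symmetric])
qed simp

text \<open>
  The function \<open>(max 0 (1 - |x - p|\<^sup>2 / \<rho>\<^sup>2))\<^sup>2\<close> times \<open>B (w x - w p)\<close>, where \<open>w x = x - proj K x\<close>. Where it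
  is not zero, \<open>|w x - w p| < \<rho>\<close>, while the derivative of the first factor is at most \<open>4 / \<rho>\<close>, so that the
  bound for the derivative of the product does not depend on \<open>\<rho>\<close>. On \<open>K\<close>, where \<open>w\<close> vanishes, the
  function is zero: if \<open>w p = 0\<close> because of the second factor, and otherwise because the points
  of \<open>K\<close> have distance at least \<open>\<rho>\<close> from \<open>p\<close>.
\<close>

lemma C1_bump:
  fixes K :: "'e::euclidean_space set" and B :: "'e \<Rightarrow>\<^sub>L 'e"
  assumes K: "subspace K" and \<rho>: "\<rho> > 0" "p - proj K p \<noteq> 0 \<Longrightarrow> \<rho> \<le> norm (p - proj K p)"
  shows "\<exists>u u'. (\<forall>x. (u has_derivative blinfun_apply (u' x)) (at x)) \<and> continuous_on UNIV u' \<and>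
    (\<forall>x. norm (u' x) \<le> 5 * norm B) \<and> (\<forall>x. \<rho> \<le> dist x p \<longrightarrow> u x = 0 \<and> u' x = 0) \<and>
    (\<forall>v. u' p v = B (v - proj K v)) \<and> (\<forall>x\<in>K. u x = 0)"
proof -
  let ?w = "\<lambda>x. x - proj K x"
  have blw: "bounded_linear ?w" by (intro bounded_linear_sub bounded_linear_ident bounded_linear_proj K)
  have wle: "norm (?w x) \<le> norm x" for x by (rule norm_diff_proj_le[OF K])
  have wdiff: "?w x - ?w y = ?w (x - y)" for x y by (simp add: linear_diff[OF linear_proj[OF K]])
  define m where "m x = max 0 (1 - ((x - p) \<bullet> (x - p)) / \<rho>^2)" for x
  define \<phi>' where "\<phi>' x v = 2 * m x * (- (2 * ((x - p) \<bullet> v) / \<rho>^2))" for x v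
  define u where "u x = (m x)^2 *\<^sub>R B (?w x - ?w p)" for x
  define D where "D x v = (m x)^2 *\<^sub>R B (?w v) + \<phi>' x v *\<^sub>R B (?w x - ?w p)" for x v
  have "((\<lambda>x. 1 - ((x - p) \<bullet> (x - p)) / \<rho>^2) has_derivative (\<lambda>v. - (2 * ((x - p) \<bullet> v) / \<rho>^2))) (at x)" for x
  proof -
    have "((\<lambda>x. (x - p) \<bullet> (x - p)) has_derivative (\<lambda>v. 2 * ((x - p) \<bullet> v))) (at x)"
      by (auto intro!: derivative_eq_intros simp: inner_commute)
    from has_derivative_diff[OF has_derivative_const[of 1]
        bounded_linear.has_derivative[OF bounded_linear_divide[of "\<rho>^2"] this]]
    show ?thesis by simp
  qed
  from has_derivative_compose[OF this has_derivative_square_max0]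
  have d\<phi>: "((\<lambda>x. (m x)^2) has_derivative \<phi>' x) (at x)" for x
    unfolding m_def \<phi>'_def[abs_def] .
  have du: "(u has_derivative D x) (at x)" for x
  proof -
    have "((\<lambda>x. B (?w x - ?w p)) has_derivative (\<lambda>v. B (?w v))) (at x)"
      using bounded_linear.has_derivative[OF blinfun.bounded_linear_right
          has_derivative_diff[OF bounded_linear_imp_has_derivative[OF blw] has_derivative_const[of "?w p"]]]
      by simp
    from has_derivative_scaleR[OF d\<phi> this] show ?thesis unfolding u_def[abs_def] D_def[abs_def] .
  qed
  have m01: "0 \<le> m x" "m x \<le> 1" for x by (auto simp: m_def)
  have far: "m x = 0" if "\<rho> \<le> dist x p" for x
  proof -
    have "\<rho>^2 \<le> (norm (x - p))^2" using that \<rho>(1) by (intro power_mono) (auto simp: dist_norm)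
    then show ?thesis using \<rho>(1) by (simp add: m_def power2_norm_eq_inner)
  qed
  have Dle: "norm (D x v) \<le> 5 * norm B * norm v" for x v
  proof (cases "\<rho> \<le> dist x p")
    case True
    then show ?thesis using far by (simp add: D_def \<phi>'_def)
  next
    case False
    then have near: "norm (x - p) \<le> \<rho>" by (simp add: dist_norm)
    have "norm ((m x)^2 *\<^sub>R B (?w v)) \<le> 1 * (norm B * norm v)"
      using m01[of x] norm_blinfun[of B "?w v"] wle[of v] mult_left_mono[OF wle[of v], of "norm B"]
      unfolding norm_scaleR by (intro mult_mono) (auto simp: power_le_one)
    moreover have "norm (\<phi>' x v *\<^sub>R B (?w x - ?w p)) \<le> 4 * (norm B * norm v)"
    proof -
      have "\<bar>(x - p) \<bullet> v\<bar> \<le> \<rho> * norm v"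
        using Cauchy_Schwarz_ineq2[of "x - p" v] mult_right_mono[OF near, of "norm v"] by simp
      then have "2 * \<bar>(x - p) \<bullet> v\<bar> / \<rho>^2 \<le> 2 * (\<rho> * norm v) / \<rho>^2" by (intro divide_right_mono) auto
      also have "\<dots> = 2 * norm v / \<rho>" using \<rho>(1) by (simp add: power2_eq_square)
      finally have "\<bar>2 * ((x - p) \<bullet> v) / \<rho>^2\<bar> \<le> 2 * norm v / \<rho>" by (simp add: abs_mult)
      then have "\<bar>\<phi>' x v\<bar> \<le> (2 * 1) * (2 * norm v / \<rho>)"
        unfolding \<phi>'_def abs_mult abs_minus_cancel using m01[of x] by (intro mult_mono) auto
      moreover have "norm (B (?w x - ?w p)) \<le> norm B * \<rho>"
        unfolding wdiff using norm_blinfun[of B "?w (x - p)"] wle[of "x - p"] near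
        by (meson mult_left_mono norm_ge_zero order_trans)
      ultimately have "\<bar>\<phi>' x v\<bar> * norm (B (?w x - ?w p)) \<le> (2 * 1) * (2 * norm v / \<rho>) * (norm B * \<rho>)"
        using \<rho>(1) by (intro mult_mono) auto
      also have "\<dots> = 4 * (norm B * norm v)" using \<rho>(1) by simp
      finally show ?thesis by simp
    qed
    ultimately show ?thesis unfolding D_def by (intro order_trans[OF norm_triangle_ineq]) simp
  qed
  define u' where "u' x = Blinfun (D x)" for x
  have u'[simp]: "blinfun_apply (u' x) = D x" for x
    unfolding u'_def using has_derivative_bounded_linear[OF du] by (simp add: bounded_linear_Blinfun_apply)
  have "continuous_on UNIV u'"
  proof (rule continuous_on_blinfun_componentwise)
    fix b :: 'e
    have contm: "continuous_on UNIV m" unfolding m_def[abs_def] using \<rho>(1) by (intro continuous_intros) auto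
    have "continuous_on UNIV (\<lambda>x. D x b)"
      unfolding D_def \<phi>'_def using \<rho>(1)
      by (intro continuous_intros contm K) auto
    then show "continuous_on UNIV (\<lambda>x. u' x b)" by simp
  qed
  moreover have "norm (u' x) \<le> 5 * norm B" for x
    by (rule norm_blinfun_bound) (use Dle in auto)
  moreover have "u x = 0 \<and> u' x = 0" if "\<rho> \<le> dist x p" for x
    using far[OF that] by (auto simp: u_def D_def \<phi>'_def intro!: blinfun_eqI)
  moreover have "u' p v = B (?w v)" for v by (simp add: D_def m_def)
  moreover have "u x = 0" if x: "x \<in> K" for x
  proof (cases "?w p = 0")
    case True
    then show ?thesis using x by (simp add: u_def proj_id[OF K])
  next
    case False
    have "\<rho> \<le> norm (?w x - ?w p)" using \<rho>(2)[OF False] x by (simp add: proj_id[OF K] norm_minus_commute)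
    also have "\<dots> \<le> dist x p" unfolding wdiff dist_norm by (rule wle)
    finally show ?thesis using far by (simp add: u_def)
  qed
  ultimately show ?thesis using du by (intro exI[of _ u] exI[of _ u']) simp
qed

text \<open>
  The function \<open>A (x - proj K x)\<close> is corrected near each \<open>p n\<close> by a bump that changes its
  derivative there as required. The norms of the differences \<open>\<alpha> n - A\<close> are summable, so the sum of
  the bumps is continuously differentiable, also at the limit point \<open>q0\<close>. The strict decrease of the distances to \<open>q0\<close> makes room for bumps that vanish, with
  their derivatives, at all other points of the sequence.
\<close>

lemma C1_perturbation_along_sequence:
  fixes K :: "'e::euclidean_space set" and A :: "'e \<Rightarrow>\<^sub>L 'e"
  assumes K: "subspace K" and p: "p \<longlonglongrightarrow> q0" and dec: "\<And>n. dist (p (Suc n)) q0 < dist (p n) q0"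
    and \<alpha>: "\<And>n. norm (\<alpha> n - A) \<le> (1/2)^n"
  shows "\<exists>\<psi> \<psi>'. (\<forall>x. (\<psi> has_derivative blinfun_apply (\<psi>' x)) (at x)) \<and> continuous_on UNIV \<psi>' \<and>
    (\<forall>x\<in>K. \<psi> x = 0) \<and> (\<forall>n v. \<psi>' (p n) v = \<alpha> n (v - proj K v))"
proof -
  let ?w = "\<lambda>x. x - proj K x"
  have blw: "bounded_linear ?w" by (intro bounded_linear_sub bounded_linear_ident bounded_linear_proj K)
  define D where "D n = dist (p n) q0" for n
  have dec': "D m < D n" if "n < m" for n m
    using lift_Suc_mono_less[of "\<lambda>n. - D n" n m] dec that by (simp add: D_def)
  have decle: "D m \<le> D n" if "n \<le> m" for n m using dec'[of n m] that by (cases "n = m") auto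
  \<comment> \<open>The values 1 are placeholders: the first point has no predecessor, and a point of \<open>K\<close> has distance 0 from \<open>K\<close>.\<close>
  define \<rho> where "\<rho> n = min (D n - D (Suc n))
    (min (if n = 0 then 1 else D (n - 1) - D n) (if ?w (p n) = 0 then 1 else norm (?w (p n))))" for n
  have \<rho>pos: "\<rho> n > 0" for n using dec'[of n "Suc n"] dec'[of "n - 1" n] by (auto simp: \<rho>_def)
  have far: "\<rho> n \<le> dist (p m) (p n)" if "m \<noteq> n" for m n
  proof (cases "m < n")
    case True
    then have "\<rho> n \<le> D (n - 1) - D n" by (auto simp: \<rho>_def)
    also have "\<dots> \<le> D m - D n" using decle[of m "n - 1"] True by simp
    also have "\<dots> \<le> dist (p m) (p n)" using dist_triangle[of "p m" q0 "p n"] by (simp add: D_def)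
    finally show ?thesis .
  next
    case False
    then have "\<rho> n \<le> D n - D m" using decle[of "Suc n" m] that by (simp add: \<rho>_def)
    also have "\<dots> \<le> dist (p m) (p n)"
      using dist_triangle[of "p n" q0 "p m"] by (simp add: D_def dist_commute)
    finally show ?thesis .
  qed
  have far0: "\<rho> n \<le> dist q0 (p n)" for n
  proof -
    have "\<rho> n \<le> D n - D (Suc n)" by (simp add: \<rho>_def)
    also have "\<dots> \<le> D n" by (simp add: D_def)
    finally show ?thesis by (simp add: D_def dist_commute)
  qed
  have "\<rho> n \<le> norm (?w (p n))" if "?w (p n) \<noteq> 0" for n using that by (simp add: \<rho>_def)
  from C1_bump[OF K \<rho>pos this]
  have "\<forall>n. \<exists>u u'. (\<forall>x. (u has_derivative blinfun_apply (u' x)) (at x)) \<and> continuous_on UNIV u' \<and>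
    (\<forall>x. norm (u' x) \<le> 5 * norm (\<alpha> n - A)) \<and> (\<forall>x. \<rho> n \<le> dist x (p n) \<longrightarrow> u x = 0 \<and> u' x = 0) \<and>
    (\<forall>v. u' (p n) v = (\<alpha> n - A) (?w v)) \<and> (\<forall>x\<in>K. u x = 0)" by blast
  from choice[OF this] obtain u where "\<forall>n. \<exists>u'. (\<forall>x. (u n has_derivative blinfun_apply (u' x)) (at x)) \<and>
    continuous_on UNIV u' \<and> (\<forall>x. norm (u' x) \<le> 5 * norm (\<alpha> n - A)) \<and>
    (\<forall>x. \<rho> n \<le> dist x (p n) \<longrightarrow> u n x = 0 \<and> u' x = 0) \<and>
    (\<forall>v. u' (p n) v = (\<alpha> n - A) (?w v)) \<and> (\<forall>x\<in>K. u n x = 0)" by blast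
  from choice[OF this] obtain u'
    where du: "\<And>n x. (u n has_derivative blinfun_apply (u' n x)) (at x)"
      and cont: "\<And>n. continuous_on UNIV (u' n)"
      and le: "\<And>n x. norm (u' n x) \<le> 5 * norm (\<alpha> n - A)"
      and zero: "\<And>n x. \<rho> n \<le> dist x (p n) \<Longrightarrow> u n x = 0 \<and> u' n x = 0"
      and at_p: "\<And>n v. u' n (p n) v = (\<alpha> n - A) (?w v)"
      and onK: "\<And>n x. x \<in> K \<Longrightarrow> u n x = 0" by blast
  define G where "G x = (\<Sum>n. u' n x)" for x
  have unif: "uniform_limit UNIV (\<lambda>n x. \<Sum>i<n. u' i x) G sequentially"
    unfolding G_def[abs_def]
  proof (rule Weierstrass_m_test)
    show "norm (u' n x) \<le> 5 * (1/2)^n" for n x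
      using le[of n x] mult_left_mono[OF \<alpha>[of n], of 5] by simp
    show "summable (\<lambda>n. 5 * (1/2::real)^n)" by (intro summable_mult summable_geometric) simp
  qed
  have contG: "continuous_on UNIV G"
    by (rule uniform_limit_theorem[OF _ unif]) (auto intro!: always_eventually continuous_intros cont)
  have "\<exists>g. \<forall>x\<in>UNIV. (\<lambda>n. u n x) sums (g x) \<and> (g has_derivative blinfun_apply (G x)) (at x within UNIV)"
  proof (rule has_derivative_series[of UNIV u "\<lambda>n x. blinfun_apply (u' n x)" "\<lambda>x. blinfun_apply (G x)" q0 0])
    show "(\<lambda>n. u n q0) sums 0" using zero[OF far0] by simp
    fix e :: real assume "e > 0"
    then have "\<forall>\<^sub>F n in sequentially. \<forall>x\<in>UNIV. dist (\<Sum>i<n. u' i x) (G x) < e"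
      using unif unfolding uniform_limit_iff by blast
    then show "\<forall>\<^sub>F n in sequentially. \<forall>x\<in>UNIV. \<forall>h. norm ((\<Sum>i<n. u' i x h) - G x h) \<le> e * norm h"
    proof eventually_elim
      case (elim n)
      show ?case
      proof (intro ballI allI)
        fix x h
        have "norm ((\<Sum>i<n. u' i x h) - G x h) = norm (((\<Sum>i<n. u' i x) - G x) h)"
          by (simp add: blinfun.diff_left blinfun.sum_left)
        also have "\<dots> \<le> norm ((\<Sum>i<n. u' i x) - G x) * norm h" by (rule norm_blinfun)
        also have "\<dots> \<le> e * norm h"
          using elim by (intro mult_right_mono) (auto simp: dist_norm less_imp_le)
        finally show "norm ((\<Sum>i<n. u' i x h) - G x h) \<le> e * norm h" .
      qed
    qed
  qed (use du in auto)
  then obtain g where g: "\<And>x. (\<lambda>n. u n x) sums g x" "\<And>x. (g has_derivative blinfun_apply (G x)) (at x)" by auto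
  define w where "w = Blinfun ?w"
  have w[simp]: "blinfun_apply w = ?w" unfolding w_def by (rule bounded_linear_Blinfun_apply[OF blw])
  define \<psi> where "\<psi> x = A (?w x) + g x" for x
  define \<psi>' where "\<psi>' x = (A o\<^sub>L w) + G x" for x
  have "(\<psi> has_derivative blinfun_apply (\<psi>' x)) (at x)" for x
  proof -
    have "((\<lambda>x. (A o\<^sub>L w) x + g x) has_derivative (\<lambda>v. (A o\<^sub>L w) v + G x v)) (at x)"
      by (intro has_derivative_add g bounded_linear_imp_has_derivative blinfun.bounded_linear_right)
    then show ?thesis by (simp add: \<psi>_def[abs_def] \<psi>'_def blinfun.add_left[abs_def])
  qed
  moreover have "continuous_on UNIV \<psi>'" unfolding \<psi>'_def[abs_def] by (intro continuous_intros contG)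
  moreover have "\<psi> x = 0" if x: "x \<in> K" for x
  proof -
    have "g x = 0" using g(1)[of x] sums_unique2[OF _ sums_zero] by (simp add: onK[OF x])
    then show ?thesis using x by (simp add: \<psi>_def proj_id[OF K])
  qed
  moreover have "\<psi>' (p n) v = \<alpha> n (?w v)" for n v
  proof -
    have "G (p n) = (\<Sum>i\<in>{n}. u' i (p n))"
      unfolding G_def by (rule suminf_finite) (use zero far in auto)
    then show ?thesis by (simp add: \<psi>'_def blinfun.add_left at_p blinfun.diff_left)
  qed
  ultimately show ?thesis by blast
qed

text \<open>
  The prescribed derivative is a function \<open>\<alpha>\<close> of the point, so that repetitions in the sequence do not
  matter. If the sequence returns to its limit infinitely often, the function \<open>\<alpha> q0 (x - proj K x)\<close>
  will do. Otherwise there is a subsequence with strictly decreasing distances to the limit along which \<open>\<alpha>\<close> converges fast.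
  Composition with the projection finally makes the function take values in \<open>K\<close>; it does not change the
  prescribed derivatives, whose values are in \<open>K\<close> already.
\<close>

theorem C1_perturbation:
  fixes K :: "'e::euclidean_space set" and A :: "'e \<Rightarrow>\<^sub>L 'e"
  assumes K: "subspace K" and q: "q \<longlonglongrightarrow> q0" and lim: "(\<lambda>i. \<alpha> (q i)) \<longlonglongrightarrow> A"
    and \<alpha>K: "\<And>i v. \<alpha> (q i) v \<in> K"
  obtains \<psi> \<psi>' where "\<And>x. (\<psi> has_derivative blinfun_apply (\<psi>' x)) (at x)" "continuous_on UNIV \<psi>'"
    "\<And>x. \<psi> x \<in> K" "\<And>x. x \<in> K \<Longrightarrow> \<psi> x = 0"
    "\<And>m::nat. \<exists>i\<ge>m. \<forall>v. \<psi>' (q i) v = \<alpha> (q i) (v - proj K v)"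
proof -
  let ?w = "\<lambda>x. x - proj K x"
  have "\<exists>\<psi> \<psi>'. (\<forall>x. (\<psi> has_derivative blinfun_apply (\<psi>' x)) (at x)) \<and> continuous_on UNIV \<psi>' \<and>
    (\<forall>x\<in>K. \<psi> x = 0) \<and> (\<forall>m::nat. \<exists>i\<ge>m. \<forall>v. \<psi>' (q i) v = \<alpha> (q i) (?w v))"
  proof (cases "\<forall>m. \<exists>i\<ge>m. q i = q0")
    case True
    have blw: "bounded_linear ?w" by (intro bounded_linear_sub bounded_linear_ident bounded_linear_proj K)
    define w where "w = Blinfun ?w"
    have w[simp]: "blinfun_apply w = ?w" unfolding w_def by (rule bounded_linear_Blinfun_apply[OF blw])
    have "(blinfun_apply (\<alpha> q0 o\<^sub>L w) has_derivative blinfun_apply (\<alpha> q0 o\<^sub>L w)) (at x)" for x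
      by (intro bounded_linear_imp_has_derivative blinfun.bounded_linear_right)
    moreover have "(\<alpha> q0 o\<^sub>L w) x = 0" if "x \<in> K" for x using that by (simp add: proj_id[OF K])
    moreover have "\<exists>i\<ge>m. \<forall>v. (\<alpha> q0 o\<^sub>L w) v = \<alpha> (q i) (?w v)" for m
    proof -
      obtain i where "i \<ge> m" "q i = q0" using True by blast
      then show ?thesis by (intro exI[of _ i]) simp
    qed
    ultimately show ?thesis
      by (intro exI[of _ "blinfun_apply (\<alpha> q0 o\<^sub>L w)"] exI[of _ "\<lambda>x. \<alpha> q0 o\<^sub>L w"]) (simp del: blinfun_apply_blinfun_compose)
  next
    case False
    then obtain m0 where m0: "\<And>i. i \<ge> m0 \<Longrightarrow> q i \<noteq> q0" by blast
    have close: "\<exists>j. j > i \<and> m0 \<le> j \<and> norm (\<alpha> (q j) - A) \<le> (1/2)^n \<and> dist (q j) q0 < d"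
      if "d > 0" for i n :: nat and d
    proof -
      have "\<forall>\<^sub>F j in sequentially. dist (\<alpha> (q j)) A < (1/2)^n" "\<forall>\<^sub>F j in sequentially. dist (q j) q0 < d"
        using tendstoD[OF lim, of "(1/2)^n"] tendstoD[OF q that] by auto
      then have "\<forall>\<^sub>F j in sequentially. j > i \<and> m0 \<le> j \<and> norm (\<alpha> (q j) - A) \<le> (1/2)^n \<and> dist (q j) q0 < d"
        using eventually_gt_at_top[of i] eventually_ge_at_top[of m0]
        by eventually_elim (auto simp: dist_norm)
      then show ?thesis using eventually_happens by fastforce
    qed
    have "\<exists>r. \<forall>n. (m0 \<le> r n \<and> norm (\<alpha> (q (r n)) - A) \<le> (1/2)^n) \<and>
        (r n < r (Suc n) \<and> dist (q (r (Suc n))) q0 < dist (q (r n)) q0)"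
    proof (rule dependent_nat_choice)
      show "\<exists>i. m0 \<le> i \<and> norm (\<alpha> (q i) - A) \<le> (1/2)^0" using close[of 1 0 0] by auto
      fix i n assume "m0 \<le> i \<and> norm (\<alpha> (q i) - A) \<le> (1/2)^n"
      then have "dist (q i) q0 > 0" using m0 by simp
      from close[OF this, of i "Suc n"]
      show "\<exists>j. (m0 \<le> j \<and> norm (\<alpha> (q j) - A) \<le> (1/2)^Suc n) \<and> i < j \<and> dist (q j) q0 < dist (q i) q0" by blast
    qed
    then obtain r where r: "\<And>n. norm (\<alpha> (q (r n)) - A) \<le> (1/2)^n" "\<And>n. r n < r (Suc n)"
      "\<And>n. dist (q (r (Suc n))) q0 < dist (q (r n)) q0" by blast
    have mono: "strict_mono r" using r(2) by (simp add: strict_mono_Suc_iff)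
    have "(\<lambda>n. q (r n)) \<longlonglongrightarrow> q0" using LIMSEQ_subseq_LIMSEQ[OF q mono] by (simp add: o_def)
    from C1_perturbation_along_sequence[OF K this r(3,1)]
    obtain \<psi> \<psi>' where \<psi>: "\<forall>x. (\<psi> has_derivative blinfun_apply (\<psi>' x)) (at x)" "continuous_on UNIV \<psi>'"
      "\<forall>x\<in>K. \<psi> x = 0" and at_r: "\<forall>n v. \<psi>' (q (r n)) v = \<alpha> (q (r n)) (?w v)" by blast
    have "\<exists>i\<ge>m. \<forall>v. \<psi>' (q i) v = \<alpha> (q i) (?w v)" for m
      using at_r strict_mono_imp_increasing[OF mono, of m] by blast
    with \<psi> show ?thesis by blast
  qed
  then obtain \<psi> \<psi>' where \<psi>: "\<And>x. (\<psi> has_derivative blinfun_apply (\<psi>' x)) (at x)" "continuous_on UNIV \<psi>'"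
    "\<And>x. x \<in> K \<Longrightarrow> \<psi> x = 0" "\<And>m. \<exists>i\<ge>m. \<forall>v. \<psi>' (q i) v = \<alpha> (q i) (?w v)" by blast
  define P where "P = Blinfun (proj K)"
  have P[simp]: "blinfun_apply P = proj K"
    unfolding P_def by (rule bounded_linear_Blinfun_apply[OF bounded_linear_proj[OF K]])
  show ?thesis
  proof (rule that[of "\<lambda>x. proj K (\<psi> x)" "\<lambda>x. P o\<^sub>L \<psi>' x"])
    show "((\<lambda>x. proj K (\<psi> x)) has_derivative blinfun_apply (P o\<^sub>L \<psi>' x)) (at x)" for x
    proof -
      have eq: "blinfun_apply (P o\<^sub>L \<psi>' x) = (\<lambda>v. proj K (\<psi>' x v))" by (rule ext) simp
      show ?thesis unfolding eq by (rule bounded_linear.has_derivative[OF bounded_linear_proj[OF K] \<psi>(1)])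
    qed
    show "continuous_on UNIV (\<lambda>x. P o\<^sub>L \<psi>' x)" by (intro continuous_intros \<psi>(2))
    show "proj K (\<psi> x) \<in> K" for x using K by simp
    show "proj K (\<psi> x) = 0" if "x \<in> K" for x
      using \<psi>(3)[OF that] linear_0[OF linear_proj[OF K]] by simp
    show "\<exists>i\<ge>m. \<forall>v. (P o\<^sub>L \<psi>' (q i)) v = \<alpha> (q i) (?w v)" for m
    proof -
      obtain i where "i \<ge> m" "\<And>v. \<psi>' (q i) v = \<alpha> (q i) (?w v)" using \<psi>(4) by blast
      then show ?thesis using \<alpha>K by (intro exI[of _ i]) (simp add: proj_id[OF K])
    qed
  qed
qed

section \<open>Transversality to retractions implies regularity\<close>

text \<open>
  A function \<open>\<psi>\<close> into \<open>K\<close> that vanishes on \<open>K\<close> turns the projection \<open>proj K\<close> into another retraction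
  \<open>proj K + \<psi>\<close> onto \<open>K\<close>, which the chart \<open>c\<close> carries to a retraction onto the leaf.
\<close>

lemma afs_regular_perturbed_projection:
  fixes N :: "('a::t2_space, 'e::euclidean_space) manifold"
    and P :: "('b::t2_space, 'g::euclidean_space) manifold"
  assumes N: "C1_manifold N" and P: "C1_manifold P" and f: "C1_map_on N P UNIV f"
    and X: "C1_submanifold N X" and y0: "y0 \<in> Y"
    and c: "y0 \<in> cdom c" "adapted_chart N (leaf f Y y0) c K"
    and tan: "\<And>y. y \<in> leaf f Y y0 \<Longrightarrow> y \<in> cdom c \<Longrightarrow>
      foliation_tangent N P f Y y = tangent_space N (leaf f Y y0) y"
    and afs: "afs_regular N P f X Y y0"
    and d\<psi>: "\<And>z. (\<psi> has_derivative blinfun_apply (\<psi>' z)) (at z)" and cont: "continuous_on UNIV \<psi>'"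
    and \<psi>K: "\<And>z. \<psi> z \<in> K" and \<psi>0: "\<And>z. z \<in> K \<Longrightarrow> \<psi> z = 0"
  obtains U where "open U" "y0 \<in> U"
    "\<And>x. x \<in> X \<inter> U \<Longrightarrow>
      (\<lambda>v. proj K v + \<psi>' (cmap c x) v) ` chart_deriv N c x ` foliation_tangent N P f X x = K"
proof -
  let ?M = "model N" and ?L = "leaf f Y y0"
  note M = C1_manifold_subspace[OF N]
  have cm: "c \<in> maximal_atlas N" and K: "subspace K" "K \<subseteq> ?M" using c by (auto simp: adapted_chart_def)
  note cc = maximal_atlas_is_chart[OF cm] and inL = adapted_chart_mem[OF c(2)]
  have yK: "cmap c y0 \<in> K" using inL[OF c(1)] mem_leaf_self[OF y0, of f] by simp
  define \<rho> where "\<rho> z = proj K z + \<psi> z" for z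
  have \<rho>K: "\<rho> z \<in> K" for z using K(1) \<psi>K by (simp add: \<rho>_def subspace_add)
  have \<rho>_id: "\<rho> z = z" if "z \<in> K" for z using that \<psi>0 by (simp add: \<rho>_def proj_id[OF K(1)])
  have d\<rho>: "(\<rho> has_derivative (\<lambda>v. proj K v + \<psi>' z v)) (at z within S)" for z S
    unfolding \<rho>_def[abs_def]
    by (intro has_derivative_add has_derivative_at_withinI[OF d\<psi>]
        bounded_linear_imp_has_derivative[OF bounded_linear_proj[OF K(1)]])
  have cont\<rho>: "continuous_on UNIV \<rho>" using d\<rho>[of _ UNIV] by (rule has_derivative_continuous_on)
  have C1\<rho>: "C1_on ?M S \<rho>" if "openin (top_of_set ?M) S" for S
  proof (rule C1_onI[OF that d\<rho>])
    show "continuous_on S (\<lambda>z. proj K v + \<psi>' z v)" for v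
      by (intro continuous_intros continuous_on_subset[OF cont]) auto
  qed
  have "openin (top_of_set ?M) (cmap c ` cdom c)" using cc by (simp add: is_chart_def)
  then obtain T where T: "open T" "cmap c ` cdom c = ?M \<inter> T" by (auto simp: openin_open)
  define \<pi> where "\<pi> x = cinv c (\<rho> (cmap c x))" for x
  define W where "W = {x \<in> cdom c. cmap c x \<in> \<rho> -` T}"
  have oW: "open W" unfolding W_def by (intro open_chart_preimage[OF cc] open_vimage[OF T(1) cont\<rho>])
  have yW: "y0 \<in> W" using c(1) yK \<rho>_id T by (auto simp: W_def)
  have W: "\<rho> (cmap c x) \<in> cmap c ` cdom c" "\<pi> x \<in> cdom c" "cmap c (\<pi> x) = \<rho> (cmap c x)" "x \<in> cdom c"
    if x: "x \<in> W" for x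
  proof -
    show \<rho>: "\<rho> (cmap c x) \<in> cmap c ` cdom c" unfolding T(2) using x \<rho>K K(2) by (auto simp: W_def)
    show "\<pi> x \<in> cdom c" "cmap c (\<pi> x) = \<rho> (cmap c x)"
      using cinv_in[OF cc \<rho>] cmap_cinv[OF cc \<rho>] by (auto simp: \<pi>_def)
    show "x \<in> cdom c" using x by (simp add: W_def)
  qed
  have \<pi>L: "\<pi> x \<in> ?L" if "x \<in> W" for x using inL[OF W(2)[OF that]] W(3)[OF that] \<rho>K by simp
  have \<pi>_id: "\<pi> x = x" if "x \<in> W" "x \<in> ?L" for x
    using W(4)[OF that(1)] inL that(2) \<rho>_id by (simp add: \<pi>_def cinv_cmap[OF cc])
  have cont\<pi>: "continuous_on W \<pi>"
    unfolding \<pi>_def[abs_def]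
  proof (rule continuous_on_compose2[OF continuous_on_cinv[OF cc]])
    show "continuous_on W (\<lambda>x. \<rho> (cmap c x))"
      by (rule continuous_on_compose2[OF cont\<rho> continuous_on_subset[OF continuous_on_cmap[OF cc]]])
        (auto simp: W_def)
  qed (use W(1) in auto)
  have \<pi>: "C1_map_on N N W \<pi>"
    unfolding C1_map_on_def
  proof (intro conjI ballI oW cont\<pi>)
    fix b d assume b: "b \<in> atlas N" and d: "d \<in> atlas N"
    have bm: "b \<in> maximal_atlas N" and dm: "d \<in> maximal_atlas N"
      using b d atlas_in_maximal_atlas[OF N] by auto
    note bc = maximal_atlas_is_chart[OF bm] and dc = maximal_atlas_is_chart[OF dm]
    let ?A = "{x \<in> W \<inter> cdom b. \<pi> x \<in> cdom d}"
    have "open (W \<inter> \<pi> -` cdom d)" by (rule continuous_open_preimage[OF cont\<pi> oW chart_open[OF dc]])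
    then have "open ((W \<inter> \<pi> -` cdom d) \<inter> cdom b)" using chart_open[OF bc] by blast
    moreover have "(W \<inter> \<pi> -` cdom d) \<inter> cdom b = ?A" by auto
    ultimately have oA: "open ?A" by simp
    have ob: "openin (top_of_set ?M) (cmap b ` ?A)" by (rule openin_cmap_image[OF bc oA]) auto
    have oc: "openin (top_of_set ?M) (cmap c ` ?A)" by (rule openin_cmap_image[OF cc oA]) (use W(4) in auto)
    have bC: "C1_on ?M (cmap b ` ?A) (cmap c \<circ> cinv b)"
      by (rule C1_on_subset[OF maximal_atlas_compatible[OF N bm cm]]) (use W(4) in auto)
    have "\<rho> ` cmap c ` ?A \<subseteq> cmap c ` (cdom c \<inter> cdom d)"
    proof
      fix z assume "z \<in> \<rho> ` cmap c ` ?A"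
      then obtain x where x: "x \<in> W" "\<pi> x \<in> cdom d" "z = \<rho> (cmap c x)" by auto
      then have "z = cmap c (\<pi> x)" "\<pi> x \<in> cdom c" using W by auto
      then show "z \<in> cmap c ` (cdom c \<inter> cdom d)" using x by blast
    qed
    note 1 = C1_on_compose(1)[OF M oc C1\<rho>[OF oc] M openin_chart_overlap[OF cm dm]
        maximal_atlas_compatible[OF N cm dm] this]
    have "C1_on ?M (cmap b ` ?A) (((cmap d \<circ> cinv c) \<circ> \<rho>) \<circ> (cmap c \<circ> cinv b))"
      by (rule C1_on_compose(1)[OF M ob bC M oc 1]) (use cinv_cmap[OF bc] in auto)
    then show "C1_on ?M (cmap b ` ?A) (cmap d \<circ> \<pi> \<circ> cinv b)"
      by (rule C1_on_cong) (simp add: \<pi>_def)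
  qed
  have "local_retraction N y0 ?L W \<pi>"
    using oW yW \<pi> \<pi>L \<pi>_id by (auto simp: local_retraction_def)
  with afs have "\<exists>U. open U \<and> y0 \<in> U \<and> U \<subseteq> W \<and> (\<forall>x\<in>X \<inter> U.
      mderiv N N \<pi> x ` foliation_tangent N P f X x = foliation_tangent N P f Y (\<pi> x))"
    by (simp add: afs_regular_def)
  then obtain U where U: "open U" "y0 \<in> U" "U \<subseteq> W"
    and onto: "\<And>x. x \<in> X \<inter> U \<Longrightarrow> mderiv N N \<pi> x ` foliation_tangent N P f X x = foliation_tangent N P f Y (\<pi> x)"
    by auto
  have "(\<lambda>v. proj K v + \<psi>' (cmap c x) v) ` chart_deriv N c x ` foliation_tangent N P f X x = K"
    if x: "x \<in> X \<inter> U" for x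
  proof -
    have xW: "x \<in> W" using x U by auto
    have T: "foliation_tangent N P f X x \<subseteq> ?M" using subspace_foliation_tangent(2)[OF N P f X] x by auto
    have oW': "openin (top_of_set ?M) (cmap c ` W)"
      by (rule openin_cmap_image[OF cc oW]) (auto simp: W_def)
    have der: "der ?M (cmap c \<circ> \<pi> \<circ> cinv c) (cmap c x) v = proj K v + \<psi>' (cmap c x) v" if v: "v \<in> ?M" for v
    proof (rule der_eq[OF M chart_in_model[OF cc W(4)[OF xW]] _ v])
      show "(cmap c \<circ> \<pi> \<circ> cinv c has_derivative (\<lambda>v. proj K v + \<psi>' (cmap c x) v)) (at (cmap c x) within ?M)"
        by (rule has_derivative_cong_openin[OF M oW' _ d\<rho>]) (use xW W in \<open>auto simp: cinv_cmap[OF cc]\<close>)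
    qed
    have "der ?M (cmap c \<circ> \<pi> \<circ> cinv c) (cmap c x) ` chart_deriv N c x ` foliation_tangent N P f X x = K"
      using mderiv_onto_tangent_space_iff[OF N c(2) \<pi> xW W(4)[OF xW] \<pi>L[OF xW] W(2)[OF xW] T]
        onto[OF x] tan[OF \<pi>L[OF xW] W(2)[OF xW]] by simp
    moreover have "chart_deriv N c x ` foliation_tangent N P f X x \<subseteq> ?M"
      using T chart_deriv_in_model[OF N cm W(4)[OF xW]] by auto
    then have "(\<lambda>v. proj K v + \<psi>' (cmap c x) v) ` chart_deriv N c x ` foliation_tangent N P f X x
        = der ?M (cmap c \<circ> \<pi> \<circ> cinv c) (cmap c x) ` chart_deriv N c x ` foliation_tangent N P f X x"
      by (intro image_cong refl der[symmetric]) blast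
    ultimately show ?thesis by simp
  qed
  with U(1,2) show ?thesis by (rule that)
qed

text \<open>
  If \<open>\<tau>\<close> does not contain the tangent space of the leaf, linear perturbations \<open>\<alpha>\<close> of the projection that
  depend on the point, and converge along a subsequence, map the tangent spaces at the points of the
  subsequence into hyperplanes of \<open>K\<close>. A retraction with these derivatives at infinitely many of the points
  contradicts the submersivity near \<open>y0\<close>.
\<close>

theorem afs_imp_af_regular:
  fixes N :: "('a::t2_space, 'e::euclidean_space) manifold"
    and P :: "('b::t2_space, 'g::euclidean_space) manifold"
  assumes N: "C1_manifold N" and P: "C1_manifold P" and f: "C1_map_on N P UNIV f"
    and X: "C1_submanifold N X" and y0: "y0 \<in> Y"
    and c: "y0 \<in> cdom c" "adapted_chart N (leaf f Y y0) c K"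
    and tan: "\<And>y. y \<in> leaf f Y y0 \<Longrightarrow> y \<in> cdom c \<Longrightarrow>
      foliation_tangent N P f Y y = tangent_space N (leaf f Y y0) y"
    and afs: "afs_regular N P f X Y y0"
  shows "af_regular N P f X Y y0"
  unfolding af_regular_def
proof (intro allI impI, rule ccontr)
  fix x0 :: "nat \<Rightarrow> 'a" and \<tau>
  let ?M = "model N" and ?L = "leaf f Y y0" and ?T = "foliation_tangent N P f X"
  define b where "b = chart_at N y0"
  assume x0X: "\<forall>i. x0 i \<in> X" and x0_lim: "x0 \<longlonglongrightarrow> y0"
    and conv: "grassmann_bundle_tendsto N x0 (\<lambda>i. ?T (x0 i)) y0 \<tau>"
    and "\<not> foliation_tangent N P f Y y0 \<subseteq> \<tau>"
  then obtain v0 where v0: "v0 \<in> foliation_tangent N P f Y y0" "v0 \<notin> \<tau>" by blast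
  have \<tau>: "subspace \<tau>" "\<tau> \<subseteq> ?M"
    and lim0: "(\<lambda>i. grassmann_dist (chart_deriv N b (x0 i) ` ?T (x0 i)) \<tau>) \<longlonglongrightarrow> 0"
    using conv by (auto simp: grassmann_bundle_tendsto_def b_def)
  have bm: "b \<in> maximal_atlas N" and yb: "y0 \<in> cdom b"
    unfolding b_def by (rule chart_at_maximal[OF N] chart_at(2)[OF N])+
  have cm: "c \<in> maximal_atlas N" and K: "subspace K" "K \<subseteq> ?M" using c by (auto simp: adapted_chart_def)
  note bc = maximal_atlas_is_chart[OF bm] and cc = maximal_atlas_is_chart[OF cm]
  note M = C1_manifold_subspace[OF N]
  have yL: "y0 \<in> ?L" by (rule mem_leaf_self[OF y0])

  have "\<forall>\<^sub>F i in sequentially. x0 i \<in> cdom c \<and> x0 i \<in> cdom b"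
    using cmap_tendsto(2)[OF cc x0_lim c(1)] cmap_tendsto(2)[OF bc x0_lim yb] by eventually_elim simp
  then obtain n0 where n0: "\<And>i. i \<ge> n0 \<Longrightarrow> x0 i \<in> cdom c \<and> x0 i \<in> cdom b"
    by (auto simp: eventually_sequentially)
  define x where "x i = x0 (i + n0)" for i
  have xX: "x i \<in> X" and xc: "x i \<in> cdom c" and xb: "x i \<in> cdom b" for i
    using x0X n0[of "i + n0"] by (auto simp: x_def)
  have x_lim: "x \<longlonglongrightarrow> y0" using LIMSEQ_ignore_initial_segment[OF x0_lim] by (simp add: x_def[abs_def])
  have T: "subspace (?T (x i))" "?T (x i) \<subseteq> ?M" for i
    using subspace_foliation_tangent[OF N P f X xX] by auto
  define V where "V i = chart_deriv N b (x i) ` ?T (x i)" for i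
  have V: "subspace (V i)" for i unfolding V_def by (rule subspace_chart_deriv_image(1)[OF N bm xb T])
  have limV: "(\<lambda>i. grassmann_dist (V i) \<tau>) \<longlonglongrightarrow> 0"
    using LIMSEQ_ignore_initial_segment[OF lim0] by (simp add: V_def x_def)
  define Q where "Q z = chart_deriv N c (cinv c z) ` ?T (cinv c z)" for z
  define p where "p i = cmap c (x i)" for i
  have p_lim: "p \<longlonglongrightarrow> cmap c y0" unfolding p_def[abs_def] by (rule cmap_tendsto(1)[OF cc x_lim c(1)])
  have Qp: "Q (p i) = chart_deriv N c (x i) ` ?T (x i)" for i
    using xc by (simp add: Q_def p_def cinv_cmap[OF cc])
  have Q: "subspace (Q (p i))" "Q (p i) \<subseteq> ?M" for i
    unfolding Qp by (rule subspace_chart_deriv_image[OF N cm xc T])+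

  \<comment> \<open>
    The vector \<open>k\<close> is tangent to the leaf but does not belong to the limit of the spaces \<open>Q (p i)\<close>, so
    that its components \<open>l (p i)\<close> normal to these spaces do not converge to 0.
  \<close>
  define k where "k = chart_deriv N c y0 v0"
  have kK: "k \<in> K"
    using chart_deriv_tangent_space[OF N c(2) yL c(1)] tan[OF yL c(1)] v0(1) by (auto simp: k_def)
  define l where "l z = k - proj (Q z) k" for z
  have "norm (l (p i)) \<le> norm k" for i unfolding l_def by (rule norm_diff_proj_le[OF Q(1)])
  then have "bounded (range (\<lambda>i. l (p i)))" by (auto simp: bounded_iff)
  then obtain l0 r where r: "strict_mono r" and l_lim: "((\<lambda>i. l (p i)) \<circ> r) \<longlonglongrightarrow> l0"
    using bounded_imp_convergent_subsequence by blast
  define q where "q i = p (r i)" for i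
  have q_lim: "q \<longlonglongrightarrow> cmap c y0" using LIMSEQ_subseq_LIMSEQ[OF p_lim r] by (simp add: q_def[abs_def] o_def)
  have lq: "(\<lambda>i. l (q i)) \<longlonglongrightarrow> l0" using l_lim by (simp add: q_def o_def)
  have l0: "l0 \<noteq> 0"
  proof
    assume "l0 = 0"
    then have "(\<lambda>i. k - l (q i)) \<longlonglongrightarrow> k" using tendsto_diff[OF tendsto_const[of k] lq] by simp
    then have proj_lim: "(\<lambda>i. proj (Q (q i)) k) \<longlonglongrightarrow> k" by (simp add: l_def)
    let ?\<theta> = "der ?M (cmap b \<circ> cinv c)" and ?A = "cmap c ` (cdom c \<inter> cdom b)"
    have oA: "openin (top_of_set ?M) ?A" by (rule openin_chart_overlap[OF cm bm])
    note C1\<theta> = maximal_atlas_compatible[OF N cm bm]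
    have qA: "q i \<in> ?A" for i using xc xb by (simp add: q_def p_def)
    have "(\<lambda>i. ?\<theta> (q i) (proj (Q (q i)) k)) \<longlonglongrightarrow> ?\<theta> (cmap c y0) k"
    proof (rule tendsto_linear_apply[OF M _ _ _ proj_lim])
      show "\<forall>\<^sub>F i in sequentially. linear (?\<theta> (q i))"
        using has_derivative_linear[OF C1_on_has_derivative[OF C1\<theta> M oA qA]] by (auto intro!: always_eventually)
      show "linear (?\<theta> (cmap c y0))"
        using has_derivative_linear[OF C1_on_has_derivative[OF C1\<theta> M oA]] yb c(1) by auto
      show "\<forall>\<^sub>F i in sequentially. proj (Q (q i)) k \<in> ?M"
        using Q proj_in unfolding q_def by (intro always_eventually allI) blast
      show "k \<in> ?M" using kK K(2) by auto
      show "(\<lambda>i. ?\<theta> (q i) v) \<longlonglongrightarrow> ?\<theta> (cmap c y0) v" if v: "v \<in> ?M" for v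
      proof (rule continuous_on_tendsto_compose[of ?A "\<lambda>z. ?\<theta> z v", OF _ q_lim])
        show "continuous_on ?A (\<lambda>z. ?\<theta> z v)" using C1\<theta> v C1_on_iff[OF M oA] by blast
      qed (use qA yb c(1) in auto)
    qed
    moreover have "?\<theta> (cmap c y0) k = v0"
    proof -
      have v0M: "v0 \<in> ?M" using v0(1) tan[OF yL c(1)] by (auto simp: tangent_space_def)
      show ?thesis
        unfolding k_def using chart_deriv_transition[OF N cm bm c(1) yb v0M] chart_deriv_self[OF N v0M, of y0]
        by (simp add: b_def)
    qed
    moreover have "?\<theta> (q i) (proj (Q (q i)) k) \<in> V (r i)" for i
    proof -
      have "proj (Q (q i)) k \<in> Q (q i)" using Q(1) by (simp add: q_def)
      then obtain v where v: "v \<in> ?T (x (r i))" "proj (Q (q i)) k = chart_deriv N c (x (r i)) v"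
        by (auto simp: q_def Qp)
      have "?\<theta> (q i) (proj (Q (q i)) k) = chart_deriv N b (x (r i)) v"
        unfolding v(2) unfolding q_def p_def
        by (rule chart_deriv_transition[OF N cm bm xc xb]) (use v(1) T(2) in blast)
      then show ?thesis using v(1) by (simp add: V_def)
    qed
    moreover have "(\<lambda>i. grassmann_dist (V (r i)) \<tau>) \<longlonglongrightarrow> 0"
      using LIMSEQ_subseq_LIMSEQ[OF limV r] by (simp add: o_def)
    ultimately have "v0 \<in> \<tau>"
      by (intro grassmann_limit_mem[of sequentially "\<lambda>i. V (r i)" \<tau> "\<lambda>i. ?\<theta> (q i) (proj (Q (q i)) k)"])
        (auto intro: always_eventually V \<tau>)
    with v0(2) show False by simp
  qed

  \<comment> \<open>
    With \<open>a\<close> and \<open>l - a\<close> the components of \<open>l\<close> along \<open>K\<close> and normal to it, the map \<open>\<alpha>\<close> satisfies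
    \<open>a \<bullet> (proj K v + \<alpha> (v - proj K v)) = l \<bullet> v\<close>. So \<open>proj K + \<alpha> \<circ> (1 - proj K)\<close> maps the vectors
    normal to \<open>l\<close> to vectors of \<open>K\<close> normal to \<open>a\<close>.
  \<close>
  define a where "a z = proj K (l z)" for z
  define \<alpha> where "\<alpha> z = Blinfun (\<lambda>v. (((l z - a z) \<bullet> v) / (a z \<bullet> a z)) *\<^sub>R a z)" for z
  have bl: "bounded_linear (\<lambda>v. ((w \<bullet> v) / s) *\<^sub>R u)" for w u :: 'e and s :: real
    by (intro bounded_linear_scaleR_const
        bounded_linear_compose[OF bounded_linear_divide bounded_linear_inner_right])
  have \<alpha>[simp]: "\<alpha> z v = (((l z - a z) \<bullet> v) / (a z \<bullet> a z)) *\<^sub>R a z" for z v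
    unfolding \<alpha>_def by (simp add: bounded_linear_Blinfun_apply[OF bl])
  define a0 where "a0 = proj K l0"
  define A where "A = Blinfun (\<lambda>v. (((l0 - a0) \<bullet> v) / (a0 \<bullet> a0)) *\<^sub>R a0)"
  have A[simp]: "A v = (((l0 - a0) \<bullet> v) / (a0 \<bullet> a0)) *\<^sub>R a0" for v
    unfolding A_def by (simp add: bounded_linear_Blinfun_apply[OF bl])
  have aq: "(\<lambda>i. a (q i)) \<longlonglongrightarrow> a0"
    unfolding a_def a0_def by (rule bounded_linear.tendsto[OF bounded_linear_proj[OF K(1)] lq])
  have a0: "a0 \<noteq> 0"
  proof
    assume "a0 = 0"
    have "k \<bullet> l (q i) = l (q i) \<bullet> l (q i)" for i
    proof -
      have "proj (Q (q i)) k \<in> Q (q i)" "subspace (Q (q i))" using Q(1) by (simp_all add: q_def)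
      then have "l (q i) \<bullet> proj (Q (q i)) k = 0" unfolding l_def by (intro proj_orthogonal)
      then show ?thesis by (simp add: l_def inner_diff_right inner_diff_left inner_commute)
    qed
    then have "(\<lambda>i. k \<bullet> l (q i)) \<longlonglongrightarrow> l0 \<bullet> l0" using tendsto_inner[OF lq lq] by simp
    moreover have "(\<lambda>i. k \<bullet> l (q i)) \<longlonglongrightarrow> k \<bullet> l0" by (intro tendsto_intros lq)
    ultimately have "k \<bullet> l0 = l0 \<bullet> l0" using LIMSEQ_unique by blast
    moreover have "k \<bullet> l0 = k \<bullet> a0" using proj_inner[OF K(1) kK, of l0] by (simp add: a0_def inner_commute)
    ultimately show False using \<open>a0 = 0\<close> l0 by simp
  qed
  have \<alpha>_lim: "(\<lambda>i. \<alpha> (q i)) \<longlonglongrightarrow> A"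
    by (rule tendsto_componentwise1) (use a0 in \<open>auto intro!: tendsto_intros aq lq\<close>)
  have aK: "a z \<in> K" for z unfolding a_def by (rule proj_in[OF K(1)])
  have \<alpha>K: "\<alpha> (q i) v \<in> K" for i v using aK K(1) by (simp add: subspace_scale)
  obtain \<psi> \<psi>' where \<psi>: "\<And>z. (\<psi> has_derivative blinfun_apply (\<psi>' z)) (at z)" "continuous_on UNIV \<psi>'"
    "\<And>z. \<psi> z \<in> K" "\<And>z. z \<in> K \<Longrightarrow> \<psi> z = 0"
    and \<psi>q: "\<And>m. \<exists>i\<ge>m. \<forall>v. \<psi>' (q i) v = \<alpha> (q i) (v - proj K v)"
    by (rule C1_perturbation[OF K(1) q_lim \<alpha>_lim \<alpha>K]) (rule that)
  obtain U where U: "open U" "y0 \<in> U"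
    and onto: "\<And>x. x \<in> X \<inter> U \<Longrightarrow> (\<lambda>v. proj K v + \<psi>' (cmap c x) v) ` chart_deriv N c x ` ?T x = K"
    by (rule afs_regular_perturbed_projection[OF N P f X y0 c tan afs \<psi>]) (assumption | rule that)+
  have xr_lim: "(\<lambda>i. x (r i)) \<longlonglongrightarrow> y0" using LIMSEQ_subseq_LIMSEQ[OF x_lim r] by (simp add: o_def)
  have "\<forall>\<^sub>F i in sequentially. x (r i) \<in> U \<and> a (q i) \<noteq> 0"
    using topological_tendstoD[OF xr_lim U] tendsto_imp_eventually_ne[OF aq a0] by eventually_elim simp
  then obtain m where m: "\<And>i. i \<ge> m \<Longrightarrow> x (r i) \<in> U \<and> a (q i) \<noteq> 0" by (auto simp: eventually_sequentially)
  obtain i where i: "i \<ge> m" "\<And>v. \<psi>' (q i) v = \<alpha> (q i) (v - proj K v)" using \<psi>q by blast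
  have ai: "a (q i) \<noteq> 0" and xU: "x (r i) \<in> X \<inter> U" using m[OF i(1)] xX by auto
  have "a (q i) \<in> (\<lambda>v. proj K v + \<psi>' (q i) v) ` Q (q i)"
    using onto[OF xU] aK by (simp add: q_def Qp) (simp add: p_def)
  then obtain v where v: "v \<in> Q (q i)" "a (q i) = proj K v + \<psi>' (q i) v" by blast
  have normal: "(l (q i) - a (q i)) \<bullet> u = 0" if "u \<in> K" for u
    unfolding a_def by (rule proj_orthogonal[OF K(1) that])
  have "a (q i) \<bullet> a (q i) = a (q i) \<bullet> proj K v + (l (q i) - a (q i)) \<bullet> (v - proj K v)"
    using arg_cong[OF v(2), of "\<lambda>u. a (q i) \<bullet> u"] ai
    unfolding i(2) \<alpha> inner_add_right inner_scaleR_right by simp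
  also have "\<dots> = l (q i) \<bullet> v"
    using normal[OF proj_in[OF K(1)]] proj_inner[OF K(1) aK, of v "q i"]
    by (simp add: inner_diff_left inner_diff_right inner_commute)
  also have "\<dots> = 0"
    unfolding l_def by (rule proj_orthogonal[OF _ v(1)]) (use Q(1) in \<open>simp add: q_def\<close>)
  finally show False using ai by simp
qed

theorem theorem6p1:
  fixes N :: "('a::t2_space, 'e::euclidean_space) manifold"
    and P :: "('b::t2_space, 'g::euclidean_space) manifold"
    and f :: "'a \<Rightarrow> 'b"
    and X Y :: "'a set"
    and y\<^sub>0 :: 'a
  assumes "C1_manifold N" and "C1_manifold P"
    and "C1_map_on N P UNIV f"
    and "C1_submanifold N X" and "C1_submanifold N Y"
    and "constant_rank_on N P f X" and "constant_rank_on N P f Y"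
    and "y\<^sub>0 \<in> Y \<inter> closure X"
  shows "af_regular N P f X Y y\<^sub>0 \<longleftrightarrow> afs_regular N P f X Y y\<^sub>0"
proof -
  have y0: "y\<^sub>0 \<in> Y" using assms(8) by simp
  obtain c K where c: "y\<^sub>0 \<in> cdom c" "adapted_chart N (leaf f Y y\<^sub>0) c K"
    and tan: "\<And>y. y \<in> leaf f Y y\<^sub>0 \<Longrightarrow> y \<in> cdom c \<Longrightarrow>
      foliation_tangent N P f Y y = tangent_space N (leaf f Y y\<^sub>0) y"
    using leaf_adapted_chart[OF assms(1,2,3,5,7) y0] by metis
  show ?thesis
    using af_imp_afs_regular[OF assms(1-4) y0 c tan] afs_imp_af_regular[OF assms(1-4) y0 c tan] by blast
qed

end
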